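(* Let $c=(c_{mi})_{1\le i\le m\le n}\in\mathbb C^{n(n+1)/2}$ and let $M_c(n)$ be the set of all $n\times n$ complex matrices $B$ such that $$\det\bigl(z-B_{(m)}\bigr)=\chi_m(z):=z^m+\sum_{i=1}^mc_{mi}z^{i-1},\qquad m=1,\dots,n.$$ Suppose that the polynomials $\chi_1,\dots,\chi_n$ have $r$ distinct roots $z_1,\dots,z_r$ in total, and for $i=1,\dots,r$ set $t_i=\#\{j\in\{1,\dots,n-1\};\ \chi_j(z_i)=0=\chi_{j+1}(z_i)\}$. Let $t=\sum_{i=1}^rt_i$. Then $M_c(n)$ contains exactly $2^t$ orbits of maximal dimension of the Gelfand-Zeitlin action.
   Context: $B_{(m)}$ denotes the upper-left $m\times m$ block of an $n\times n$ matrix $B$. The Gelfand-Zeitlin action is the action of the group $\mathbb C^{n(n-1)/2}$ on $\mathfrak{gl}(n,\mathbb C)$ generated by the commuting actions of $\mathbb C$, one for each $1\le i\le m\le n-1$, given by $z.B=\mathrm{Ad}\bigl(e^{z(B_{(m)})^{i-1}}\bigr)B$, where $(B_{(m)})^{i-1}$ (an $m\times m$ matrix) is extended by zeros to an $n\times n$ matrix. This action preserves each $M_c(n)$. An orbit of maximal dimension is an orbit of dimension $n(n-1)/2$, i.e. an orbit with discrete stabiliser. *)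

theory Defs
  imports
    "HOL-Analysis.Isolated"
    "HOL-Analysis.Function_Topology"
    "HOL-Algebra.Group_Action"
    "Jordan_Normal_Form.Char_Poly"
    "Jordan_Normal_Form.Gauss_Jordan_Elimination"
begin

definition upper_left :: "nat \<Rightarrow> complex mat \<Rightarrow> complex mat" where
  "upper_left m B = mat m m (\<lambda>(j, k). B $$ (j, k))"

definition extend_by_zeros :: "nat \<Rightarrow> complex mat \<Rightarrow> complex mat" where
  "extend_by_zeros n X =
     (let m = dim_row X
      in four_block_mat X (0\<^sub>m m (n - m)) (0\<^sub>m (n - m) m) (0\<^sub>m (n - m) (n - m)))"

(* The exponential series of a square matrix, summed entrywise; it converges for every X. *)
definition mat_exp :: "complex mat \<Rightarrow> complex mat" where
  "mat_exp X = mat (dim_row X) (dim_row X) (\<lambda>(j, k). \<Sum>p. (X ^\<^sub>m p) $$ (j, k) / fact p)"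

(* Only used for invertible g, for which mat_inverse g = Some (inverse of g). *)
definition Ad :: "complex mat \<Rightarrow> complex mat \<Rightarrow> complex mat" where
  "Ad g B = g * B * the (mat_inverse g)"

(* For i = 1 the exponent involves the m x m identity extended by zeros,
   not the n x n identity. *)
definition gz_flow :: "nat \<Rightarrow> nat \<Rightarrow> nat \<Rightarrow> complex \<Rightarrow> complex mat \<Rightarrow> complex mat" where
  "gz_flow n m i z B = Ad (mat_exp (z \<cdot>\<^sub>m extend_by_zeros n (upper_left m B ^\<^sub>m (i - 1)))) B"

definition gz_indices :: "nat \<Rightarrow> (nat \<times> nat) set" where
  "gz_indices n = {(m, i). 1 \<le> i \<and> i \<le> m \<and> m \<le> n - 1}"

(* The additive group of complex n(n-1)/2-tuples, as the functions supported on gz_indices n.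
   The product topology on the function type induces the usual topology on it. *)
definition gz_group :: "nat \<Rightarrow> (nat \<times> nat \<Rightarrow> complex) monoid" where
  "gz_group n =
     \<lparr>carrier = {z. \<forall>p. p \<notin> gz_indices n \<longrightarrow> z p = 0},
      monoid.mult = (\<lambda>z w p. z p + w p),
      one = (\<lambda>p. 0)\<rparr>"

(* The flows commute, so the order of composition is immaterial.
   The restriction to n x n matrices is the format of the locale group_action. *)
definition gz_action :: "nat \<Rightarrow> (nat \<times> nat \<Rightarrow> complex) \<Rightarrow> complex mat \<Rightarrow> complex mat" where
  "gz_action n z = (\<lambda>B \<in> carrier_mat n n.
     foldr (\<lambda>(m, i). gz_flow n m i (z (m, i)))
       [(m, i). m \<leftarrow> [1..<n], i \<leftarrow> [1..<Suc m]] B)"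

definition gz_orbits :: "nat \<Rightarrow> complex mat set set" where
  "gz_orbits n = Group_Action.orbits (gz_group n) (carrier_mat n n) (gz_action n)"

(* Meant for orbits Q: dimension n(n-1)/2 amounts to discrete stabilisers. *)
definition gz_maximal_dimension :: "nat \<Rightarrow> complex mat set \<Rightarrow> bool" where
  "gz_maximal_dimension n Q \<longleftrightarrow>
     (\<forall>B \<in> Q. discrete (Group_Action.stabilizer (gz_group n) (gz_action n) B))"

definition chi :: "(nat \<Rightarrow> nat \<Rightarrow> complex) \<Rightarrow> nat \<Rightarrow> complex poly" where
  "chi c m = monom 1 m + (\<Sum>i = 1..m. monom (c m i) (i - 1))"

definition M_set :: "(nat \<Rightarrow> nat \<Rightarrow> complex) \<Rightarrow> nat \<Rightarrow> complex mat set" where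
  "M_set c n = {B \<in> carrier_mat n n. \<forall>m \<in> {1..n}. char_poly (upper_left m B) = chi c m}"

end

theory Submission
  imports Defs "HOL-Analysis.Complex_Transcendental"
    "HOL-Computational_Algebra.Field_as_Ring"
begin

text \<open>
  Write \<open>B\<^sub>m\<^sub>+\<^sub>1\<close> as \<open>A = B\<^sub>m\<close> bordered by a column \<open>b\<close>, a row \<open>c\<close> and a corner \<open>d\<close>. An orbit has maximal
  dimension iff at every level no nonzero polynomial \<open>p\<close> of degree below \<open>m\<close> satisfies
  \<open>p(A) b = 0\<close> and \<open>c p(A) = 0\<close>. Then every \<open>B\<^sub>m\<close> is nonderogatory, so with a cyclic vector \<open>v\<close> and the
  dual covector \<open>l\<close> one has \<open>b = \<beta>(A) v\<close>, \<open>c = l \<gamma>(A)\<close>, and, with \<open>\<chi>\<close> the characteristic polynomial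
  of \<open>A\<close>, that of \<open>B\<^sub>m\<^sub>+\<^sub>1\<close> is \<open>(x - d) \<chi> - (\<beta> \<gamma> mod \<chi>)\<close>. The flows of level \<open>m\<close> multiply \<open>\<beta>\<close> and
  divide \<open>\<gamma>\<close> by an arbitrary unit modulo \<open>\<chi>\<close>. At a root of \<open>\<chi>\<close> that is also a root of the next
  characteristic polynomial, exactly one of \<open>\<beta>\<close> and \<open>\<gamma>\<close> vanishes; these binary choices are invariant
  and arbitrary, and they determine the orbit.
\<close>

section \<open>Polynomials of a matrix\<close>

text \<open>Why a common root offers two choices whatever its multiplicity: at a root w of \<chi> of
  multiplicity k, look at the local ring C[x]/(x - w)^k. Strong regularity makes \<beta> or \<gamma>
  a unit there. A flow normalises that unit to 1, and the product, hence the next characteristic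
  polynomial, then fixes the other one. The next polynomial takes the value -\<beta>(w)\<gamma>(w)
  at w, so both are units unless w is a common root. The proof handles all roots at once: a generic
  scalar replaces the splitting into local rings. That the flows reach every unit modulo \<chi> is
  the surjectivity of exp onto the units of C[x]/(\<chi>), which rests on scalar logarithms at the
  roots. The vectors v and l are not canonical. Therefore \<open>excites\<close> and
  \<open>sreg_at\<close> are stated without them, which makes invariance under conjugation
  immediate; the coordinates \<beta>, \<gamma> serve only within one bordering step. Discreteness
  and strong regularity meet in two ways: exp is injective near 0, and a violating p produces a
  whole complex line in the stabiliser.\<close>

definition poly_mat :: "complex mat \<Rightarrow> complex poly \<Rightarrow> complex mat" where
  "poly_mat A p = fold_coeffs (\<lambda>a M. a \<cdot>\<^sub>m 1\<^sub>m (dim_row A) + A * M) p (0\<^sub>m (dim_row A) (dim_row A))"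

lemma poly_mat_0: "poly_mat A 0 = 0\<^sub>m (dim_row A) (dim_row A)"
  by (simp add: poly_mat_def)

text \<open>Horner's recursion. The pair \<open>p = 0\<close>, \<open>a = 0\<close> is treated apart
  because \<open>fold_coeffs\<close> takes no step on the zero polynomial.\<close>

lemma poly_mat_pCons:
  assumes "A \<in> carrier_mat m m"
  shows "poly_mat A (pCons a p) = a \<cdot>\<^sub>m 1\<^sub>m m + A * poly_mat A p"
proof (cases "p = 0 \<and> a = 0")
  case True
  have "0 \<cdot>\<^sub>m 1\<^sub>m m + A * 0\<^sub>m m m = (0\<^sub>m m m :: complex mat)"
    using assms by (intro eq_matI) auto
  with True assms show ?thesis by (simp add: poly_mat_def)
next
  case False
  with assms show ?thesis by (auto simp: poly_mat_def fold_coeffs_pCons_coeff_not_0_eq fold_coeffs_pCons_not_0_0_eq)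
qed

lemma poly_mat_closed [simp]:
  assumes "A \<in> carrier_mat m m"
  shows "poly_mat A p \<in> carrier_mat m m"
  by (induction p) (use assms in \<open>auto simp: poly_mat_0 poly_mat_pCons\<close>)

lemma poly_mat_dim [simp]:
  assumes "A \<in> carrier_mat m m"
  shows "dim_row (poly_mat A p) = m" "dim_col (poly_mat A p) = m"
  using poly_mat_closed[OF assms, of p] by auto

lemma poly_mat_add:
  assumes A: "A \<in> carrier_mat m m"
  shows "poly_mat A (p + q) = poly_mat A p + poly_mat A q"
proof (induction p q rule: poly_induct2)
  case 0
  then show ?case using A by (simp add: poly_mat_0)
next
  case (pCons a p b q)
  have "A * (poly_mat A p + poly_mat A q) = A * poly_mat A p + A * poly_mat A q"
    using A by (intro mult_add_distrib_mat[of _ m m _ m]) auto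
  with pCons A show ?case
    by (auto simp: poly_mat_pCons algebra_simps intro!: eq_matI)
qed

lemma poly_mat_smult:
  assumes A: "A \<in> carrier_mat m m"
  shows "poly_mat A (Polynomial.smult a p) = a \<cdot>\<^sub>m poly_mat A p"
proof (induction p)
  case 0
  then show ?case using A by (simp add: poly_mat_0)
next
  case (pCons b p)
  have "A * (a \<cdot>\<^sub>m poly_mat A p) = a \<cdot>\<^sub>m (A * poly_mat A p)"
    using A by (intro mult_smult_distrib[of _ m m _ m]) auto
  with pCons A show ?case
    by (auto simp: poly_mat_pCons algebra_simps intro!: eq_matI)
qed

lemma poly_mat_uminus:
  assumes A: "A \<in> carrier_mat m m"
  shows "poly_mat A (- p) = - poly_mat A p"
  using poly_mat_smult[OF A, of "-1" p] A by (auto intro!: eq_matI)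

lemma poly_mat_diff:
  assumes A: "A \<in> carrier_mat m m"
  shows "poly_mat A (p - q) = poly_mat A p - poly_mat A q"
  using poly_mat_add[OF A, of p "-q"] A by (auto simp: poly_mat_uminus intro!: eq_matI)

lemma poly_mat_mult:
  assumes A: "A \<in> carrier_mat m m"
  shows "poly_mat A (p * q) = poly_mat A p * poly_mat A q"
proof (induction p)
  case 0
  then show ?case using A by (simp add: poly_mat_0)
next
  case (pCons a p)
  have "poly_mat A (pCons a p * q) = a \<cdot>\<^sub>m poly_mat A q + A * poly_mat A (p * q)"
    using A by (auto simp: poly_mat_add poly_mat_smult poly_mat_pCons intro!: eq_matI)
  also have "A * poly_mat A (p * q) = A * poly_mat A p * poly_mat A q"
    using A by (simp add: pCons assoc_mult_mat[of _ m m _ m _ m])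
  also have "a \<cdot>\<^sub>m poly_mat A q = a \<cdot>\<^sub>m 1\<^sub>m m * poly_mat A q"
    using A by (simp add: mult_smult_assoc_mat[of _ m m _ m])
  also have "a \<cdot>\<^sub>m 1\<^sub>m m * poly_mat A q + A * poly_mat A p * poly_mat A q
      = (a \<cdot>\<^sub>m 1\<^sub>m m + A * poly_mat A p) * poly_mat A q"
    using A by (intro add_mult_distrib_mat[symmetric, of _ m m _ _ m]) auto
  finally show ?case using A by (simp add: poly_mat_pCons)
qed

lemma poly_mat_1: "A \<in> carrier_mat m m \<Longrightarrow> poly_mat A 1 = 1\<^sub>m m"
  unfolding one_pCons by (auto simp: poly_mat_pCons poly_mat_0 intro!: eq_matI)

lemma poly_mat_const: "A \<in> carrier_mat m m \<Longrightarrow> poly_mat A [:a:] = a \<cdot>\<^sub>m 1\<^sub>m m"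
  by (auto simp: poly_mat_pCons poly_mat_0 intro!: eq_matI)

lemma poly_mat_linear: "A \<in> carrier_mat m m \<Longrightarrow> poly_mat A [:a, 1:] = a \<cdot>\<^sub>m 1\<^sub>m m + A"
  by (auto simp: poly_mat_pCons poly_mat_0 intro!: eq_matI)

lemma poly_mat_power: "A \<in> carrier_mat m m \<Longrightarrow> poly_mat A (p ^ k) = poly_mat A p ^\<^sub>m k"
proof (induction k)
  case 0
  then show ?case by (simp add: poly_mat_1)
next
  case (Suc k)
  then show ?case using poly_mat_mult[OF Suc.prems, of "p^k" p] by (simp add: mult.commute)
qed

lemma poly_mat_monom: "A \<in> carrier_mat m m \<Longrightarrow> poly_mat A (monom a k) = a \<cdot>\<^sub>m A ^\<^sub>m k"
proof -
  assume A: "A \<in> carrier_mat m m"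
  have "monom a k = Polynomial.smult a ([:0, 1:] ^ k)" by (simp add: monom_altdef)
  moreover have "poly_mat A [:0, 1:] = A" using A by (auto simp: poly_mat_linear intro!: eq_matI)
  ultimately show ?thesis using A by (simp add: poly_mat_smult poly_mat_power)
qed

lemma poly_mat_commute:
  assumes "A \<in> carrier_mat m m"
  shows "poly_mat A p * poly_mat A q = poly_mat A q * poly_mat A p"
  using poly_mat_mult[OF assms, of p q] poly_mat_mult[OF assms, of q p] by (simp add: mult.commute)

lemma poly_mat_index_sum:
  assumes A: "A \<in> carrier_mat m m" and "i < m" "j < m"
  shows "poly_mat A (\<Sum>k\<in>S. f k) $$ (i, j) = (\<Sum>k\<in>S. poly_mat A (f k) $$ (i, j))"
  by (induction S rule: infinite_finite_induct) (use assms in \<open>auto simp: poly_mat_add poly_mat_0\<close>)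

lemma poly_mat_index:
  assumes A: "A \<in> carrier_mat m m" and ij: "i < m" "j < m" and "degree p < N"
  shows "poly_mat A p $$ (i, j) = (\<Sum>k<N. coeff p k * (A ^\<^sub>m k) $$ (i, j))"
proof -
  have "p = (\<Sum>k<N. monom (coeff p k) k)"
    using assms(4) by (intro poly_eqI) (auto simp: coeff_sum coeff_eq_0)
  then have "poly_mat A p $$ (i, j) = (\<Sum>k<N. poly_mat A (monom (coeff p k) k) $$ (i, j))"
    using poly_mat_index_sum[OF A ij, of "\<lambda>k. monom (coeff p k) k" "{..<N}"] by simp
  with A ij show ?thesis by (simp add: poly_mat_monom)
qed

text \<open>\<open>X\<close> may be rectangular: a square \<open>X\<close> covers commutation and
  conjugation, a column \<open>X\<close> with a 1 x 1 matrix on the other side covers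
  eigenvectors.\<close>

lemma poly_mat_intertwine:
  assumes A: "A \<in> carrier_mat m m" and B: "B \<in> carrier_mat k k" and X: "X \<in> carrier_mat k m"
    and XA: "X * A = B * X"
  shows "X * poly_mat A p = poly_mat B p * X"
proof (induction p)
  case 0
  then show ?case using A B X by (simp add: poly_mat_0)
next
  case (pCons a p)
  have "X * poly_mat A (pCons a p) = X * (a \<cdot>\<^sub>m 1\<^sub>m m) + X * (A * poly_mat A p)"
    unfolding poly_mat_pCons[OF A] by (rule mult_add_distrib_mat[of _ k m _ m]) (use A B X in auto)
  also have "X * (a \<cdot>\<^sub>m 1\<^sub>m m) = a \<cdot>\<^sub>m 1\<^sub>m k * X"
    using X by (simp add: mult_smult_distrib[of _ k m _ m] mult_smult_assoc_mat[of _ k k _ m])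
  also have "X * (A * poly_mat A p) = B * (X * poly_mat A p)"
    using A B X XA by (simp flip: assoc_mult_mat[of _ k m _ m _ m] assoc_mult_mat[of _ k k _ m _ m])
  also have "\<dots> = B * poly_mat B p * X"
    unfolding pCons.IH by (rule assoc_mult_mat[symmetric, of _ k k _ k _ m]) (use A B X in auto)
  also have "a \<cdot>\<^sub>m 1\<^sub>m k * X + B * poly_mat B p * X = (a \<cdot>\<^sub>m 1\<^sub>m k + B * poly_mat B p) * X"
    by (rule add_mult_distrib_mat[symmetric, of _ k k]) (use A B X in auto)
  finally show ?case using B by (simp add: poly_mat_pCons)
qed

lemma poly_mat_transpose:
  assumes A: "A \<in> carrier_mat m m"
  shows "poly_mat (transpose_mat A) p = transpose_mat (poly_mat A p)"
proof (induction p)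
  case 0
  then show ?case using A by (simp add: poly_mat_0)
next
  case (pCons a p)
  have "poly_mat (transpose_mat A) (pCons a p) = a \<cdot>\<^sub>m 1\<^sub>m m + transpose_mat (poly_mat A p * A)"
    using A by (simp add: poly_mat_pCons[of _ m] pCons.IH transpose_mult[of _ m m _ m])
  also have "poly_mat A p * A = A * poly_mat A p"
    using poly_mat_intertwine[OF A A A refl, of p] by simp
  also have "a \<cdot>\<^sub>m 1\<^sub>m m + transpose_mat (A * poly_mat A p) = transpose_mat (a \<cdot>\<^sub>m 1\<^sub>m m + A * poly_mat A p)"
    using A by (auto intro!: eq_matI)
  finally show ?case using A by (simp add: poly_mat_pCons)
qed

text \<open>Applied to the columns \<open>u\<close> of \<open>adj (x - A)\<close>, the substitution \<open>u \<mapsto> \<Sum>i. u\<^sub>i(A) e\<^sub>i\<close>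
  kills every multiple of \<open>x - A\<close>.\<close>
theorem cayley_hamilton:
  assumes A: "A \<in> carrier_mat m m"
  shows "poly_mat A (char_poly A) = 0\<^sub>m m m"
proof (rule eq_matI, goal_cases)
  case (1 r j)
  then have r: "r < m" and j: "j < m" by auto
  define C where "C = char_poly_matrix A"
  have C: "C \<in> carrier_mat m m" unfolding C_def using A by simp
  have adj: "adj_mat C \<in> carrier_mat m m" "C * adj_mat C = char_poly A \<cdot>\<^sub>m 1\<^sub>m m"
    using adj_mat[OF C] by (auto simp: char_poly_def C_def)
  define u where "u l = adj_mat C $$ (l, j)" for l
  have Cil: "C $$ (i, l) = (if i = l then [:0, 1:] else 0) - [:A $$ (i, l):]" if "i < m" "l < m" for i l
    using that A by (simp add: C_def char_poly_matrix_def)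
  have prod: "(\<Sum>l<m. C $$ (i, l) * u l) = (if i = j then char_poly A else 0)" if i: "i < m" for i
  proof -
    have "(\<Sum>l<m. C $$ (i, l) * u l) = (C * adj_mat C) $$ (i, j)"
      using i j C adj(1) by (simp add: scalar_prod_def u_def atLeast0LessThan)
    then show ?thesis using adj(2) i j by simp
  qed
  have x: "poly_mat A (u l * [:0, 1:]) $$ (r, l) = (\<Sum>s<m. poly_mat A (u l) $$ (r, s) * A $$ (s, l))" if "l < m" for l
  proof -
    have "poly_mat A [:0, 1:] = A" using A by (auto simp: poly_mat_linear intro!: eq_matI)
    then show ?thesis using poly_mat_mult[OF A, of "u l" "[:0,1:]"] r that A
      by (simp add: scalar_prod_def atLeast0LessThan)
  qed
  have "poly_mat A (char_poly A) $$ (r, j) = (\<Sum>i<m. poly_mat A (if i = j then char_poly A else 0) $$ (r, i))"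
    using r j A by (simp add: if_distrib[of "poly_mat A"] if_distribR if_distrib[of "\<lambda>M. M $$ _"] poly_mat_0 cong: if_cong)
  also have "\<dots> = (\<Sum>i<m. poly_mat A (\<Sum>l<m. C $$ (i, l) * u l) $$ (r, i))"
    by (intro sum.cong refl) (simp add: prod)
  also have "\<dots> = (\<Sum>i<m. \<Sum>l<m. poly_mat A (C $$ (i, l) * u l) $$ (r, i))"
    using A r by (simp add: poly_mat_index_sum)
  \<comment> \<open>Each entry of x - A splits into x on the diagonal and a constant. By
    \<open>x\<close> and an exchange of the sums, the two contributions cancel.\<close>
  also have "\<dots> = (\<Sum>i<m. \<Sum>l<m. (if i = l then poly_mat A (u l * [:0, 1:]) $$ (r, i) else 0)
       - A $$ (i, l) * poly_mat A (u l) $$ (r, i))"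
    using A r by (intro sum.cong refl)
      (auto simp: Cil left_diff_distrib poly_mat_diff poly_mat_smult poly_mat_0 poly_mat_uminus mult.commute)
  also have "\<dots> = (\<Sum>i<m. poly_mat A (u i * [:0, 1:]) $$ (r, i)) - (\<Sum>i<m. \<Sum>l<m. A $$ (i, l) * poly_mat A (u l) $$ (r, i))"
    by (simp add: sum_subtractf)
  also have "(\<Sum>i<m. \<Sum>l<m. A $$ (i, l) * poly_mat A (u l) $$ (r, i)) = (\<Sum>l<m. \<Sum>i<m. A $$ (i, l) * poly_mat A (u l) $$ (r, i))"
    by (rule sum.swap)
  also have "(\<Sum>i<m. poly_mat A (u i * [:0, 1:]) $$ (r, i)) = \<dots>"
    by (intro sum.cong refl) (subst x, auto simp: mult.commute)
  finally show ?case using r j by simp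
qed (use A in auto)

section \<open>The matrix exponential\<close>

lemma smult_one_mat [simp]: "1 \<cdot>\<^sub>m (Y :: complex mat) = Y"
  by auto

lemma pow_mat_index_Suc:
  assumes "X \<in> carrier_mat m m" "i < m" "j < m"
  shows "(X ^\<^sub>m Suc p) $$ (i, j) = (\<Sum>l<m. (X ^\<^sub>m p) $$ (i, l) * X $$ (l, j))"
  using assms by (simp add: scalar_prod_def atLeast0LessThan)

text \<open>The number m times the largest modulus of an entry is submultiplicative, hence the
  factor \<open>real m\<close> on the left. The power 0 is left out because the identity violates
  the bound once m > 1.\<close>

lemma norm_pow_mat_le:
  fixes X :: "complex mat"
  assumes X: "X \<in> carrier_mat m m" and M: "\<And>i j. i < m \<Longrightarrow> j < m \<Longrightarrow> norm (X $$ (i, j)) \<le> M"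
    and "i < m" "j < m"
  shows "real m * norm ((X ^\<^sub>m Suc p) $$ (i, j)) \<le> (real m * M) ^ Suc p"
  using assms(3,4)
proof (induction p arbitrary: i j)
  case 0
  then show ?case using M X by (simp add: mult_left_mono)
next
  case (Suc p)
  have "norm ((X ^\<^sub>m Suc (Suc p)) $$ (i, j)) \<le> (\<Sum>l<m. norm ((X ^\<^sub>m Suc p) $$ (i, l)) * norm (X $$ (l, j)))"
    unfolding pow_mat_index_Suc[OF X Suc.prems] norm_mult[symmetric] by (rule norm_sum)
  also have "\<dots> \<le> (\<Sum>l<m. norm ((X ^\<^sub>m Suc p) $$ (i, l)) * M)"
    using M Suc.prems by (intro sum_mono mult_left_mono) auto
  finally have "real m * norm ((X ^\<^sub>m Suc (Suc p)) $$ (i, j)) \<le> (\<Sum>l<m. (real m * norm ((X ^\<^sub>m Suc p) $$ (i, l))) * M)"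
    by (simp add: sum_distrib_left mult_left_mono mult.assoc flip: sum_distrib_left)
  also have "\<dots> \<le> (\<Sum>l<m. (real m * M) ^ Suc p * M)"
  proof (intro sum_mono mult_right_mono)
    show "0 \<le> M" using M[OF Suc.prems] norm_ge_zero order_trans by blast
  qed (use Suc in auto)
  also have "\<dots> = (real m * M) ^ Suc (Suc p)" by simp
  finally show ?case .
qed

lemma entry_bound:
  fixes X :: "complex mat"
  obtains M where "M > 0" "\<And>i j. i < m \<Longrightarrow> j < m \<Longrightarrow> norm (X $$ (i, j)) \<le> M"
proof
  show "(1 + (\<Sum>x\<in>{..<m} \<times> {..<m}. norm (X $$ x))) > 0"
    by (intro add_pos_nonneg sum_nonneg) auto
  fix i j assume "i < m" "j < m"
  then have "norm (X $$ (i, j)) \<le> (\<Sum>x\<in>{..<m} \<times> {..<m}. norm (X $$ x))"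
    by (intro member_le_sum) auto
  then show "norm (X $$ (i, j)) \<le> 1 + (\<Sum>x\<in>{..<m} \<times> {..<m}. norm (X $$ x))" by simp
qed

lemma mat_exp_summable_norm:
  fixes X :: "complex mat"
  assumes X: "X \<in> carrier_mat m m" and ij: "i < m" "j < m"
  shows "summable (\<lambda>p. norm ((X ^\<^sub>m p) $$ (i, j) / fact p))"
proof -
  obtain M where M: "M > 0" "\<And>i j. i < m \<Longrightarrow> j < m \<Longrightarrow> norm (X $$ (i, j)) \<le> M"
    using entry_bound[of m X] by metis
  have "norm ((X ^\<^sub>m p) $$ (i, j)) \<le> (real m * M) ^ p" for p
  proof (cases p)
    case 0
    then show ?thesis using X ij by (simp add: one_mat_def)
  next
    case (Suc q)
    have "1 * norm ((X ^\<^sub>m p) $$ (i, j)) \<le> real m * norm ((X ^\<^sub>m p) $$ (i, j))"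
      using ij by (intro mult_right_mono) auto
    also have "\<dots> \<le> (real m * M) ^ p" unfolding Suc using norm_pow_mat_le[OF X M(2) ij] by blast
    finally show ?thesis by simp
  qed
  then show ?thesis
    by (intro summable_comparison_test[OF _ summable_exp[of "real m * M"]] exI[of _ 0])
      (auto simp: norm_divide field_simps)
qed

lemmas mat_exp_summable = summable_norm_cancel[OF mat_exp_summable_norm]

lemma mat_exp_closed [simp]: "X \<in> carrier_mat m m \<Longrightarrow> mat_exp X \<in> carrier_mat m m"
  by (auto simp: mat_exp_def)

lemma mat_exp_dim [simp]: "dim_row (mat_exp X) = dim_row X" "dim_col (mat_exp X) = dim_row X"
  by (simp_all add: mat_exp_def)

lemma mat_exp_index:
  "X \<in> carrier_mat m m \<Longrightarrow> i < m \<Longrightarrow> j < m \<Longrightarrow> mat_exp X $$ (i, j) = (\<Sum>p. (X ^\<^sub>m p) $$ (i, j) / fact p)"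
  by (auto simp: mat_exp_def)

lemma pow_mat_intertwine:
  fixes A B X :: "complex mat"
  assumes A: "A \<in> carrier_mat m m" and B: "B \<in> carrier_mat k k" and X: "X \<in> carrier_mat k m"
    and XA: "X * A = B * X"
  shows "X * A ^\<^sub>m p = B ^\<^sub>m p * X"
  using poly_mat_intertwine[OF assms, of "monom 1 p"] A B by (simp add: poly_mat_monom)

lemma mat_exp_intertwine:
  assumes A: "A \<in> carrier_mat m m" and B: "B \<in> carrier_mat k k" and X: "X \<in> carrier_mat k m"
    and XA: "X * A = B * X"
  shows "X * mat_exp A = mat_exp B * X"
proof (rule eq_matI, goal_cases)
  case (1 i j)
  then have ij: "i < k" "j < m" using B X by auto
  have "(X * mat_exp A) $$ (i, j) = (\<Sum>l<m. X $$ (i, l) * (\<Sum>p. (A ^\<^sub>m p) $$ (l, j) / fact p))"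
    using A X ij by (auto simp: scalar_prod_def atLeast0LessThan mat_exp_index intro!: sum.cong)
  also have "\<dots> = (\<Sum>l<m. \<Sum>p. X $$ (i, l) * ((A ^\<^sub>m p) $$ (l, j) / fact p))"
    using A ij by (intro sum.cong refl suminf_mult[symmetric] mat_exp_summable[of _ m]) auto
  also have "\<dots> = (\<Sum>p. \<Sum>l<m. X $$ (i, l) * ((A ^\<^sub>m p) $$ (l, j) / fact p))"
    using A ij by (intro suminf_sum[symmetric] summable_mult mat_exp_summable[of _ m]) auto
  also have "\<dots> = (\<Sum>p. (X * A ^\<^sub>m p) $$ (i, j) / fact p)"
    using A X ij by (auto simp: scalar_prod_def atLeast0LessThan sum_divide_distrib intro!: suminf_cong sum.cong)
  also have "\<dots> = (\<Sum>p. (B ^\<^sub>m p * X) $$ (i, j) / fact p)"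
    unfolding pow_mat_intertwine[OF assms] ..
  also have "\<dots> = (\<Sum>p. \<Sum>l<k. ((B ^\<^sub>m p) $$ (i, l) / fact p) * X $$ (l, j))"
    using B X ij by (auto simp: scalar_prod_def atLeast0LessThan sum_divide_distrib intro!: suminf_cong sum.cong)
  also have "\<dots> = (\<Sum>l<k. \<Sum>p. ((B ^\<^sub>m p) $$ (i, l) / fact p) * X $$ (l, j))"
    using B ij by (intro suminf_sum summable_mult2 mat_exp_summable[of _ k]) auto
  also have "\<dots> = (\<Sum>l<k. (\<Sum>p. (B ^\<^sub>m p) $$ (i, l) / fact p) * X $$ (l, j))"
    using B ij by (intro sum.cong refl suminf_mult2[symmetric] mat_exp_summable[of _ k]) auto
  also have "\<dots> = (mat_exp B * X) $$ (i, j)"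
    using B X ij by (auto simp: scalar_prod_def atLeast0LessThan mat_exp_index intro!: sum.cong)
  finally show ?case .
qed (use A B X in auto)

definition exp_poly :: "complex mat \<Rightarrow> complex poly \<Rightarrow> complex mat" where
  "exp_poly A p = mat_exp (poly_mat A p)"

lemma exp_poly_closed [simp]: "A \<in> carrier_mat m m \<Longrightarrow> exp_poly A p \<in> carrier_mat m m"
  by (auto simp: exp_poly_def)

lemma exp_poly_dim [simp]:
  assumes "A \<in> carrier_mat m m"
  shows "dim_row (exp_poly A p) = m" "dim_col (exp_poly A p) = m"
  using exp_poly_closed[OF assms, of p] by auto

lemma exp_poly_index:
  assumes A: "A \<in> carrier_mat m m" "i < m" "j < m"
  shows "exp_poly A p $$ (i, j) = (\<Sum>k. poly_mat A (p ^ k) $$ (i, j) / fact k)"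
    "summable (\<lambda>k. norm (poly_mat A (p ^ k) $$ (i, j) / fact k))"
  using assms mat_exp_summable_norm[of "poly_mat A p" m i j]
  by (auto simp: exp_poly_def mat_exp_index[of _ m] poly_mat_power)

text \<open>The Cauchy product of the entry series meets the binomial theorem, which is applied in
  the commutative ring of polynomials before evaluation at \<open>A\<close>.\<close>

lemma exp_poly_add:
  assumes A: "A \<in> carrier_mat m m"
  shows "exp_poly A (p + q) = exp_poly A p * exp_poly A q"
proof (rule eq_matI, goal_cases)
  case (1 i j)
  then have ij: "i < m" "j < m" using A by auto
  have "(\<lambda>k. \<Sum>l<m. \<Sum>r\<le>k. (poly_mat A (p ^ r) $$ (i, l) / fact r) * (poly_mat A (q ^ (k - r)) $$ (l, j) / fact (k - r)))
    sums (\<Sum>l<m. exp_poly A p $$ (i, l) * exp_poly A q $$ (l, j))"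
  proof (intro sums_sum)
    fix l assume l: "l \<in> {..<m}"
    then show "(\<lambda>k. \<Sum>r\<le>k. (poly_mat A (p ^ r) $$ (i, l) / fact r) * (poly_mat A (q ^ (k - r)) $$ (l, j) / fact (k - r)))
      sums (exp_poly A p $$ (i, l) * exp_poly A q $$ (l, j))"
      using Cauchy_product_sums[OF exp_poly_index(2)[OF A ij(1), of l p] exp_poly_index(2)[OF A _ ij(2), of l q]]
      by (simp add: exp_poly_index(1)[OF A] ij)
  qed
  moreover have "(\<Sum>l<m. \<Sum>r\<le>k. (poly_mat A (p ^ r) $$ (i, l) / fact r) * (poly_mat A (q ^ (k - r)) $$ (l, j) / fact (k - r)))
      = poly_mat A ((p + q) ^ k) $$ (i, j) / fact k" for k
  proof -
    have "poly_mat A ((p + q) ^ k) $$ (i, j) / fact k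
       = (\<Sum>r\<le>k. poly_mat A (of_nat (k choose r) * p ^ r * q ^ (k - r)) $$ (i, j) / fact k)"
      using A ij by (simp add: binomial_ring poly_mat_index_sum sum_divide_distrib)
    also have "\<dots> = (\<Sum>r\<le>k. poly_mat A (p ^ r * q ^ (k - r)) $$ (i, j) / (fact r * fact (k - r)))"
    proof (intro sum.cong refl)
      fix r assume "r \<in> {..k}"
      then have "of_nat (k choose r) = (fact k / (fact r * fact (k - r)) :: complex)"
        by (simp add: binomial_fact)
      moreover have "of_nat (k choose r) * p ^ r * q ^ (k - r) = Polynomial.smult (of_nat (k choose r)) (p ^ r * q ^ (k - r))"
        by (simp add: of_nat_poly mult.assoc)
      ultimately show "poly_mat A (of_nat (k choose r) * p ^ r * q ^ (k - r)) $$ (i, j) / fact k =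
          poly_mat A (p ^ r * q ^ (k - r)) $$ (i, j) / (fact r * fact (k - r))"
        using A ij by (simp add: poly_mat_smult)
    qed
    also have "\<dots> = (\<Sum>r\<le>k. \<Sum>l<m. (poly_mat A (p ^ r) $$ (i, l) / fact r) * (poly_mat A (q ^ (k - r)) $$ (l, j) / fact (k - r)))"
      using A ij by (intro sum.cong refl)
        (simp add: poly_mat_mult[OF A] scalar_prod_def atLeast0LessThan sum_divide_distrib)
    finally show ?thesis by (simp add: sum.swap[of _ "{..<m}"])
  qed
  ultimately have "(\<lambda>k. poly_mat A ((p + q) ^ k) $$ (i, j) / fact k) sums (\<Sum>l<m. exp_poly A p $$ (i, l) * exp_poly A q $$ (l, j))"
    by simp
  from sums_unique[OF this] show ?case
    using A ij by (simp add: exp_poly_index(1)[OF A ij] scalar_prod_def atLeast0LessThan)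
qed (use A in auto)

text \<open>Turns the exponential of a nilpotent \<open>poly_mat A p\<close> into an explicit
  polynomial in \<open>A\<close>; the logarithm is built from this.\<close>

lemma exp_poly_truncate:
  assumes A: "A \<in> carrier_mat m m" and 0: "poly_mat A (p ^ K) = 0\<^sub>m m m"
  shows "exp_poly A p = poly_mat A (\<Sum>k<K. Polynomial.smult (1 / fact k) (p ^ k))"
proof (rule eq_matI, goal_cases)
  case (1 i j)
  then have ij: "i < m" "j < m" using A by auto
  have "poly_mat A (p ^ k) = 0\<^sub>m m m" if "k \<ge> K" for k
  proof -
    have "p ^ k = p ^ K * p ^ (k - K)" using that by (simp flip: power_add)
    then show ?thesis using A 0 by (simp add: poly_mat_mult left_mult_zero_mat[of _ m])
  qed
  then have "(\<Sum>k. poly_mat A (p ^ k) $$ (i, j) / fact k) = (\<Sum>k<K. poly_mat A (p ^ k) $$ (i, j) / fact k)"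
    using ij by (intro suminf_finite) auto
  then show ?case using A ij by (simp add: exp_poly_index poly_mat_index_sum poly_mat_smult)
qed (use A in auto)

lemma exp_poly_0: "A \<in> carrier_mat m m \<Longrightarrow> exp_poly A 0 = 1\<^sub>m m"
  using exp_poly_truncate[of A m 0 1] by (simp add: poly_mat_0 poly_mat_const)

lemma exp_poly_minus:
  assumes "A \<in> carrier_mat m m"
  shows "exp_poly A p * exp_poly A (- p) = 1\<^sub>m m" "exp_poly A (- p) * exp_poly A p = 1\<^sub>m m"
  using exp_poly_add[OF assms, of p "-p"] exp_poly_add[OF assms, of "-p" p] exp_poly_0[OF assms] by auto

lemma exp_poly_intertwine:
  assumes A: "A \<in> carrier_mat m m" and B: "B \<in> carrier_mat k k" and X: "X \<in> carrier_mat k m"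
    and XA: "X * A = B * X"
  shows "X * exp_poly A p = exp_poly B p * X"
  unfolding exp_poly_def
  by (rule mat_exp_intertwine[of _ m _ k]) (use assms poly_mat_intertwine[OF assms] in auto)

lemma exp_poly_commute:
  assumes A: "A \<in> carrier_mat m m"
  shows "poly_mat A q * exp_poly A p = exp_poly A p * poly_mat A q"
proof (rule exp_poly_intertwine[OF A A])
  have "poly_mat A [:0, 1:] = A" using A by (auto simp: poly_mat_linear intro!: eq_matI)
  then show "poly_mat A q * A = A * poly_mat A q" using poly_mat_commute[OF A, of q "[:0, 1:]"] by simp
qed (use A in auto)

text \<open>The column \<open>u\<close> intertwines \<open>A\<close> with the 1 x 1 matrix
  \<open>L\<close> of entry \<open>w\<close>, for which polynomials and exponential are
  scalar.\<close>

lemma exp_poly_eigenvector: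
  assumes A: "A \<in> carrier_mat m m" and u: "u \<in> carrier_mat m 1" and Au: "A * u = w \<cdot>\<^sub>m u"
  shows "poly_mat A p * u = poly p w \<cdot>\<^sub>m u" "exp_poly A p * u = exp (poly p w) \<cdot>\<^sub>m u"
proof -
  have us: "u * (a \<cdot>\<^sub>m 1\<^sub>m 1) = a \<cdot>\<^sub>m u" for a
    by (subst mult_smult_distrib[OF u one_carrier_mat]) (simp only: right_mult_one_mat[OF u])
  define L where "L = w \<cdot>\<^sub>m 1\<^sub>m 1"
  have L: "L \<in> carrier_mat 1 1" by (simp add: L_def)
  have uL: "u * L = A * u" using u Au unfolding L_def us Au ..
  have pL: "poly_mat L p = poly p w \<cdot>\<^sub>m 1\<^sub>m 1" for p
  proof (induction p)
    case 0
    then show ?case using L by (auto simp: poly_mat_0)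
  next
    case (pCons a p)
    show ?case unfolding poly_mat_pCons[OF L] pCons.IH
      unfolding L_def by (auto intro!: eq_matI)
  qed
  have "exp_poly L p $$ (0, 0) = exp (poly p w)"
    using exp_poly_index(1)[OF L, of 0 0 p] by (simp add: pL exp_def scaleR_conv_of_real field_simps)
  then have eL: "exp_poly L p = exp (poly p w) \<cdot>\<^sub>m 1\<^sub>m 1"
    using L by (intro eq_matI) auto
  show "poly_mat A p * u = poly p w \<cdot>\<^sub>m u" "exp_poly A p * u = exp (poly p w) \<cdot>\<^sub>m u"
    using poly_mat_intertwine[OF L A u uL, of p] exp_poly_intertwine[OF L A u uL, of p] u
    unfolding pL eL us by simp_all
qed

text \<open>Injectivity of exp near 0 with an explicit radius. From exp X = 1 follows X = -(X^2/2! +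
  X^3/3! + ...). If X were nonzero, K = m times the largest modulus of an entry would satisfy K
  \<le> e^K - 1 - K \<le> K^2 < K.\<close>

lemma exp_eq_1_imp_0:
  assumes X: "X \<in> carrier_mat m m" and e: "mat_exp X = 1\<^sub>m m"
    and small: "\<And>i j. i < m \<Longrightarrow> j < m \<Longrightarrow> real m * norm (X $$ (i, j)) < 1"
  shows "X = 0\<^sub>m m m"
proof (rule ccontr)
  assume "X \<noteq> 0\<^sub>m m m"
  then obtain i0 j0 where ij0: "i0 < m" "j0 < m" "X $$ (i0, j0) \<noteq> 0"
    using X by (metis carrier_matD eq_matI index_zero_mat)
  define M where "M = Max ((\<lambda>x. norm (X $$ x)) ` ({..<m} \<times> {..<m}))"
  have fin: "finite ((\<lambda>x. norm (X $$ x)) ` ({..<m} \<times> {..<m}))" by simp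
  have M: "norm (X $$ (i, j)) \<le> M" if "i < m" "j < m" for i j
    unfolding M_def using that by (intro Max_ge fin) auto
  \<comment> \<open>The maximum is attained, so estimating this one entry bounds K in terms of K
    itself.\<close>
  have "M \<in> (\<lambda>x. norm (X $$ x)) ` ({..<m} \<times> {..<m})"
    unfolding M_def using ij0 by (intro Max_in fin) auto
  then obtain i j where ij: "i < m" "j < m" "M = norm (X $$ (i, j))" by auto
  define K where "K = real m * M"
  have "0 < norm (X $$ (i0, j0))" using ij0 by simp
  then have "M > 0" using M[OF ij0(1,2)] by linarith
  then have K: "0 < K" "K < 1" using small[OF ij(1,2)] ij by (auto simp: K_def)
  have sm: "summable (\<lambda>p. (X ^\<^sub>m p) $$ (i, j) / fact p)" by (rule mat_exp_summable[OF X ij(1,2)])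
  have sm1: "summable (\<lambda>p. (X ^\<^sub>m (p + 2)) $$ (i, j) / fact (p + 2))"
    using summable_ignore_initial_segment[OF sm, of 2] by simp
  have "1\<^sub>m m $$ (i, j) = (\<Sum>p. (X ^\<^sub>m p) $$ (i, j) / fact p)"
    using e X ij by (metis mat_exp_index)
  also have "\<dots> = (\<Sum>p. (X ^\<^sub>m (p + 2)) $$ (i, j) / fact (p + 2)) + (\<Sum>p<2. (X ^\<^sub>m p) $$ (i, j) / fact p)"
    by (rule suminf_split_initial_segment[OF sm])
  finally have eq: "X $$ (i, j) = - (\<Sum>p. (X ^\<^sub>m (p + 2)) $$ (i, j) / fact (p + 2))"
    using X ij by (simp add: numeral_2_eq_2 add_eq_0_iff)
  have ex: "summable (\<lambda>p. K ^ p / fact p)" using summable_exp[of K] by (simp add: field_simps)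
  have ex2: "summable (\<lambda>p. K ^ (p + 2) / fact (p + 2))"
    using summable_ignore_initial_segment[OF ex, of 2] by simp
  have b: "norm (of_nat m * ((X ^\<^sub>m (p + 2)) $$ (i, j) / fact (p + 2))) \<le> K ^ (p + 2) / fact (p + 2)" for p
  proof -
    have "norm (of_nat m * ((X ^\<^sub>m (p + 2)) $$ (i, j) / fact (p + 2)))
        = real m * norm ((X ^\<^sub>m (p + 2)) $$ (i, j)) / fact (p + 2)"
      by (simp only: norm_mult norm_divide norm_of_nat norm_fact times_divide_eq_right)
    moreover have "real m * norm ((X ^\<^sub>m (p + 2)) $$ (i, j)) \<le> K ^ (p + 2)"
      using norm_pow_mat_le[OF X M ij(1,2), of "Suc p"] unfolding K_def by (simp only: add_2_eq_Suc')
    ultimately show ?thesis by (simp only: divide_right_mono fact_ge_zero)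
  qed
  have sn: "summable (\<lambda>p. norm (of_nat m * ((X ^\<^sub>m (p + 2)) $$ (i, j) / fact (p + 2))))"
    by (rule summable_comparison_test'[OF ex2, of 0], unfold real_norm_def abs_norm_cancel, rule b)
  have "K = norm (of_nat m * X $$ (i, j))" by (simp add: K_def ij norm_mult)
  also have "\<dots> = norm (\<Sum>p. of_nat m * ((X ^\<^sub>m (p + 2)) $$ (i, j) / fact (p + 2)))"
    unfolding eq using sm1 by (subst suminf_mult) (simp_all add: norm_mult)
  also have "\<dots> \<le> (\<Sum>p. norm (of_nat m * ((X ^\<^sub>m (p + 2)) $$ (i, j) / fact (p + 2))))"
    by (rule summable_norm[OF sn])
  also have "\<dots> \<le> (\<Sum>p. K ^ (p + 2) / fact (p + 2))"
    by (rule suminf_le[OF b sn ex2])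
  also have "\<dots> = exp K - 1 - K"
    using suminf_split_initial_segment[OF ex, of 2] by (simp add: exp_def numeral_2_eq_2 field_simps)
  also have "\<dots> \<le> K\<^sup>2" using exp_bound[of K] K by simp
  also have "\<dots> < K" using K by (simp add: power2_eq_square)
  finally show False by simp
qed

text \<open>The embedding of GL(m) into GL(n) as upper-left block. The complement carries the
  identity, as in the exponential of a matrix extended by zeros.\<close>

definition pad_one :: "nat \<Rightarrow> complex mat \<Rightarrow> complex mat" where
  "pad_one n g = four_block_mat g (0\<^sub>m (dim_row g) (n - dim_row g)) (0\<^sub>m (n - dim_row g) (dim_row g)) (1\<^sub>m (n - dim_row g))"

lemma mat_exp_extend_by_zeros:
  assumes X: "X \<in> carrier_mat m m" and "m \<le> n"
  shows "mat_exp (extend_by_zeros n X) = pad_one n (mat_exp X)"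
proof -
  let ?Z = "extend_by_zeros n X"
  have Zc: "?Z \<in> carrier_mat n n" using assms by (auto simp: extend_by_zeros_def Let_def)
  have pw: "?Z ^\<^sub>m p = four_block_mat (X ^\<^sub>m p) (0\<^sub>m m (n - m)) (0\<^sub>m (n - m) m) (0\<^sub>m (n - m) (n - m) ^\<^sub>m p)" for p
    using pow_four_block_mat[OF X, of "0\<^sub>m (n - m) (n - m)" "n - m" p] X
    by (simp add: extend_by_zeros_def Let_def)
  \<comment> \<open>The zeroth power of the zero block is the identity; outside the upper-left block
    only this term of the series contributes.\<close>
  have z: "(0\<^sub>m (n - m) (n - m) ^\<^sub>m p :: complex mat) = (if p = 0 then 1\<^sub>m (n - m) else 0\<^sub>m (n - m) (n - m))" for p
    by (cases p) auto
  have Xp: "dim_row (X ^\<^sub>m p) = m" "dim_col (X ^\<^sub>m p) = m" for p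
    using pow_carrier_mat[OF X, of p] by auto
  show ?thesis
  proof (rule eq_matI, goal_cases)
    case (1 i j)
    then have ij: "i < n" "j < n" using X \<open>m \<le> n\<close> by (auto simp: pad_one_def)
    have "mat_exp ?Z $$ (i, j) = (\<Sum>p. (?Z ^\<^sub>m p) $$ (i, j) / fact p)" using Zc ij by (rule mat_exp_index)
    also have "\<dots> = pad_one n (mat_exp X) $$ (i, j)"
    proof (cases "i < m \<and> j < m")
      case True
      then show ?thesis using X ij by (simp add: pad_one_def pw mat_exp_index Xp del: pow_mat_dim pow_mat_dim_square)
    next
      case False
      have "(\<Sum>p. (?Z ^\<^sub>m p) $$ (i, j) / fact p) = (\<Sum>p\<in>{0}. (?Z ^\<^sub>m p) $$ (i, j) / fact p)"
        using False ij X by (intro suminf_finite) (auto simp: pw z)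
      then show ?thesis using False ij X by (auto simp: pad_one_def carrier_matD[OF Zc])
    qed
    finally show ?case .
  qed (use X \<open>m \<le> n\<close> Zc in \<open>auto simp: pad_one_def\<close>)
qed

section \<open>Cyclic vectors and logarithms\<close>

declare One_nat_def [simp del]

section \<open>Roots and divisibility of complex polynomials\<close>

lemma coprime_if_no_common_root:
  fixes p q :: "complex poly"
  assumes "p \<noteq> 0" and no: "\<And>w. poly p w = 0 \<Longrightarrow> poly q w \<noteq> 0"
  shows "coprime p q"
proof (rule coprimeI)
  fix c assume c: "c dvd p" "c dvd q"
  with \<open>p \<noteq> 0\<close> have "c \<noteq> 0" by auto
  have "degree c = 0"
  proof (rule ccontr)
    assume "degree c \<noteq> 0"
    then obtain w where "poly c w = 0"
      using fundamental_theorem_of_algebra[of c] constant_degree[of c] by auto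
    with c no[of w] show False by (auto elim!: dvdE)
  qed
  with \<open>c \<noteq> 0\<close> show "is_unit c" by (auto simp: is_unit_iff_degree)
qed

lemma interpolation_exists:
  fixes f :: "complex \<Rightarrow> complex"
  assumes "finite S"
  shows "\<exists>p. \<forall>w\<in>S. poly p w = f w"
  using assms
proof induction
  case (insert a S)
  then obtain p where p: "\<forall>w\<in>S. poly p w = f w" by auto
  define r where "r = (\<Prod>w\<in>S. [:- w, 1:])"
  have r: "poly r a \<noteq> 0" "\<forall>w\<in>S. poly r w = 0"
    using insert.hyps by (auto simp: r_def poly_prod)
  show ?case
    by (rule exI[of _ "p + Polynomial.smult ((f a - poly p a) / poly r a) r"]) (use p r in auto)
qed auto

text \<open>Each \<open>s\<close> rules out at most the value -f s / g s. Where
  \<open>g s = 0\<close> the quotient is 0 and merely discards one more value.\<close>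

lemma generic_scalar:
  fixes f g :: "'b \<Rightarrow> complex"
  assumes "finite S" and "\<And>s. s \<in> S \<Longrightarrow> f s \<noteq> 0 \<or> g s \<noteq> 0"
  obtains a where "\<And>s. s \<in> S \<Longrightarrow> f s + a * g s \<noteq> 0"
proof -
  have "infinite (UNIV - (\<lambda>s. - f s / g s) ` S)"
    using assms(1) by (intro Diff_infinite_finite) (auto simp: infinite_UNIV_char_0)
  then obtain a where a: "a \<notin> (\<lambda>s. - f s / g s) ` S"
    by (metis Diff_iff UNIV_I finite.emptyI ex_in_conv)
  show ?thesis
  proof (rule that[of a])
    fix s assume s: "s \<in> S"
    then have "a \<noteq> - f s / g s" using a by auto
    show "f s + a * g s \<noteq> 0"
    proof
      assume 0: "f s + a * g s = 0"
      then have "g s \<noteq> 0" using assms(2)[OF s] by auto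
      moreover have "a * g s = - f s" using 0 by (metis add.commute eq_neg_iff_add_eq_0)
      ultimately have "a = - f s / g s" by (metis nonzero_mult_div_cancel_right)
      with \<open>a \<noteq> - f s / g s\<close> show False ..
    qed
  qed
qed

text \<open>Each linear factor of \<open>q\<close>, counted with multiplicity, divides one copy of
  \<open>p\<close>. With \<open>q\<close> the characteristic polynomial of A, a polynomial that
  vanishes at all eigenvalues becomes nilpotent at A.\<close>

lemma poly_dvd_power_if_roots:
  fixes p q :: "complex poly"
  assumes q: "q \<noteq> 0" and roots: "\<And>w. poly q w = 0 \<Longrightarrow> poly p w = 0"
  shows "q dvd p ^ degree q"
proof -
  obtain as where as: "Polynomial.smult (lead_coeff q) (\<Prod>a\<leftarrow>as. [:- a, 1:]) = q" "length as = degree q"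
    using fundamental_theorem_algebra_factorized[of q] by auto
  have "poly p a = 0" if "a \<in> set as" for a
  proof (rule roots)
    show "poly q a = 0" using that by (subst as(1)[symmetric]) (auto simp: poly_prod_list image_iff prod_list_zero_iff)
  qed
  then have "(\<Prod>a\<leftarrow>as. [:- a, 1:]) dvd p ^ length as"
  proof (induction as)
    case (Cons a as)
    then have "[:- a, 1:] dvd p" "(\<Prod>a\<leftarrow>as. [:- a, 1:]) dvd p ^ length as"
      by (simp_all add: poly_eq_0_iff_dvd)
    then have "[:- a, 1:] * (\<Prod>a\<leftarrow>as. [:- a, 1:]) dvd p * p ^ length as" by (rule mult_dvd_mono)
    then show ?case by simp
  qed simp
  then have "Polynomial.smult (lead_coeff q) (\<Prod>a\<leftarrow>as. [:- a, 1:]) dvd p ^ length as"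
    using q by (simp add: smult_dvd_iff)
  with as show ?thesis by simp
qed

lemma char_poly_facts:
  fixes A :: "complex mat"
  assumes "A \<in> carrier_mat m m"
  shows degree_char_poly: "degree (char_poly A) = m" and char_poly_nz: "char_poly A \<noteq> 0"
  using degree_monic_char_poly[OF assms] by auto

text \<open>The quotient by x - w is nonzero and of too low degree to annihilate a nonderogatory
  matrix; applied to a cyclic vector it yields an eigenvector for w.\<close>

lemma synthetic_div_char_poly:
  fixes A :: "complex mat"
  assumes A: "A \<in> carrier_mat m m" and w: "poly (char_poly A) w = 0"
  shows "char_poly A = [:- w, 1:] * synthetic_div (char_poly A) w"
    "synthetic_div (char_poly A) w \<noteq> 0" "degree (synthetic_div (char_poly A) w) < m"
proof -
  show eq: "char_poly A = [:- w, 1:] * synthetic_div (char_poly A) w"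
    using synthetic_div_correct'[of w "char_poly A"] w by simp
  then show nz: "synthetic_div (char_poly A) w \<noteq> 0"
    using char_poly_nz[OF A] by (metis mult_zero_right)
  have "degree (char_poly A) = degree [:- w, 1:] + degree (synthetic_div (char_poly A) w)"
    by (subst eq, rule degree_mult_eq) (use nz in auto)
  then show "degree (synthetic_div (char_poly A) w) < m" using degree_char_poly[OF A] by simp
qed

text \<open>With Cayley-Hamilton this says that the minimal polynomial equals the characteristic
  polynomial.\<close>

definition nonderogatory :: "complex mat \<Rightarrow> bool" where
  "nonderogatory A \<longleftrightarrow> (\<forall>p. degree p < dim_row A \<longrightarrow> poly_mat A p = 0\<^sub>m (dim_row A) (dim_row A) \<longrightarrow> p = 0)"

lemma eq_mat_if_eq_on_columns:
  fixes X Y :: "complex mat"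
  assumes X: "X \<in> carrier_mat k m" and Y: "Y \<in> carrier_mat k m"
    and eq: "\<And>b. b \<in> carrier_mat m 1 \<Longrightarrow> X * b = Y * b"
  shows "X = Y"
proof (rule eq_matI, goal_cases)
  case (1 i j)
  then have ij: "i < k" "j < m" using Y by auto
  define b where "b = mat m 1 (\<lambda>(l, _). if l = j then 1 else 0 :: complex)"
  have b: "b \<in> carrier_mat m 1" by (simp add: b_def)
  have "(Z * b) $$ (i, 0) = Z $$ (i, j)" if "Z \<in> carrier_mat k m" for Z
    using that ij b by (simp add: scalar_prod_def b_def if_distrib[of "\<lambda>x. _ * x"] cong: if_cong)
  with eq[OF b] X Y show ?case by metis
qed (use X Y in auto)

text \<open>Independence of v, A v, ..., A^(m-1) v, put in terms of polynomials. The map from p to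
  p(A) v then identifies C[x]/(\<open>cp\<close>) with the columns;
  \<open>poly_mat_vec_eq_iff\<close> gives injectivity and \<open>vector_poly_exists\<close>
  surjectivity.\<close>

locale cyclic_vector =
  fixes A :: "complex mat" and m :: nat and v :: "complex mat"
  assumes A [simp]: "A \<in> carrier_mat m m" and v [simp]: "v \<in> carrier_mat m 1"
    and cyclic: "\<And>p. degree p < m \<Longrightarrow> poly_mat A p * v = 0\<^sub>m m 1 \<Longrightarrow> p = 0"
begin

abbreviation "cp \<equiv> char_poly A"

lemma dims [simp]:
  "dim_row A = m" "dim_col A = m" "dim_row v = m" "dim_col v = 1"
  "dim_row (poly_mat A p) = m" "dim_col (poly_mat A p) = m"
  "dim_row (exp_poly A p) = m" "dim_col (exp_poly A p) = m"
  using carrier_matD[OF A] carrier_matD[OF v] poly_mat_dim[OF A, of p] exp_poly_dim[OF A, of p] by auto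

lemma poly_mat_X: "poly_mat A [:0, 1:] = A"
  unfolding poly_mat_linear[OF A] by (auto intro!: eq_matI)

lemma poly_mat_char_poly_multiple: "cp dvd p \<Longrightarrow> poly_mat A p = 0\<^sub>m m m"
  by (auto elim!: dvdE simp: poly_mat_mult[OF A] cayley_hamilton[OF A] left_mult_zero_mat[of _ m])

lemma poly_mat_cong: "cp dvd p - q \<Longrightarrow> poly_mat A p = poly_mat A q"
  using poly_mat_char_poly_multiple[of "p - q"] poly_mat_add[OF A, of "p - q" q]
  by (simp add: left_add_zero_mat[of _ m m])

lemma poly_mat_mod: "poly_mat A (p mod cp) = poly_mat A p"
  by (rule poly_mat_cong[symmetric]) (rule dvd_minus_mod)

lemma degree_mod_char_poly: "m > 0 \<Longrightarrow> degree (p mod cp) < m"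
  using degree_mod_less[of cp p] degree_char_poly[OF A] char_poly_nz[OF A] by auto

lemma poly_mat_vec_eq_0_iff: "poly_mat A p * v = 0\<^sub>m m 1 \<longleftrightarrow> cp dvd p"
proof
  assume 0: "poly_mat A p * v = 0\<^sub>m m 1"
  show "cp dvd p"
  proof (cases "m = 0")
    case True
    then have "is_unit cp" using degree_char_poly[OF A] char_poly_nz[OF A] by (simp add: is_unit_iff_degree)
    then show ?thesis by (rule unit_imp_dvd)
  next
    case False
    then have "p mod cp = 0" using 0 degree_mod_char_poly by (intro cyclic) (auto simp: poly_mat_mod)
    then show ?thesis by auto
  qed
next
  assume "cp dvd p"
  then show "poly_mat A p * v = 0\<^sub>m m 1"
    by (simp add: poly_mat_char_poly_multiple left_mult_zero_mat[OF v])
qed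

lemma poly_mat_vec_eq_iff: "poly_mat A p * v = poly_mat A q * v \<longleftrightarrow> cp dvd p - q"
proof
  assume eq: "poly_mat A p * v = poly_mat A q * v"
  have "poly_mat A (p - q) * v = poly_mat A p * v - poly_mat A q * v"
    unfolding poly_mat_diff[OF A] by (rule minus_mult_distrib_mat[of _ m m _ _ 1]) auto
  also have "\<dots> = 0\<^sub>m m 1" unfolding eq by (rule minus_r_inv_mat) (rule mult_carrier_mat[of _ m m], auto)
  finally show "cp dvd p - q" by (simp add: poly_mat_vec_eq_0_iff)
qed (simp add: poly_mat_cong)

definition basis_poly :: "(nat \<Rightarrow> complex) \<Rightarrow> complex poly" where
  "basis_poly x = (\<Sum>j<m. monom (x j) j)"

lemma coeff_basis_poly: "coeff (basis_poly x) j = (if j < m then x j else 0)"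
  by (simp add: basis_poly_def coeff_sum)

text \<open>\<open>V\<close> is the Krylov matrix with columns A^j v; a kernel vector would be the
  coefficient vector of a polynomial of degree below m that kills v. The inverse of \<open>V\<close>
  later gives surjectivity and the dual covector.\<close>

lemma krylov:
  obtains V where "V \<in> carrier_mat m m" "det V \<noteq> 0"
    "\<And>x i. i < m \<Longrightarrow> (poly_mat A (basis_poly x) * v) $$ (i, 0) = (\<Sum>j<m. V $$ (i, j) * x j)"
proof
  define V where "V = mat m m (\<lambda>(i, j). (A ^\<^sub>m j * v) $$ (i, 0))"
  show V: "V \<in> carrier_mat m m" by (simp add: V_def)
  show eq: "(poly_mat A (basis_poly x) * v) $$ (i, 0) = (\<Sum>j<m. V $$ (i, j) * x j)" if i: "i < m" for x i
  proof -
    have "(poly_mat A (basis_poly x) * v) $$ (i, 0) = (\<Sum>l<m. poly_mat A (basis_poly x) $$ (i, l) * v $$ (l, 0))"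
      using i A v by (simp add: scalar_prod_def atLeast0LessThan)
    also have "\<dots> = (\<Sum>l<m. (\<Sum>j<m. x j * (A ^\<^sub>m j) $$ (i, l)) * v $$ (l, 0))"
      using i A by (intro sum.cong refl) (simp add: basis_poly_def poly_mat_index_sum[OF A] poly_mat_monom[OF A])
    also have "\<dots> = (\<Sum>j<m. \<Sum>l<m. x j * ((A ^\<^sub>m j) $$ (i, l) * v $$ (l, 0)))"
      by (simp add: sum_distrib_right mult.assoc) (rule sum.swap)
    also have "\<dots> = (\<Sum>j<m. V $$ (i, j) * x j)"
    proof (intro sum.cong refl)
      fix j assume "j \<in> {..<m}"
      have "(A ^\<^sub>m j * v) $$ (i, 0) = (\<Sum>l<m. (A ^\<^sub>m j) $$ (i, l) * v $$ (l, 0))"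
        using i by (simp add: scalar_prod_def atLeast0LessThan)
      with i \<open>j \<in> {..<m}\<close> show "(\<Sum>l<m. x j * ((A ^\<^sub>m j) $$ (i, l) * v $$ (l, 0))) = V $$ (i, j) * x j"
        by (simp add: V_def sum_distrib_left mult.commute)
    qed
    finally show ?thesis .
  qed
  show "det V \<noteq> 0"
  proof
    assume "det V = 0"
    then obtain x where x: "x \<in> carrier_vec m" "x \<noteq> 0\<^sub>v m" "V *\<^sub>v x = 0\<^sub>v m"
      using det_0_iff_vec_prod_zero[OF V] by auto
    have "poly_mat A (basis_poly (vec_index x)) * v = 0\<^sub>m m 1"
    proof (rule eq_matI, goal_cases)
      case (1 i j)
      then have i: "i < m" "j = 0" by auto
      have "(poly_mat A (basis_poly (vec_index x)) * v) $$ (i, 0) = vec_index (V *\<^sub>v x) i"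
        unfolding eq[OF i(1)] using i V x(1) by (simp add: scalar_prod_def atLeast0LessThan)
      then show ?case using i x by simp
    qed (use carrier_matD[OF v] in auto)
    then have "basis_poly (vec_index x) = 0 \<or> m = 0"
      by (cases "m = 0") (auto intro!: cyclic simp: basis_poly_def intro!: degree_sum_less intro: le_less_trans[OF degree_monom_le])
    then have "vec_index x j = 0" if "j < m" for j using coeff_basis_poly[of "vec_index x" j] that by auto
    with x show False by (auto intro: eq_vecI)
  qed
qed

lemma vector_poly_exists:
  assumes b: "b \<in> carrier_mat m 1"
  shows "\<exists>p. b = poly_mat A p * v"
proof -
  obtain V where V: "V \<in> carrier_mat m m" "det V \<noteq> 0"
    "\<And>x i. i < m \<Longrightarrow> (poly_mat A (basis_poly x) * v) $$ (i, 0) = (\<Sum>j<m. V $$ (i, j) * x j)"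
    using krylov by blast
  define X where "X = (1 / det V) \<cdot>\<^sub>m (adj_mat V * b)"
  have X: "X \<in> carrier_mat m 1" using adj_mat(1)[OF V(1)] b by (auto simp: X_def)
  have "V * X = (1 / det V) \<cdot>\<^sub>m (V * adj_mat V * b)"
    using V(1) adj_mat(1)[OF V(1)] b
    by (simp add: X_def mult_smult_distrib[of _ m m _ 1] assoc_mult_mat[of _ m m _ m _ 1])
  also have "\<dots> = b"
    unfolding adj_mat(2)[OF V(1)] mult_smult_assoc_mat[OF one_carrier_mat b] left_mult_one_mat[OF b]
    using V(2) by (auto intro!: eq_matI)
  finally have VX: "V * X = b" .
  have "b = poly_mat A (basis_poly (\<lambda>j. X $$ (j, 0))) * v"
  proof (rule eq_matI, goal_cases)
    case (1 i j)
    then have i: "i < m" "j = 0" by auto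
    have "(V * X) $$ (i, 0) = (poly_mat A (basis_poly (\<lambda>j. X $$ (j, 0))) * v) $$ (i, 0)"
      unfolding V(3)[OF i(1)] using V(1) X i by (simp add: scalar_prod_def atLeast0LessThan)
    then show ?case by (simp add: i VX)
  qed (use carrier_matD[OF v] carrier_matD[OF b] in auto)
  then show ?thesis ..
qed

text \<open>If X v = r(A) v, then X and r(A), both commuting with A, agree on every p(A) v, that is,
  on all columns.\<close>

lemma commuting_mat_poly_exists:
  assumes X: "X \<in> carrier_mat m m" and XA: "X * A = A * X"
  shows "\<exists>r. X = poly_mat A r"
proof -
  obtain r where r: "X * v = poly_mat A r * v"
    using vector_poly_exists[of "X * v"] X by auto
  have "X = poly_mat A r"
  proof (rule eq_mat_if_eq_on_columns[OF X])
    fix b :: "complex mat" assume "b \<in> carrier_mat m 1"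
    then obtain p where p: "b = poly_mat A p * v" using vector_poly_exists by blast
    have "X * b = poly_mat A p * (X * v)"
      using poly_mat_intertwine[OF A A X XA, of p] X unfolding p
      by (simp flip: assoc_mult_mat[of _ m m _ m _ 1])
    also have "\<dots> = poly_mat A r * b"
      unfolding r p using poly_mat_commute[OF A, of p r]
      by (simp flip: assoc_mult_mat[of _ m m _ m _ 1])
    finally show "X * b = poly_mat A r * b" .
  qed simp
  then show ?thesis ..
qed

text \<open>The exponential commutes with A, so it is a polynomial in A. The values of that
  polynomial at the roots are read off from the eigenvectors (\<open>cp\<close> / (x - w))(A)
  v.\<close>

lemma exp_poly_is_poly:
  obtains r where "exp_poly A p = poly_mat A r" "\<And>w. poly cp w = 0 \<Longrightarrow> poly r w = exp (poly p w)"
proof -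
  note x = poly_mat_X
  have "exp_poly A p * A = A * exp_poly A p"
    using exp_poly_commute[OF A, of "[:0, 1:]" p] by (simp add: x)
  then obtain r where r: "exp_poly A p = poly_mat A r"
    using commuting_mat_poly_exists[of "exp_poly A p"] by auto
  moreover have "poly r w = exp (poly p w)" if w: "poly cp w = 0" for w
  proof -
    define h where "h = synthetic_div cp w"
    note h = synthetic_div_char_poly[OF A w, folded h_def]
    define u where "u = poly_mat A h * v"
    have u: "u \<in> carrier_mat m 1" by (auto simp: u_def intro: mult_carrier_mat[of _ m m])
    have u0: "u \<noteq> 0\<^sub>m m 1" using cyclic[OF h(3)] h(2) by (auto simp: u_def)
    have "poly_mat A ([:0, 1:] * h) * v = poly_mat A (Polynomial.smult w h) * v"
      unfolding poly_mat_vec_eq_iff by (subst h(1)) (simp add: algebra_simps)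
    then have "A * u = w \<cdot>\<^sub>m u"
      unfolding poly_mat_mult[OF A] poly_mat_smult[OF A] x u_def
      by (simp add: assoc_mult_mat[of _ m m _ m _ 1] mult_smult_assoc_mat[of _ m m _ 1])
    from exp_poly_eigenvector[OF A u this] r have eq: "poly r w \<cdot>\<^sub>m u = exp (poly p w) \<cdot>\<^sub>m u" by metis
    obtain i where i: "i < m" "u $$ (i, 0) \<noteq> 0"
      using u u0 by (metis (no_types, lifting) carrier_matD eq_matI index_zero_mat less_one)
    from arg_cong[OF eq, of "\<lambda>M. M $$ (i, 0)"] show ?thesis
      using i carrier_matD[OF u] by simp
  qed
  ultimately show ?thesis using that by blast
qed

text \<open>Successive approximation. Multiplying 1 + Y, with Y = y^j s, by exp(-Y) leaves 1 +
  Y^2(...), whose deviation from 1 is divisible by y^(j+1). If q is a logarithm of that, q + Y is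
  one of 1 + Y. The process stops since y^m vanishes modulo \<open>cp\<close>.\<close>

lemma unipotent_log_exists:
  assumes y: "\<And>w. poly cp w = 0 \<Longrightarrow> poly y w = 0" and "j \<ge> 1"
  shows "\<exists>q. exp_poly A q = poly_mat A (1 + y ^ j * s)"
  using \<open>j \<ge> 1\<close>
proof (induction "m - j" arbitrary: j s rule: less_induct)
  case less
  have ym: "cp dvd y ^ m"
    using poly_dvd_power_if_roots[OF char_poly_nz[OF A] y] degree_char_poly[OF A] by simp
  define Y where "Y = y ^ j * s"
  show ?case
  proof (cases "j \<ge> m")
    case True
    then have "cp dvd Y" unfolding Y_def using ym by (meson dvd_mult2 dvd_trans le_imp_power_dvd)
    then have "poly_mat A (1 + Y) = exp_poly A 0"
      using poly_mat_cong[of "1 + Y" 1] by (simp add: exp_poly_0[OF A] poly_mat_1[OF A])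
    then show ?thesis unfolding Y_def by metis
  next
    case False
    \<comment> \<open>The terms from index m on vanish at A already; m + 2 terms are kept so that
      the first two can be split off for every m.\<close>
    define T where "T = (\<Sum>k<m + 2. Polynomial.smult (1 / fact k) ((- Y) ^ k))"
    have "y ^ m dvd y ^ (j * m)" using less.prems by (intro le_imp_power_dvd) simp
    then have "cp dvd (- Y) ^ m" using ym
      by (simp add: Y_def power_mult_distrib power_minus[of "_ * _"] flip: power_mult)
        (meson dvd_mult dvd_mult2 dvd_trans)
    then have "cp dvd (- Y) ^ (m + 2)" by (simp add: power_add)
    then have T: "exp_poly A (- Y) = poly_mat A T"
      unfolding T_def by (intro exp_poly_truncate[OF A] poly_mat_char_poly_multiple)
    define R where "R = (\<Sum>k<m. Polynomial.smult (1 / fact (k + 2)) ((- Y) ^ k))"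
    have "T = 1 - Y + Y\<^sup>2 * R"
      unfolding T_def R_def by (simp add: sum.lessThan_Suc_shift sum_distrib_left power2_eq_square mult_ac del: sum.lessThan_Suc)
    then have "(1 + Y) * T = 1 + Y\<^sup>2 * ((1 + Y) * R - 1)"
      by (simp only:) (simp add: algebra_simps power2_eq_square)
    moreover have "Y\<^sup>2 = y ^ (j + 1) * (y ^ (j - 1) * s\<^sup>2)"
    proof -
      have "j + j = (j + 1) + (j - 1)" using less.prems by simp
      then have "y ^ j * y ^ j = y ^ (j + 1) * y ^ (j - 1)" by (simp only: flip: power_add)
      then show ?thesis by (simp add: Y_def power2_eq_square algebra_simps)
    qed
    ultimately have "(1 + Y) * T = 1 + y ^ (j + 1) * (y ^ (j - 1) * s\<^sup>2 * ((1 + Y) * R - 1))"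
      by (simp only: mult.assoc)
    moreover have "m - (j + 1) < m - j" using False by simp
    ultimately obtain q where q: "exp_poly A q = poly_mat A ((1 + Y) * T)"
      using less.hyps[of "j + 1" "y ^ (j - 1) * s\<^sup>2 * ((1 + Y) * R - 1)"] by auto
    have "exp_poly A (q + Y) = poly_mat A (1 + Y) * (exp_poly A (- Y) * exp_poly A Y)"
      unfolding exp_poly_add[OF A] q poly_mat_mult[OF A] T
      by (simp add: assoc_mult_mat[of _ m m _ m _ m])
    also have "\<dots> = poly_mat A (1 + Y)" by (simp add: exp_poly_minus(2)[OF A] right_mult_one_mat[of _ m])
    finally show ?thesis unfolding Y_def by blast
  qed
qed

text \<open>Interpolating the scalar logarithms of \<open>u\<close> at the roots by
  \<open>q0\<close> leaves the factor u exp(-q0), which is 1 at every root and hence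
  unipotent.\<close>

lemma log_exists:
  assumes u: "\<And>w. poly cp w = 0 \<Longrightarrow> poly u w \<noteq> 0"
  shows "\<exists>q. exp_poly A q = poly_mat A u"
proof -
  have "finite {w. poly cp w = 0}" by (rule poly_roots_finite[OF char_poly_nz[OF A]])
  from interpolation_exists[OF this, of "\<lambda>w. Ln (poly u w)"]
  obtain q0 where q0: "\<And>w. poly cp w = 0 \<Longrightarrow> poly q0 w = Ln (poly u w)" by auto
  obtain r where r: "exp_poly A (- q0) = poly_mat A r" "\<And>w. poly cp w = 0 \<Longrightarrow> poly r w = exp (poly (- q0) w)"
    using exp_poly_is_poly by blast
  have "poly (u * r - 1) w = 0" if "poly cp w = 0" for w
    using r(2)[OF that] q0[OF that] u[OF that] by (simp add: exp_minus)
  from unipotent_log_exists[of "u * r - 1" 1 1, OF this]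
  obtain q where "exp_poly A q = poly_mat A (u * r)" by auto
  then have "exp_poly A (q + q0) = poly_mat A u * (exp_poly A (- q0) * exp_poly A q0)"
    unfolding exp_poly_add[OF A] by (simp add: poly_mat_mult[OF A] r assoc_mult_mat[of _ m m _ m _ m])
  then have "exp_poly A (q + q0) = poly_mat A u" by (simp add: exp_poly_minus(2)[OF A] right_mult_one_mat[of _ m])
  then show ?thesis ..
qed

end

text \<open>A vector v fails to be cyclic only if (\<open>cp\<close> / (x - w))(A) v = 0 for some
  root w: the minimal annihilator of v divides \<open>cp\<close>, and if it is a proper divisor it
  divides one of these quotients. As A is nonderogatory, no quotient vanishes at A, so a generic v
  works.\<close>

lemma cyclic_vector_exists:
  assumes A: "A \<in> carrier_mat m m" and nd: "nonderogatory A"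
  shows "\<exists>v. cyclic_vector A m v"
proof -
  define cp where "cp = char_poly A"
  \<comment> \<open>Points of the moment curve: a nonzero row applied to \<open>v s\<close> is a
    nonzero polynomial in s, so each root excludes finitely many s.\<close>
  define v where "v s = mat m 1 (\<lambda>(i, _). s ^ i)" for s :: complex
  define R where "R = {w. poly cp w = 0}"
  have finR: "finite R" unfolding R_def cp_def by (rule poly_roots_finite[OF char_poly_nz[OF A]])
  define H where "H w = poly_mat A (synthetic_div cp w)" for w
  have Hc: "H w \<in> carrier_mat m m" for w using A by (simp add: H_def)
  have "finite {s. H w * v s = 0\<^sub>m m 1}" if w: "w \<in> R" for w
  proof -
    have "poly (char_poly A) w = 0" using w by (simp add: R_def cp_def)
    note h = synthetic_div_char_poly[OF A this, folded cp_def]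
    have "H w \<noteq> 0\<^sub>m m m" using nd h A unfolding nonderogatory_def H_def by auto
    then obtain i j where ij: "i < m" "j < m" "H w $$ (i, j) \<noteq> 0"
      using Hc[of w] by (metis carrier_matD eq_matI index_zero_mat)
    define P where "P = (\<Sum>l<m. monom (H w $$ (i, l)) l)"
    have "coeff P j \<noteq> 0" using ij by (simp add: P_def coeff_sum)
    then have "P \<noteq> 0" by auto
    moreover have "poly P s = (H w * v s) $$ (i, 0)" for s
      using ij Hc[of w] by (simp add: P_def poly_sum poly_monom scalar_prod_def v_def atLeast0LessThan)
    then have "{s. H w * v s = 0\<^sub>m m 1} \<subseteq> {s. poly P s = 0}" using ij by auto
    ultimately show ?thesis using poly_roots_finite finite_subset by blast
  qed
  with finR have "finite (\<Union>w\<in>R. {s. H w * v s = 0\<^sub>m m 1})" by blast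
  then obtain s where s: "s \<notin> (\<Union>w\<in>R. {s. H w * v s = 0\<^sub>m m 1})"
    using ex_new_if_finite[OF infinite_UNIV_char_0] by blast
  have vc: "v s \<in> carrier_mat m 1" by (simp add: v_def)
  have "cyclic_vector A m (v s)"
  proof
    fix p assume p: "degree p < m" "poly_mat A p * v s = 0\<^sub>m m 1"
    show "p = 0"
    proof (rule ccontr)
      assume "p \<noteq> 0"
      define Q where "Q p \<longleftrightarrow> p \<noteq> 0 \<and> poly_mat A p * v s = 0\<^sub>m m 1" for p
      obtain p0 where p0: "Q p0" "\<And>q. Q q \<Longrightarrow> degree p0 \<le> degree q"
        using exists_least_iff[of "\<lambda>d. \<exists>q. Q q \<and> degree q = d"] \<open>p \<noteq> 0\<close> p
        by (metis Q_def not_le)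
      have deg: "degree p0 < m" using p0(2)[of p] p \<open>p \<noteq> 0\<close> by (simp add: Q_def)
      \<comment> \<open>A nonzero remainder that kills \<open>v s\<close> would undercut the minimal
        degree of \<open>p0\<close>.\<close>
      have "\<not> Q (cp mod p0)"
        using p0 degree_mod_less[of p0 cp] by (metis Q_def not_le)
      moreover have "poly_mat A (cp mod p0) * v s = 0\<^sub>m m 1"
      proof -
        have "poly_mat A (cp mod p0) = poly_mat A cp - poly_mat A (cp div p0) * poly_mat A p0"
          using A by (simp add: minus_div_mult_eq_mod[symmetric] poly_mat_diff poly_mat_mult)
        also have "\<dots> * v s = poly_mat A cp * v s - poly_mat A (cp div p0) * (poly_mat A p0 * v s)"
          using A vc by (simp add: minus_mult_distrib_mat[of _ m m _ _ 1] assoc_mult_mat[of _ m m _ m _ 1] mult_carrier_mat[of _ m m _ m])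
        also have "\<dots> = 0\<^sub>m m 1"
          using p0(1) A vc by (simp add: Q_def cp_def cayley_hamilton left_mult_zero_mat[of _ m] right_mult_zero_mat[of _ m m])
        finally show ?thesis .
      qed
      ultimately have "cp mod p0 = 0" by (simp add: Q_def)
      then obtain q where q: "cp = p0 * q" by (auto elim: dvdE)
      have "cp \<noteq> 0" "degree cp = m" using char_poly_facts[OF A] by (auto simp: cp_def)
      then have "degree q \<noteq> 0" using q deg degree_mult_eq[of p0 q] by (cases "q = 0") auto
      then obtain w where w: "poly q w = 0"
        using fundamental_theorem_of_algebra[of q] constant_degree[of q] by auto
      then have wR: "w \<in> R" using q by (simp add: R_def)
      obtain q' where q': "q = [:- w, 1:] * q'" using w by (auto simp: poly_eq_0_iff_dvd)
      have "[:- w, 1:] * synthetic_div cp w = [:- w, 1:] * (q' * p0)"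
        using synthetic_div_char_poly(1)[OF A, of w] wR unfolding R_def cp_def[symmetric] q q'
        by (simp only: mult_ac mem_Collect_eq)
      then have "synthetic_div cp w = q' * p0" by (metis mult_cancel_left pCons_eq_0_iff one_neq_zero)
      then have "H w * v s = poly_mat A q' * (poly_mat A p0 * v s)"
        using A vc by (simp add: H_def poly_mat_mult assoc_mult_mat[of _ m m _ m _ 1])
      also have "\<dots> = 0\<^sub>m m 1" using p0(1) A by (simp add: Q_def right_mult_zero_mat[of _ m m])
      finally show False using s wR by auto
    qed
  qed (use A vc in auto)
  then show ?thesis ..
qed

section \<open>Bordered matrices\<close>

lemma row_times_column:
  fixes l u :: "complex mat"
  assumes "l \<in> carrier_mat 1 m" "u \<in> carrier_mat m 1"
  shows "(l * u) $$ (0, 0) = (\<Sum>i<m. l $$ (0, i) * u $$ (i, 0))"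
  using assms by (simp add: scalar_prod_def atLeast0LessThan)

context cyclic_vector
begin

text \<open>\<open>l\<close> is the last row of the inverse Krylov matrix, so it reads off the
  coefficient of A^(m-1) v.\<close>

lemma dual_vector_exists:
  obtains l where "l \<in> carrier_mat 1 m"
    "\<And>p. m > 0 \<Longrightarrow> (l * (poly_mat A p * v)) $$ (0, 0) = coeff (p mod cp) (m - 1)"
proof -
  obtain V where V: "V \<in> carrier_mat m m" "det V \<noteq> 0"
    "\<And>x i. i < m \<Longrightarrow> (poly_mat A (basis_poly x) * v) $$ (i, 0) = (\<Sum>j<m. V $$ (i, j) * x j)"
    using krylov by blast
  define l where "l = mat 1 m (\<lambda>(_, j). adj_mat V $$ (m - 1, j) / det V)"
  have l: "l \<in> carrier_mat 1 m" by (simp add: l_def)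
  have lV: "(\<Sum>i<m. l $$ (0, i) * V $$ (i, j)) = (if j = m - 1 then 1 else 0)" if "j < m" for j
  proof -
    have "(\<Sum>i<m. adj_mat V $$ (m - 1, i) * V $$ (i, j)) = (adj_mat V * V) $$ (m - 1, j)"
      using that V(1) adj_mat(1)[OF V(1)] by (simp add: scalar_prod_def atLeast0LessThan)
    also have "\<dots> = (if j = m - 1 then det V else 0)"
      using that by (auto simp: adj_mat(3)[OF V(1)])
    finally show ?thesis using V(2) by (auto simp: l_def simp flip: sum_divide_distrib)
  qed
  have "(l * (poly_mat A p * v)) $$ (0, 0) = coeff (p mod cp) (m - 1)" if "m > 0" for p
  proof -
    have "p mod cp = basis_poly (coeff (p mod cp))"
      by (intro poly_eqI) (use degree_mod_char_poly[OF that, of p] in \<open>auto simp: coeff_basis_poly coeff_eq_0\<close>)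
    then have "(poly_mat A p * v) $$ (i, 0) = (\<Sum>j<m. V $$ (i, j) * coeff (p mod cp) j)" if "i < m" for i
      using V(3)[OF that] poly_mat_mod by metis
    moreover have "(l * (poly_mat A p * v)) $$ (0, 0) = (\<Sum>i<m. l $$ (0, i) * (poly_mat A p * v) $$ (i, 0))"
      by (rule row_times_column[OF l]) (simp add: mult_carrier_mat[of _ m m])
    ultimately have "(l * (poly_mat A p * v)) $$ (0, 0) = (\<Sum>i<m. \<Sum>j<m. l $$ (0, i) * V $$ (i, j) * coeff (p mod cp) j)"
      by (simp add: sum_distrib_left mult.assoc)
    also have "\<dots> = (\<Sum>j<m. (\<Sum>i<m. l $$ (0, i) * V $$ (i, j)) * coeff (p mod cp) j)"
      by (subst sum.swap) (simp add: sum_distrib_right)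
    also have "\<dots> = (\<Sum>j<m. if j = m - 1 then coeff (p mod cp) j else 0)"
      by (intro sum.cong refl) (simp add: lV)
    also have "\<dots> = coeff (p mod cp) (m - 1)" using that by simp
    finally show ?thesis .
  qed
  with l that show ?thesis by blast
qed

end

text \<open>The functional that \<open>l\<close> induces on C[x]/(\<open>cp\<close>) is the top
  coefficient of the remainder, equivalently the sum of the residues of p/\<open>cp\<close>. It
  makes the quotient a Frobenius algebra; hence \<open>l\<close> is cyclic for row vectors as
  well.\<close>

locale cyclic_pair = cyclic_vector +
  fixes l :: "complex mat"
  assumes l [simp]: "l \<in> carrier_mat 1 m" and pos: "m > 0"
    and pairing: "\<And>p. (l * (poly_mat A p * v)) $$ (0, 0) = coeff (p mod cp) (m - 1)"
begin

lemma covector_eq_0D: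
  assumes p: "degree p < m" and 0: "l * poly_mat A p = 0\<^sub>m 1 m"
  shows "p = 0"
proof (rule ccontr)
  assume "p \<noteq> 0"
  \<comment> \<open>Multiplication by x^k lifts p to degree exactly m - 1, where the functional
    returns its leading coefficient.\<close>
  define k where "k = m - 1 - degree p"
  define q where "q = p * monom 1 k"
  have "degree q = m - 1" using p \<open>p \<noteq> 0\<close> pos
    by (simp add: q_def k_def degree_mult_eq degree_monom_eq monom_eq_0_iff)
  then have q: "q mod cp = q" "coeff q (m - 1) = lead_coeff q"
    using degree_char_poly[OF A] pos by (auto intro: mod_poly_less)
  have "l * (poly_mat A q * v) = l * poly_mat A p * (poly_mat A (monom 1 k) * v)"
    by (simp add: q_def poly_mat_mult[OF A] assoc_mult_mat[of _ m m _ m _ 1] assoc_mult_mat[of _ 1 m _ m _ 1] mult_carrier_mat[of _ m m])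
  also have "\<dots> = 0\<^sub>m 1 1" unfolding 0 by (rule left_mult_zero_mat) (simp add: mult_carrier_mat[of _ m m])
  finally have "coeff q (m - 1) = 0" using pairing[of q] q by simp
  then have "q = 0" using q by simp
  with \<open>p \<noteq> 0\<close> show False by (simp add: q_def monom_eq_0_iff)
qed

text \<open>Lets the results on columns be reused for rows.\<close>

lemma transpose_cyclic: "cyclic_vector (transpose_mat A) m (transpose_mat l)"
proof
  fix p assume p: "degree p < m" "poly_mat (transpose_mat A) p * transpose_mat l = 0\<^sub>m m 1"
  have "transpose_mat (l * poly_mat A p) = 0\<^sub>m m 1"
    using p(2) by (simp add: poly_mat_transpose[OF A] transpose_mult[of _ 1 m _ m])
  then have "l * poly_mat A p = transpose_mat (0\<^sub>m m 1)" by (metis transpose_transpose)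
  then show "p = 0" using p(1) by (intro covector_eq_0D) auto
qed (auto intro: transpose_carrier_mat[THEN iffD2])

lemma covector_poly_eq_iff: "l * poly_mat A p = l * poly_mat A q \<longleftrightarrow> cp dvd p - q"
proof -
  interpret T: cyclic_vector "transpose_mat A" m "transpose_mat l" by (rule transpose_cyclic)
  have tr: "transpose_mat (l * poly_mat A p) = poly_mat (transpose_mat A) p * transpose_mat l" for p
    by (simp add: poly_mat_transpose[OF A] transpose_mult[of _ 1 m _ m])
  have "l * poly_mat A p = l * poly_mat A q \<longleftrightarrow> transpose_mat (l * poly_mat A p) = transpose_mat (l * poly_mat A q)"
    by (metis transpose_transpose)
  then show ?thesis unfolding tr T.poly_mat_vec_eq_iff char_poly_transpose_mat[OF A] .
qed

lemma covector_poly_exists: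
  assumes c: "c \<in> carrier_mat 1 m"
  shows "\<exists>p. c = l * poly_mat A p"
proof -
  interpret T: cyclic_vector "transpose_mat A" m "transpose_mat l" by (rule transpose_cyclic)
  obtain p where "transpose_mat c = poly_mat (transpose_mat A) p * transpose_mat l"
    using T.vector_poly_exists[of "transpose_mat c"] c by auto
  also have "\<dots> = transpose_mat (l * poly_mat A p)"
    by (simp add: poly_mat_transpose[OF A] transpose_mult[of _ 1 m _ m])
  finally show ?thesis by (metis transpose_transpose)
qed

end

lemma cyclic_pair_exists:
  assumes A: "A \<in> carrier_mat m m" and nd: "nonderogatory A" and "m > 0"
  obtains v l where "cyclic_pair A m v l"
proof -
  obtain v where "cyclic_vector A m v" using cyclic_vector_exists[OF A nd] by blast
  then interpret cyclic_vector A m v .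
  obtain l where "l \<in> carrier_mat 1 m"
    "\<And>p. m > 0 \<Longrightarrow> (l * (poly_mat A p * v)) $$ (0, 0) = coeff (p mod cp) (m - 1)"
    using dual_vector_exists by blast
  with \<open>m > 0\<close> have "cyclic_pair A m v l" by unfold_locales auto
  with that show ?thesis .
qed

section \<open>The characteristic polynomial of a bordered matrix\<close>

definition bordered :: "complex mat \<Rightarrow> complex mat \<Rightarrow> complex mat \<Rightarrow> complex \<Rightarrow> complex mat" where
  "bordered A b c d = four_block_mat A b c (mat 1 1 (\<lambda>_. d))"

lemma bordered_closed [simp]: "A \<in> carrier_mat m m \<Longrightarrow> bordered A b c d \<in> carrier_mat (m + 1) (m + 1)"
  by (auto simp: bordered_def intro!: four_block_carrier_mat)

text \<open>The Schur complement at a point x where x - A is invertible. With h = (\<chi> -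
  \<chi>(x))/(X - x) in the variable X, one has (x - A) h(A) = \<chi>(x), so h(A) is \<chi>(x) times
  the inverse of x - A.\<close>

lemma poly_char_poly_bordered:
  assumes A: "A \<in> carrier_mat m m" and b: "b \<in> carrier_mat m 1" and c: "c \<in> carrier_mat 1 m"
    and x: "poly (char_poly A) x \<noteq> 0"
  shows "poly (char_poly (bordered A b c d)) x
    = (x - d) * poly (char_poly A) x - (c * (poly_mat A (synthetic_div (char_poly A) x) * b)) $$ (0, 0)"
proof -
  define h where "h = synthetic_div (char_poly A) x"
  define \<mu> where "\<mu> = poly (char_poly A) x"
  define H where "H = poly_mat A h"
  have H: "H \<in> carrier_mat m m" using A by (simp add: H_def)
  define X where "X = x \<cdot>\<^sub>m 1\<^sub>m m - A"
  have X: "X \<in> carrier_mat m m" by (simp only: X_def minus_carrier_mat[OF A])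
  have XH: "X * H = \<mu> \<cdot>\<^sub>m 1\<^sub>m m"
  proof -
    have eq: "[:- x, 1:] * h + [:\<mu>:] = char_poly A" unfolding h_def \<mu>_def by (rule synthetic_div_correct')
    have "[:x, - 1:] * h = - ([:- x, 1:] * h)" by (simp flip: mult_minus_left)
    also have "\<dots> = [:\<mu>:] - char_poly A"
      unfolding eq[symmetric] by (simp only: diff_add_eq_diff_diff_swap diff_self diff_0)
    finally have "[:x, - 1:] * h = [:\<mu>:] - char_poly A" .
    then have "poly_mat A ([:x, - 1:] * h) = poly_mat A ([:\<mu>:] - char_poly A)" by simp
    moreover have "poly_mat A ([:\<mu>:] - char_poly A) = \<mu> \<cdot>\<^sub>m 1\<^sub>m m"
      using A by (auto simp: poly_mat_diff[OF A] poly_mat_const[OF A] cayley_hamilton[OF A])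
    moreover have "poly_mat A [:x, - 1:] = X"
      using A poly_mat_smult[OF A, of "-1" "[:-x, 1:]"] by (auto simp: poly_mat_linear[OF A] X_def)
    ultimately show ?thesis by (simp only: poly_mat_mult[OF A] H_def)
  qed
  have detX: "det X = \<mu>"
    unfolding \<mu>_def char_poly_matrix[OF A] by (rule arg_cong[of _ _ det]) (use A in \<open>auto simp: X_def char_matrix_def\<close>)
  define M where "M = four_block_mat X (- b) (- c) (mat 1 1 (\<lambda>_. x - d))"
  have M: "M \<in> carrier_mat (m + 1) (m + 1)" using X by (auto simp: M_def intro!: four_block_carrier_mat)
  have detM: "det M = poly (char_poly (bordered A b c d)) x"
    unfolding char_poly_matrix[OF bordered_closed[OF A]]
    by (rule arg_cong[of _ _ det], rule eq_matI)
      (use A b c in \<open>auto simp: M_def X_def char_matrix_def bordered_def\<close>)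
  \<comment> \<open>Right multiplication by \<open>N\<close> clears the last column above the
    corner. Its determinant \<mu> cancels against det X = \<mu>, which is where \<open>x\<close>
    being no root enters.\<close>
  define N where "N = four_block_mat (1\<^sub>m m) (H * b) (0\<^sub>m 1 m) (mat 1 1 (\<lambda>_. \<mu>))"
  have N: "N \<in> carrier_mat (m + 1) (m + 1)" by (auto simp: N_def intro!: four_block_carrier_mat)
  have Hb: "H * b \<in> carrier_mat m 1" using H b by simp
  have det1: "det (mat 1 1 (\<lambda>_. y)) = y" for y :: complex by (subst det_single[of _ ]) auto
  have detN: "det N = \<mu>"
    unfolding N_def by (subst det_four_block_mat_lower_left_zero[of _ m _ 1]) (use Hb in \<open>auto simp: det1\<close>)
  define s where "s = (x - d) * \<mu> - (c * (H * b)) $$ (0, 0)"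
  have "M * N = four_block_mat (X * 1\<^sub>m m + - b * 0\<^sub>m 1 m) (X * (H * b) + - b * mat 1 1 (\<lambda>_. \<mu>))
      (- c * 1\<^sub>m m + mat 1 1 (\<lambda>_. x - d) * 0\<^sub>m 1 m) (- c * (H * b) + mat 1 1 (\<lambda>_. x - d) * mat 1 1 (\<lambda>_. \<mu>))"
    unfolding M_def N_def by (rule mult_four_block_mat[of _ m m _ 1 _ 1 _ _ m _ 1]) (use X b c Hb in auto)
  also have "X * 1\<^sub>m m + - b * 0\<^sub>m 1 m = X" using X b by (simp add: right_mult_zero_mat[of _ m 1])
  also have "X * (H * b) + - b * mat 1 1 (\<lambda>_. \<mu>) = 0\<^sub>m m 1"
  proof -
    have "X * (H * b) = \<mu> \<cdot>\<^sub>m b"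
      using XH X H b by (simp add: mult_smult_assoc_mat[of _ m m _ 1] flip: assoc_mult_mat[of _ m m _ m _ 1])
    then show ?thesis using b by (auto simp: scalar_prod_def One_nat_def intro!: eq_matI)
  qed
  also have "- c * (H * b) + mat 1 1 (\<lambda>_. x - d) * mat 1 1 (\<lambda>_. \<mu>) = mat 1 1 (\<lambda>_. s)"
  proof -
    have "- c * (H * b) = - (c * (H * b))" using c Hb by (intro eq_matI) (auto simp: scalar_prod_def sum_negf)
    then show ?thesis using c Hb
      by (intro eq_matI) (auto simp: s_def scalar_prod_def)
  qed
  finally have "M * N = four_block_mat X (0\<^sub>m m 1) (- c * 1\<^sub>m m + mat 1 1 (\<lambda>_. x - d) * 0\<^sub>m 1 m) (mat 1 1 (\<lambda>_. s))" .
  then have "det (M * N) = det X * det (mat 1 1 (\<lambda>_. s))"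
    by (simp only:, subst det_four_block_mat_upper_right_zero[of _ m _ 1]) (use X c in auto)
  moreover have "det (M * N) = det M * det N" by (rule det_mult[OF M N])
  ultimately show ?thesis
    using x detN detX detM by (simp add: det1 s_def H_def h_def \<mu>_def)
qed

definition sreg_at :: "complex mat \<Rightarrow> complex mat \<Rightarrow> complex mat \<Rightarrow> bool" where
  "sreg_at A b c \<longleftrightarrow> (\<forall>p. degree p < dim_row A \<longrightarrow> poly_mat A p * b = 0\<^sub>m (dim_row A) 1
     \<longrightarrow> c * poly_mat A p = 0\<^sub>m 1 (dim_row A) \<longrightarrow> p = 0)"

text \<open>Here \<open>synthetic_div \<chi> w\<close> is \<open>\<chi> / (x - w)\<close>; in the coordinate \<open>b = \<beta>(A) v\<close> the condition is
  \<open>\<beta>(w) \<noteq> 0\<close>.\<close>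
definition excites :: "complex mat \<Rightarrow> complex mat \<Rightarrow> complex \<Rightarrow> bool" where
  "excites A b w \<longleftrightarrow> poly_mat A (synthetic_div (char_poly A) w) * b \<noteq> 0\<^sub>m (dim_row A) 1"

context cyclic_pair
begin

text \<open>Off the roots of \<open>cp\<close> the Schur term is the top coefficient of f h modulo
  \<open>cp\<close>, for f the remainder of \<beta>\<gamma> and h as in the Schur complement, and
  this coefficient is f(x). Agreement off finitely many points suffices.\<close>

lemma char_poly_bordered:
  "char_poly (bordered A (poly_mat A \<beta> * v) (l * poly_mat A \<gamma>) d) = [:- d, 1:] * cp - (\<beta> * \<gamma>) mod cp"
proof -
  define f where "f = (\<beta> * \<gamma>) mod cp"
  define P where "P = char_poly (bordered A (poly_mat A \<beta> * v) (l * poly_mat A \<gamma>) d)"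
  have "poly P x = poly ([:- d, 1:] * cp - f) x" if x: "poly cp x \<noteq> 0" for x
  proof -
    define h where "h = synthetic_div cp x"
    have h: "[:- x, 1:] * h + [:poly cp x:] = cp" unfolding h_def by (rule synthetic_div_correct')
    have dh: "degree h < m" unfolding h_def degree_synthetic_div degree_char_poly[OF A] using pos by simp
    have "coeff cp m = 1" "m = Suc (m - 1)" using degree_monic_char_poly[OF A] pos by auto
    then have h1: "coeff h (m - 1) = 1"
      using arg_cong[OF h, of "\<lambda>p. coeff p m"] dh by (simp add: coeff_eq_0 coeff_pCons split: nat.splits)
    define s where "s = synthetic_div f x"
    have s: "[:- x, 1:] * s + [:poly f x:] = f" unfolding s_def by (rule synthetic_div_correct')
    have df: "degree f < m" unfolding f_def by (rule degree_mod_char_poly[OF pos])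
    have ds: "degree s < m" unfolding s_def degree_synthetic_div using df by simp
    have s1: "coeff s (m - 1) = 0"
    proof (cases "degree f = 0")
      case True
      then have "s = 0" by (simp add: s_def synthetic_div_eq_0_iff)
      then show ?thesis by simp
    next
      case False
      then show ?thesis using df by (intro coeff_eq_0) (simp add: s_def degree_synthetic_div)
    qed
    \<comment> \<open>Writing f = (X - x) s + f(x) and (X - x) h = \<open>cp\<close> -
      \<open>cp\<close>(x), the product f h is congruent to this g. Its coefficient at m - 1 is
      f(x), since h is monic of degree m - 1 and s has smaller degree or is 0.\<close>
    define g where "g = Polynomial.smult (poly f x) h - Polynomial.smult (poly cp x) s"
    have "f * h = s * ([:- x, 1:] * h) + Polynomial.smult (poly f x) h"
      by (subst s[symmetric]) (simp add: algebra_simps)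
    also have "[:- x, 1:] * h = cp - [:poly cp x:]" using h by (simp add: algebra_simps)
    finally have "f * h = s * cp + g" by (simp add: g_def algebra_simps)
    then have "(\<gamma> * h * \<beta>) mod cp = g mod cp"
      by (metis (no_types, lifting) f_def mod_mult_left_eq mult.assoc mult.commute mod_mult_self3)
    also have "\<dots> = g" using dh ds degree_char_poly[OF A]
      by (intro mod_poly_less) (auto simp: g_def intro!: degree_diff_less le_less_trans[OF degree_smult_le])
    finally have "(l * (poly_mat A (\<gamma> * h * \<beta>) * v)) $$ (0, 0) = poly f x"
      by (simp only: pairing) (simp add: g_def h1 s1)
    moreover have "l * (poly_mat A (\<gamma> * h * \<beta>) * v) = l * poly_mat A \<gamma> * (poly_mat A h * (poly_mat A \<beta> * v))"
      by (simp add: poly_mat_mult[OF A] assoc_mult_mat[of _ m m _ m _ 1] assoc_mult_mat[of _ 1 m _ m _ 1] mult_carrier_mat[of _ m m])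
    ultimately show ?thesis
      unfolding P_def by (subst poly_char_poly_bordered[OF A _ _ x])
        (auto simp: h_def algebra_simps intro: mult_carrier_mat[of _ m m] mult_carrier_mat[of _ 1 m])
  qed
  \<comment> \<open>The factor \<open>cp\<close> makes the product vanish at the roots of
    \<open>cp\<close> too.\<close>
  then have "poly ((P - ([:- d, 1:] * cp - f)) * cp) x = 0" for x by auto
  then have "(P - ([:- d, 1:] * cp - f)) * cp = 0" using poly_all_0_iff_0 by blast
  then show ?thesis using char_poly_nz[OF A] by (simp add: P_def f_def)
qed

lemma vec_annihilated_iff: "poly_mat A p * (poly_mat A \<beta> * v) = 0\<^sub>m m 1 \<longleftrightarrow> cp dvd p * \<beta>"
  unfolding poly_mat_vec_eq_0_iff[symmetric] poly_mat_mult[OF A] by (simp add: assoc_mult_mat[of _ m m _ m _ 1])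

lemma covec_annihilated_iff: "l * poly_mat A \<gamma> * poly_mat A p = 0\<^sub>m 1 m \<longleftrightarrow> cp dvd \<gamma> * p"
  using covector_poly_eq_iff[of "\<gamma> * p" 0] poly_mat_0[of A]
  by (simp add: poly_mat_mult[OF A] right_mult_zero_mat[of _ 1 m] assoc_mult_mat[of _ 1 m _ m _ m])

lemma excites_iff:
  assumes w: "poly cp w = 0"
  shows "excites A (poly_mat A \<beta> * v) w \<longleftrightarrow> poly \<beta> w \<noteq> 0"
proof -
  note h = synthetic_div_char_poly[OF A w]
  have "cp dvd synthetic_div cp w * \<beta> \<longleftrightarrow> [:- w, 1:] * synthetic_div cp w dvd \<beta> * synthetic_div cp w"
    by (subst h(1)) (simp only: mult.commute)
  also have "\<dots> \<longleftrightarrow> poly \<beta> w = 0" using h(2) by (simp only: dvd_mult_cancel_right poly_eq_0_iff_dvd) simp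
  finally show ?thesis by (simp add: excites_def vec_annihilated_iff)
qed

text \<open>A common zero w of \<beta> and \<gamma> on the spectrum makes \<open>cp\<close> / (x -
  w) a violating p. Without one, a generic \<beta> + a\<gamma> is a unit modulo \<open>cp\<close>,
  so p must be a multiple of \<open>cp\<close>.\<close>

lemma sreg_at_iff:
  "sreg_at A (poly_mat A \<beta> * v) (l * poly_mat A \<gamma>) \<longleftrightarrow> (\<forall>w. poly cp w = 0 \<longrightarrow> poly \<beta> w \<noteq> 0 \<or> poly \<gamma> w \<noteq> 0)"
    (is "?L \<longleftrightarrow> ?R")
proof
  assume L: ?L
  show ?R
  proof (rule ccontr)
    assume "\<not> ?R"
    then obtain w where w: "poly cp w = 0" "poly \<beta> w = 0" "poly \<gamma> w = 0" by blast
    note h = synthetic_div_char_poly[OF A w(1)]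
    have "cp dvd synthetic_div cp w * \<beta>" "cp dvd synthetic_div cp w * \<gamma>"
      using w(2,3) h(1) by (metis poly_eq_0_iff_dvd dvd_refl mult.commute mult_dvd_mono)+
    with L h(2,3) show False
      by (simp add: sreg_at_def vec_annihilated_iff covec_annihilated_iff mult.commute)
  qed
next
  assume R: ?R
  have "finite {w. poly cp w = 0}" by (rule poly_roots_finite[OF char_poly_nz[OF A]])
  then obtain a where a: "\<And>w. w \<in> {w. poly cp w = 0} \<Longrightarrow> poly \<beta> w + a * poly \<gamma> w \<noteq> 0"
    using generic_scalar[of "{w. poly cp w = 0}" "poly \<beta>" "poly \<gamma>"] R by blast
  then have cop: "coprime cp (\<beta> + Polynomial.smult a \<gamma>)"
    by (intro coprime_if_no_common_root char_poly_nz[OF A]) auto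
  show ?L unfolding sreg_at_def
  proof (intro allI impI)
    fix p assume p: "degree p < dim_row A" "poly_mat A p * (poly_mat A \<beta> * v) = 0\<^sub>m (dim_row A) 1"
      "l * poly_mat A \<gamma> * poly_mat A p = 0\<^sub>m 1 (dim_row A)"
    then have "cp dvd p * \<beta>" "cp dvd \<gamma> * p" by (simp_all add: vec_annihilated_iff covec_annihilated_iff)
    then have "cp dvd p * \<beta> + Polynomial.smult a (\<gamma> * p)" by (intro dvd_add dvd_smult)
    then have "cp dvd p * (\<beta> + Polynomial.smult a \<gamma>)" by (simp add: algebra_simps)
    with cop have "cp dvd p" by (simp add: coprime_dvd_mult_left_iff)
    with p(1) degree_char_poly[OF A] show "p = 0" by (metis dims(1) dvd_imp_degree_le leD)
  qed
qed

end

text \<open>In the coordinates \<open>b = \<beta>(A) v\<close>, \<open>c = l \<gamma>(A)\<close> the conjugating element is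
  \<open>(\<beta>' + a \<gamma>) / (\<beta> + a \<gamma>')\<close>; a generic \<open>a\<close> makes numerator and denominator units modulo the
  characteristic polynomial.\<close>
lemma border_transitive:
  assumes A: "A \<in> carrier_mat m m" and nd: "nonderogatory A" and "m > 0"
    and b: "b \<in> carrier_mat m 1" "b' \<in> carrier_mat m 1"
    and c: "c \<in> carrier_mat 1 m" "c' \<in> carrier_mat 1 m"
    and sreg: "sreg_at A b c" "sreg_at A b' c'"
    and char: "char_poly (bordered A b c d) = char_poly (bordered A b' c' d')"
    and ex: "\<And>w. poly (char_poly A) w = 0 \<Longrightarrow> excites A b w = excites A b' w"
  shows "d = d' \<and> (\<exists>q. exp_poly A q * b = b' \<and> c = c' * exp_poly A q)"
proof -
  obtain v l where "cyclic_pair A m v l" using cyclic_pair_exists[OF A nd \<open>m > 0\<close>] .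
  then interpret cyclic_pair A m v l .
  obtain \<beta> \<beta>' \<gamma> \<gamma>' where coords: "b = poly_mat A \<beta> * v" "b' = poly_mat A \<beta>' * v"
    "c = l * poly_mat A \<gamma>" "c' = l * poly_mat A \<gamma>'"
    using vector_poly_exists covector_poly_exists b c by meson
  define f f' where "f = (\<beta> * \<gamma>) mod cp" and "f' = (\<beta>' * \<gamma>') mod cp"
  have eq: "[:- d, 1:] * cp - f = [:- d', 1:] * cp - f'"
    using char unfolding coords char_poly_bordered f_def f'_def .
  have "Polynomial.smult (d' - d) cp = ([:- d, 1:] - [:- d', 1:]) * cp" by simp
  also have "\<dots> = f - f'"
    using eq by (simp only: left_diff_distrib diff_eq_eq) (simp only: algebra_simps)
  finally have ff: "Polynomial.smult (d' - d) cp = f - f'" .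
  \<comment> \<open>In \<open>ff\<close> a multiple of \<open>cp\<close>, which has degree m, equals
    a difference of remainders of degree below m.\<close>
  have dd: "d = d'"
  proof (rule ccontr)
    assume "d \<noteq> d'"
    then have "degree (Polynomial.smult (d' - d) cp) = m" using degree_char_poly[OF A] by simp
    moreover have "degree (f - f') < m"
      unfolding f_def f'_def by (intro degree_diff_less degree_mod_char_poly pos)
    ultimately show False using ff by simp
  qed
  with ff have "cp dvd \<beta> * \<gamma> - \<beta>' * \<gamma>'"
    by (simp add: f_def f'_def mod_eq_dvd_iff)
  have ex': "poly \<beta> w \<noteq> 0 \<longleftrightarrow> poly \<beta>' w \<noteq> 0" if "poly cp w = 0" for w
    using ex[OF that] by (simp add: coords excites_iff[OF that])
  have sr: "poly \<beta> w \<noteq> 0 \<or> poly \<gamma> w \<noteq> 0" "poly \<beta>' w \<noteq> 0 \<or> poly \<gamma>' w \<noteq> 0" if "poly cp w = 0" for w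
    using sreg that by (auto simp: coords sreg_at_iff)
  have fin: "finite ({w. poly cp w = 0} \<times> (UNIV :: bool set))"
    using poly_roots_finite[OF char_poly_nz[OF A]] by simp
  \<comment> \<open>The Boolean tag yields one scalar a that serves \<beta> + a\<gamma>' and
    \<beta>' + a\<gamma> together. If \<beta>(w) = 0 then \<beta>'(w) = 0 by \<open>ex'\<close>, so
    \<gamma>'(w) is nonzero by \<open>sr\<close>; the other case is symmetric.\<close>
  define f1 g1 where "f1 = (\<lambda>(w, t). if t then poly \<beta> w else poly \<beta>' w)"
    and "g1 = (\<lambda>(w, t). if t then poly \<gamma>' w else poly \<gamma> w)"
  have "f1 s \<noteq> 0 \<or> g1 s \<noteq> 0" if s0: "s \<in> {w. poly cp w = 0} \<times> UNIV" for s
  proof -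
    obtain w t where s: "s = (w, t)" "poly cp w = 0" using s0 by blast
    show ?thesis using ex'[OF s(2)] sr[OF s(2)] by (cases t) (auto simp: s(1) f1_def g1_def)
  qed
  then obtain a where a: "\<And>s. s \<in> {w. poly cp w = 0} \<times> UNIV \<Longrightarrow> f1 s + a * g1 s \<noteq> 0"
    using generic_scalar[OF fin, of f1 g1] by blast
  define D N where "D = \<beta> + Polynomial.smult a \<gamma>'" and "N = \<beta>' + Polynomial.smult a \<gamma>"
  have "poly D w \<noteq> 0" "poly N w \<noteq> 0" if "poly cp w = 0" for w
    using a[of "(w, True)"] a[of "(w, False)"] that by (auto simp: D_def N_def f1_def g1_def)
  then obtain q1 q2 where q: "exp_poly A q1 = poly_mat A D" "exp_poly A q2 = poly_mat A N"
    using log_exists by meson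
  \<comment> \<open>The relations N\<beta> = D\<beta>' and \<gamma>D = \<gamma>'N, which make N/D
    the conjugating unit, fail only by a h and h.\<close>
  define h where "h = \<beta> * \<gamma> - \<beta>' * \<gamma>'"
  have h: "cp dvd h" unfolding h_def by fact
  have "N * \<beta> - D * \<beta>' = Polynomial.smult a h" by (simp add: N_def D_def h_def smult_diff_right algebra_simps)
  then have "cp dvd N * \<beta> - D * \<beta>'" using h by (simp add: dvd_smult)
  then have "poly_mat A N * b = poly_mat A D * b'"
    unfolding poly_mat_vec_eq_iff[symmetric] poly_mat_mult[OF A] coords
    by (simp add: assoc_mult_mat[of _ m m _ m _ 1])
  then have "exp_poly A q2 * b = exp_poly A q1 * b'" by (simp add: q)
  then have "exp_poly A (- q1) * exp_poly A q2 * b = exp_poly A (- q1) * exp_poly A q1 * b'"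
    using b by (simp add: assoc_mult_mat[of _ m m _ m _ 1])
  then have 1: "exp_poly A (q2 - q1) * b = b'"
    using exp_poly_add[OF A, of "- q1" q2] b by (simp add: exp_poly_minus(2)[OF A])
  have "\<gamma> * D - \<gamma>' * N = h" by (simp add: N_def D_def h_def smult_diff_right algebra_simps)
  then have "l * poly_mat A (\<gamma> * D) = l * poly_mat A (\<gamma>' * N)" using h by (simp add: covector_poly_eq_iff)
  then have "c * exp_poly A q1 = c' * exp_poly A q2"
    unfolding poly_mat_mult[OF A] coords q by (simp add: assoc_mult_mat[of _ 1 m _ m _ m])
  then have "c * exp_poly A q1 * exp_poly A (- q1) = c' * exp_poly A q2 * exp_poly A (- q1)" by simp
  then have "c = c' * exp_poly A (q2 - q1)"
    using c exp_poly_add[OF A, of q2 "- q1"]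
    by (simp add: exp_poly_minus(1)[OF A] assoc_mult_mat[of _ 1 m _ m _ m])
  with 1 dd show ?thesis by blast
qed

text \<open>At each point of \<open>S\<close> the full power of the linear factor goes into \<beta>,
  which leaves \<gamma> nonzero there.\<close>

lemma separate_roots:
  fixes P :: "complex poly"
  assumes "finite S" "P \<noteq> 0" "\<And>w. w \<in> S \<Longrightarrow> poly P w = 0"
  shows "\<exists>\<beta> \<gamma>. P = \<beta> * \<gamma> \<and> (\<forall>w. poly \<beta> w = 0 \<longleftrightarrow> w \<in> S) \<and> (\<forall>w\<in>S. poly \<gamma> w \<noteq> 0)"
  using assms
proof (induction S)
  case empty
  show ?case by (rule exI[of _ 1], rule exI[of _ P]) simp
next
  case (insert a S)
  then obtain \<beta> \<gamma> where IH: "P = \<beta> * \<gamma>" "\<And>w. poly \<beta> w = 0 \<longleftrightarrow> w \<in> S" "\<And>w. w \<in> S \<Longrightarrow> poly \<gamma> w \<noteq> 0" by auto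
  then have "\<gamma> \<noteq> 0" using insert.prems by auto
  then obtain \<gamma>' where g: "\<gamma> = [:- a, 1:] ^ order a \<gamma> * \<gamma>'" "\<not> [:- a, 1:] dvd \<gamma>'"
    using order_decomp by blast
  have "poly P a = 0" "poly \<beta> a \<noteq> 0" using insert.prems insert.hyps IH(2) by auto
  then have "order a \<gamma> > 0" using IH(1) \<open>\<gamma> \<noteq> 0\<close> by (simp add: order_root)
  moreover have "poly \<gamma>' w \<noteq> 0" if "w \<in> insert a S" for w
    using that g(2) IH(3)[of w] arg_cong[OF g(1), of "\<lambda>p. poly p w"] by (cases "w = a") (auto simp: poly_eq_0_iff_dvd)
  ultimately show ?case
    by (intro exI[of _ "\<beta> * [:- a, 1:] ^ order a \<gamma>"] exI[of _ \<gamma>'])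
      (use IH g(1) in \<open>auto simp: mult.assoc simp del: mult_pCons_left\<close>)
qed

text \<open>Modulo \<open>cp\<close> the product of the coordinates must be (x - d)
  \<open>cp\<close> - P, that is, -P. So P itself is factored as \<beta>\<gamma>, and the
  coordinates are \<beta> and -\<gamma>.\<close>

lemma border_exists:
  assumes A: "A \<in> carrier_mat m m" and nd: "nonderogatory A" and "m > 0"
    and P: "degree P = m + 1" "lead_coeff P = 1"
    and S: "\<And>w. w \<in> S \<Longrightarrow> poly (char_poly A) w = 0 \<and> poly P w = 0"
  shows "\<exists>b c d. b \<in> carrier_mat m 1 \<and> c \<in> carrier_mat 1 m \<and> char_poly (bordered A b c d) = P \<and> sreg_at A b c
    \<and> (\<forall>w. poly (char_poly A) w = 0 \<longrightarrow> poly P w = 0 \<longrightarrow> (excites A b w \<longleftrightarrow> w \<in> S))"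
proof -
  obtain v l where "cyclic_pair A m v l" using cyclic_pair_exists[OF A nd \<open>m > 0\<close>] .
  then interpret cyclic_pair A m v l .
  \<comment> \<open>The common roots at which \<beta> has to vanish, \<open>excites\<close> being
    \<beta>(w) \<noteq> 0.\<close>
  define T where "T = {w. poly cp w = 0 \<and> poly P w = 0} - S"
  have "finite T" using poly_roots_finite[OF char_poly_nz[OF A]] by (rule rev_finite_subset) (auto simp: T_def)
  moreover have "P \<noteq> 0" using P by auto
  moreover have "poly P w = 0" if "w \<in> T" for w using that by (simp add: T_def)
  ultimately obtain \<beta> \<gamma> where bg: "P = \<beta> * \<gamma>" "\<And>w. poly \<beta> w = 0 \<longleftrightarrow> w \<in> T" "\<And>w. w \<in> T \<Longrightarrow> poly \<gamma> w \<noteq> 0"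
    using separate_roots[of T P] by meson
  \<comment> \<open>Chosen to cancel the coefficient of x^m in (x - d) \<open>cp\<close> - P, so
    that this is a remainder modulo \<open>cp\<close>.\<close>
  define d where "d = coeff ([:0, 1:] * cp - P) m"
  define f where "f = [:- d, 1:] * cp - P"
  have mon: "coeff cp m = 1" "degree cp = m" using degree_monic_char_poly[OF A] by auto
  have "degree f < m"
  proof -
    have "coeff f i = 0" if i: "i \<ge> m" for i
    proof -
      consider "i = m" | "i = Suc m" | "i > Suc m" using i by linarith
      then show ?thesis
      proof cases
        case 1
        then show ?thesis using mon by (simp add: f_def d_def)
      next
        case 2
        have "coeff P (Suc m) = 1" using P by (metis Suc_eq_plus1)
        then show ?thesis using mon 2 by (simp add: f_def coeff_eq_0)
      next
        case 3
        then show ?thesis using mon P by (cases i) (simp_all add: f_def coeff_eq_0)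
      qed
    qed
    then show ?thesis using \<open>m > 0\<close> by (intro degree_lessI) auto
  qed
  then have "f mod cp = f" using mon by (intro mod_poly_less) simp
  moreover have "(\<beta> * (- \<gamma>)) mod cp = f mod cp"
  proof -
    have "- Y - (X - Y) = - X" for X Y :: "complex poly" by simp
    then have "\<beta> * (- \<gamma>) - f = - ([:- d, 1:] * cp)" unfolding f_def bg(1) mult_minus_right .
    then show ?thesis unfolding mod_eq_dvd_iff by (simp only: dvd_minus_iff dvd_triv_right)
  qed
  ultimately have char: "char_poly (bordered A (poly_mat A \<beta> * v) (l * poly_mat A (- \<gamma>)) d) = P"
    by (simp only: char_poly_bordered) (simp add: f_def)
  have sr: "sreg_at A (poly_mat A \<beta> * v) (l * poly_mat A (- \<gamma>))"
    unfolding sreg_at_iff using bg(2,3) by auto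
  show ?thesis
    by (rule exI[of _ "poly_mat A \<beta> * v"], rule exI[of _ "l * poly_mat A (- \<gamma>)"], rule exI[of _ d])
      (use char sr bg(2) in \<open>auto simp: excites_iff T_def mult_carrier_mat[of _ m m] mult_carrier_mat[of _ 1 m]\<close>)
qed

text \<open>For the last unit vector \<open>e\<close> there are \<open>F\<close> and \<open>s\<close>, linear in \<open>q\<close>, such that
  \<open>q(B) e = (F(A) b, s)\<close> and \<open>e\<^sup>T q(B) = (c F(A), s)\<close>, and \<open>deg F = deg q - 1\<close>.\<close>
lemma nonderogatory_bordered:
  assumes A: "A \<in> carrier_mat m m" and b: "b \<in> carrier_mat m 1" and c: "c \<in> carrier_mat 1 m"
    and sreg: "sreg_at A b c" and "m > 0"
  shows "nonderogatory (bordered A b c d)"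
proof -
  define B where "B = bordered A b c d"
  have B: "B \<in> carrier_mat (m + 1) (m + 1)" unfolding B_def using A by simp
  have Bix: "B $$ (i, j) = (if i < m then if j < m then A $$ (i, j) else b $$ (i, 0)
      else if j < m then c $$ (0, j) else d)" if "i \<le> m" "j \<le> m" for i j
    using that A b c by (auto simp: B_def bordered_def)
  have sum: "(\<Sum>k<m + 1. g k) = (\<Sum>k<m. g k) + g m" for g :: "nat \<Rightarrow> complex"
    by (subst Suc_eq_plus1[symmetric]) simp
  \<comment> \<open>The last three conjuncts serve the end of the proof: q(B) = 0 with deg q \<le> m
    forces F = 0 by strong regularity, then q is constant, and then s is that constant.\<close>
  define R where "R q F s \<longleftrightarrow> (\<forall>i\<le>m. poly_mat B q $$ (i, m) = (if i < m then (poly_mat A F * b) $$ (i, 0) else s))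
      \<and> (\<forall>i<m. poly_mat B q $$ (m, i) = (c * poly_mat A F) $$ (0, i))
      \<and> degree F \<le> degree q - 1 \<and> (F = 0 \<longleftrightarrow> degree q = 0) \<and> (degree q = 0 \<longrightarrow> s = coeff q 0)" for q F s
  have R: "\<And>i. i \<le> m \<Longrightarrow> poly_mat B q $$ (i, m) = (if i < m then (poly_mat A F * b) $$ (i, 0) else s)"
      "\<And>i. i < m \<Longrightarrow> poly_mat B q $$ (m, i) = (c * poly_mat A F) $$ (0, i)"
      "degree F \<le> degree q - 1" "F = 0 \<longleftrightarrow> degree q = 0" "degree q = 0 \<longrightarrow> s = coeff q 0"
      if "R q F s" for q F s
    using that unfolding R_def by blast+
  have key: "\<exists>F s. R q F s" for q
  proof (induction q)
    case 0
    show ?case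
      unfolding R_def by (rule exI[of _ 0], rule exI[of _ 0]) (use A B b c in \<open>auto simp: poly_mat_0\<close>)
  next
    case (pCons a q)
    then obtain F s where "R q F s" by blast
    note IH = R[OF this]
    define Q where "Q = poly_mat B q"
    have Q: "Q \<in> carrier_mat (m + 1) (m + 1)" using B by (simp add: Q_def)
    have x: "poly_mat B [:0, 1:] = B" using B unfolding poly_mat_linear[OF B] by auto
    have BQ: "B * Q = Q * B" using poly_mat_commute[OF B, of q "[:0, 1:]"] by (simp add: x Q_def)
    define Fb cF where "Fb = poly_mat A F * b" and "cF = c * poly_mat A F"
    have Fb: "Fb \<in> carrier_mat m 1" and cF: "cF \<in> carrier_mat 1 m"
      using A b c by (auto simp: Fb_def cF_def intro: mult_carrier_mat[of _ m m] mult_carrier_mat[of _ 1 m])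
    have xA: "poly_mat A [:0, 1:] = A" using A unfolding poly_mat_linear[OF A] by auto
    \<comment> \<open>From (F(A) b, s), multiplication by B produces A F(A) b + s b on top, so
      passing from q to a + x q replaces F by s + x F.\<close>
    have pF: "poly_mat A (pCons s F) * b = s \<cdot>\<^sub>m b + A * Fb"
      using A b unfolding poly_mat_pCons[OF A] Fb_def
      by (simp add: add_mult_distrib_mat[of _ m m _ _ 1] mult_smult_assoc_mat[of _ m m _ 1] assoc_mult_mat[of _ m m _ m _ 1])
    have "A * poly_mat A F = poly_mat A F * A" using poly_mat_commute[OF A, of "[:0, 1:]" F] by (simp add: xA)
    then have cp: "c * poly_mat A (pCons s F) = s \<cdot>\<^sub>m c + cF * A"
      using A c mult_carrier_mat[OF poly_mat_closed[OF A] A, of F] unfolding poly_mat_pCons[OF A] cF_def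
      by (simp add: mult_add_distrib_mat[of _ 1 m _ m] mult_smult_distrib[of _ 1 m _ m] assoc_mult_mat[of _ 1 m _ m _ m])
    have col: "poly_mat B (pCons a q) $$ (i, m) = (poly_mat A (pCons s F) * b) $$ (i, 0)" if i: "i < m" for i
    proof -
      have "(B * Q) $$ (i, m) = (\<Sum>k<m + 1. B $$ (i, k) * Q $$ (k, m))"
        using i B Q by (simp add: scalar_prod_def atLeast0LessThan)
      also have "\<dots> = (\<Sum>k<m. A $$ (i, k) * Fb $$ (k, 0)) + b $$ (i, 0) * s"
        unfolding sum using i by (simp add: Bix Q_def IH(1) Fb_def)
      also have "\<dots> = (s \<cdot>\<^sub>m b + A * Fb) $$ (i, 0)"
        using i A b Fb by (simp add: scalar_prod_def atLeast0LessThan)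
      finally show ?thesis unfolding pF poly_mat_pCons[OF B] Q_def[symmetric] using i B Q by simp
    qed
    have row: "poly_mat B (pCons a q) $$ (m, i) = (c * poly_mat A (pCons s F)) $$ (0, i)" if i: "i < m" for i
    proof -
      have "(Q * B) $$ (m, i) = (\<Sum>k<m + 1. Q $$ (m, k) * B $$ (k, i))"
        using i B Q by (simp add: scalar_prod_def atLeast0LessThan)
      also have "\<dots> = (\<Sum>k<m. cF $$ (0, k) * A $$ (k, i)) + s * c $$ (0, i)"
        unfolding sum using i IH(1)[of m] by (simp add: Bix Q_def IH(2) cF_def)
      also have "\<dots> = (s \<cdot>\<^sub>m c + cF * A) $$ (0, i)"
        using i A c cF by (simp add: scalar_prod_def atLeast0LessThan)
      finally show ?thesis unfolding cp poly_mat_pCons[OF B] Q_def[symmetric] BQ using i B Q by simp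
    qed
    define s' where "s' = poly_mat B (pCons a q) $$ (m, m)"
    have deg: "degree (pCons s F) \<le> degree (pCons a q) - 1"
      using IH(3,4) by (cases "degree q = 0") (auto split: if_splits)
    have zero: "pCons s F = 0 \<longleftrightarrow> degree (pCons a q) = 0"
    proof
      assume "pCons s F = 0"
      then have "degree q = 0" "coeff q 0 = 0" using IH(4,5) by auto
      then have "q = 0" by (metis leading_coeff_0_iff)
      then show "degree (pCons a q) = 0" by simp
    next
      assume "degree (pCons a q) = 0"
      then have "q = 0" by (auto split: if_splits)
      then show "pCons s F = 0" using IH(4,5) by simp
    qed
    have const: "s' = coeff (pCons a q) 0" if "degree (pCons a q) = 0"
    proof -
      have "q = 0" using that by (auto split: if_splits)
      then show ?thesis using B by (simp add: s'_def poly_mat_const[OF B])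
    qed
    show ?case unfolding R_def
      by (rule exI[of _ "pCons s F"], rule exI[of _ s'])
        (intro conjI; (rule deg zero)?; use col row const in \<open>auto simp: s'_def\<close>)
  qed
  have "q = 0" if q: "degree q < m + 1" "poly_mat B q = 0\<^sub>m (m + 1) (m + 1)" for q
  proof -
    obtain F s where "R q F s" using key by blast
    note F = R[OF this]
    have "poly_mat A F * b = 0\<^sub>m m 1"
    proof (rule eq_matI, goal_cases)
      case (1 i j)
      then show ?case using F(1)[of i] q(2) by simp
    qed (use A b in auto)
    moreover have "c * poly_mat A F = 0\<^sub>m 1 m"
    proof (rule eq_matI, goal_cases)
      case (1 i j)
      then show ?case using F(2)[of j] q(2) by simp
    qed (use A c in auto)
    moreover have "degree F < m" using F(3) q(1) \<open>m > 0\<close> by linarith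
    ultimately have "F = 0" using sreg A by (auto simp: sreg_at_def)
    then have "degree q = 0" "s = coeff q 0" using F(4,5) by auto
    moreover have "s = 0" using F(1)[of m] q(2) by simp
    ultimately show "q = 0" by (metis leading_coeff_0_iff)
  qed
  then show ?thesis using B unfolding nonderogatory_def B_def[symmetric] by auto
qed

section \<open>The flows\<close>

lemma pad_one_closed [simp]: "g \<in> carrier_mat m m \<Longrightarrow> m \<le> n \<Longrightarrow> pad_one n g \<in> carrier_mat n n"
  by (auto simp: pad_one_def intro!: four_block_carrier_mat)

lemma pad_one_index:
  assumes "g \<in> carrier_mat m m" "m \<le> n" "i < n" "j < n"
  shows "pad_one n g $$ (i, j) = (if i < m \<and> j < m then g $$ (i, j) else if i = j then 1 else 0)"
  using assms by (auto simp: pad_one_def)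

lemma pad_one_self: "g \<in> carrier_mat n n \<Longrightarrow> pad_one n g = g"
  by (rule eq_matI) (auto simp: pad_one_def)

lemma pad_one_one: "m \<le> n \<Longrightarrow> pad_one n (1\<^sub>m m) = 1\<^sub>m n"
  by (rule eq_matI) (auto simp: pad_one_def)

lemma pad_one_pad_one:
  assumes g: "g \<in> carrier_mat m m" "m \<le> k" "k \<le> n"
  shows "pad_one n (pad_one k g) = pad_one n g"
proof (rule eq_matI, goal_cases)
  case (1 i j)
  then have ij: "i < n" "j < n" using g by (auto simp: pad_one_def)
  show ?case using pad_one_index[of "pad_one k g" k n i j] pad_one_index[of g m n i j] pad_one_index[of g m k i j] ij g
    by (auto split: if_splits)
qed (use g in \<open>auto simp: pad_one_def\<close>)

lemma pad_one_left_index: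
  assumes g: "g \<in> carrier_mat m m" "m \<le> n" and M: "M \<in> carrier_mat n k" and ij: "i < n" "j < k"
  shows "(pad_one n g * M) $$ (i, j) = (if i < m then \<Sum>l<m. g $$ (i, l) * M $$ (l, j) else M $$ (i, j))"
proof -
  have P: "pad_one n g \<in> carrier_mat n n" using g by simp
  have "(pad_one n g * M) $$ (i, j) = (\<Sum>l<n. pad_one n g $$ (i, l) * M $$ (l, j))"
    using P M ij by (simp add: scalar_prod_def atLeast0LessThan)
  also have "\<dots> = (if i < m then \<Sum>l<m. g $$ (i, l) * M $$ (l, j) else M $$ (i, j))"
  proof (cases "i < m")
    case True
    have "(\<Sum>l<n. pad_one n g $$ (i, l) * M $$ (l, j)) = (\<Sum>l<m. pad_one n g $$ (i, l) * M $$ (l, j))"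
      using g ij True by (intro sum.mono_neutral_right) (auto simp: pad_one_index)
    also have "\<dots> = (\<Sum>l<m. g $$ (i, l) * M $$ (l, j))"
      using g ij True by (intro sum.cong refl) (auto simp: pad_one_index)
    finally show ?thesis using True by simp
  next
    case False
    have "(\<Sum>l<n. pad_one n g $$ (i, l) * M $$ (l, j)) = (\<Sum>l<n. if i = l then M $$ (l, j) else 0)"
      using g ij False by (intro sum.cong refl) (auto simp: pad_one_index)
    then show ?thesis using False ij by simp
  qed
  finally show ?thesis .
qed

lemma pad_one_right_index:
  assumes g: "g \<in> carrier_mat m m" "m \<le> n" and M: "M \<in> carrier_mat k n" and ij: "i < k" "j < n"
  shows "(M * pad_one n g) $$ (i, j) = (if j < m then \<Sum>l<m. M $$ (i, l) * g $$ (l, j) else M $$ (i, j))"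
proof -
  have P: "pad_one n g \<in> carrier_mat n n" using g by simp
  have "(M * pad_one n g) $$ (i, j) = (\<Sum>l<n. M $$ (i, l) * pad_one n g $$ (l, j))"
    using P M ij by (simp add: scalar_prod_def atLeast0LessThan)
  also have "\<dots> = (if j < m then \<Sum>l<m. M $$ (i, l) * g $$ (l, j) else M $$ (i, j))"
  proof (cases "j < m")
    case True
    have "(\<Sum>l<n. M $$ (i, l) * pad_one n g $$ (l, j)) = (\<Sum>l<m. M $$ (i, l) * pad_one n g $$ (l, j))"
      using g ij True by (intro sum.mono_neutral_right) (auto simp: pad_one_index)
    also have "\<dots> = (\<Sum>l<m. M $$ (i, l) * g $$ (l, j))"
      using g ij True by (intro sum.cong refl) (auto simp: pad_one_index)
    finally show ?thesis using True by simp
  next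
    case False
    have "(\<Sum>l<n. M $$ (i, l) * pad_one n g $$ (l, j)) = (\<Sum>l<n. if l = j then M $$ (i, l) else 0)"
      using g ij False by (intro sum.cong refl) (auto simp: pad_one_index)
    then show ?thesis using False ij by simp
  qed
  finally show ?thesis .
qed

lemma pad_one_mult:
  assumes g: "g \<in> carrier_mat m m" "h \<in> carrier_mat m m" "m \<le> n"
  shows "pad_one n g * pad_one n h = pad_one n (g * h)"
proof (rule eq_matI, goal_cases)
  case (1 i j)
  have gh: "g * h \<in> carrier_mat m m" using g by simp
  have ij: "i < n" "j < n" using 1 g gh by (auto simp: pad_one_def)
  have "(\<Sum>l<m. g $$ (i, l) * pad_one n h $$ (l, j)) = (if j < m then (g * h) $$ (i, j) else 0)" if "i < m"
    using g ij that by (auto simp: pad_one_index[OF g(2,3)] scalar_prod_def atLeast0LessThan intro!: sum.cong sum.neutral)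
  then show ?case
    using g ij by (auto simp: pad_one_left_index[OF g(1,3) pad_one_closed[OF g(2,3)]] pad_one_index[OF g(2,3)] pad_one_index[OF gh g(3)])
qed (use g in \<open>auto simp: pad_one_def\<close>)

lemma upper_left_closed [simp]: "upper_left m B \<in> carrier_mat m m"
  by (simp add: upper_left_def)

lemma pad_one_exp_closed [simp]:
  "m \<le> n \<Longrightarrow> pad_one n (exp_poly (upper_left m B) q) \<in> carrier_mat n n"
  by (rule pad_one_closed[of _ m]) simp_all

lemma upper_left_self: "B \<in> carrier_mat n n \<Longrightarrow> upper_left n B = B"
  by (rule eq_matI) (auto simp: upper_left_def)

lemma upper_left_upper_left: "k \<le> m \<Longrightarrow> upper_left k (upper_left m B) = upper_left k B"
  by (rule eq_matI) (auto simp: upper_left_def)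

definition border_col :: "nat \<Rightarrow> complex mat \<Rightarrow> complex mat" where
  "border_col m B = mat m 1 (\<lambda>(i, _). B $$ (i, m))"

definition border_row :: "nat \<Rightarrow> complex mat \<Rightarrow> complex mat" where
  "border_row m B = mat 1 m (\<lambda>(_, j). B $$ (m, j))"

lemma border_closed [simp]: "border_col m B \<in> carrier_mat m 1" "border_row m B \<in> carrier_mat 1 m"
  by (simp_all add: border_col_def border_row_def)

lemma border_dim [simp]:
  "dim_row (border_col m B) = m" "dim_col (border_col m B) = 1"
  "dim_row (border_row m B) = 1" "dim_col (border_row m B) = m"
  by (simp_all add: border_col_def border_row_def)

lemma upper_left_Suc:
  "upper_left (Suc m) B = bordered (upper_left m B) (border_col m B) (border_row m B) (B $$ (m, m))"
  by (rule eq_matI) (auto simp: upper_left_def bordered_def border_col_def border_row_def less_Suc_eq One_nat_def)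

lemma conj_pad_one_index:
  assumes g: "g \<in> carrier_mat m m" and h: "h \<in> carrier_mat m m" and "m \<le> k" "k \<le> n"
    and B: "B \<in> carrier_mat n n" and ij: "i < k" "j < k"
  shows "(pad_one n g * B * pad_one n h) $$ (i, j) = (pad_one k g * upper_left k B * pad_one k h) $$ (i, j)"
proof -
  have mn: "m \<le> n" using assms by simp
  have c1: "pad_one n g * B \<in> carrier_mat n n" using g B mn by (intro mult_carrier_mat[of _ n n]) auto
  have c2: "pad_one k g * upper_left k B \<in> carrier_mat k k" using g \<open>m \<le> k\<close> by (intro mult_carrier_mat[of _ k k]) auto
  have eq: "(pad_one n g * B) $$ (i, j) = (pad_one k g * upper_left k B) $$ (i, j)" if "i < k" "j < k" for i j
    using that assms(3,4) by (simp add: pad_one_left_index[OF g mn B] pad_one_left_index[OF g \<open>m \<le> k\<close> upper_left_closed])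
      (simp add: upper_left_def)
  show ?thesis
    using ij assms(3,4) by (simp add: pad_one_right_index[OF h mn c1] pad_one_right_index[OF h \<open>m \<le> k\<close> c2] eq)
qed

text \<open>Beyond the first m coordinates the padded factors are the identity, so a block of size k
  \<ge> m is conjugated within itself.\<close>

lemma upper_left_conj_pad_one:
  assumes g: "g \<in> carrier_mat m m" and h: "h \<in> carrier_mat m m" and "m \<le> k" "k \<le> n"
    and B: "B \<in> carrier_mat n n"
  shows "upper_left k (pad_one n g * B * pad_one n h) = pad_one k g * upper_left k B * pad_one k h"
proof (rule eq_matI, goal_cases)
  case (1 i j)
  have "pad_one k h \<in> carrier_mat k k" "pad_one k g \<in> carrier_mat k k" using assms by simp_all
  then have ij: "i < k" "j < k" using 1 by auto
  show ?case using conj_pad_one_index[OF assms ij] ij by (simp add: upper_left_def)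
qed (use assms in \<open>auto simp: upper_left_def pad_one_def\<close>)

text \<open>With index k outside the range of g and h, the column meets only the left factor, the
  row only the right one, and the corner neither.\<close>

lemma border_conj_pad_one:
  assumes g: "g \<in> carrier_mat m m" and h: "h \<in> carrier_mat m m" and "m \<le> k" "k < n"
    and B: "B \<in> carrier_mat n n"
  shows "border_col k (pad_one n g * B * pad_one n h) = pad_one k g * border_col k B" (is ?C)
    and "border_row k (pad_one n g * B * pad_one n h) = border_row k B * pad_one k h" (is ?R)
    and "(pad_one n g * B * pad_one n h) $$ (k, k) = B $$ (k, k)" (is ?D)
proof -
  have mn: "m \<le> n" using assms by simp
  have Pg: "pad_one k g \<in> carrier_mat k k" and Ph: "pad_one k h \<in> carrier_mat k k" using assms by simp_all
  have c1: "pad_one n g * B \<in> carrier_mat n n" using g B mn by (intro mult_carrier_mat[of _ n n]) auto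
  note ix = pad_one_right_index[OF h mn c1] pad_one_left_index[OF g mn B]
    pad_one_left_index[OF g \<open>m \<le> k\<close> border_closed(1)] pad_one_right_index[OF h \<open>m \<le> k\<close> border_closed(2)]
  show ?C
  proof (rule eq_matI, goal_cases)
    case (1 i j)
    then have "i < k" "j = 0" using Pg by auto
    then show ?case using assms(3,4)
      by (subst border_col_def) (simp add: ix del: index_mult_mat, simp add: border_col_def)
  qed (use Pg in \<open>auto simp: border_col_def\<close>)
  show ?R
  proof (rule eq_matI, goal_cases)
    case (1 i j)
    then have "i = 0" "j < k" using Ph by auto
    then show ?case using assms(3,4)
      by (subst border_row_def) (simp add: ix del: index_mult_mat, simp add: border_row_def)
  qed (use Ph in \<open>auto simp: border_row_def\<close>)
  show ?D using assms(3,4) by (simp add: ix del: index_mult_mat)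
qed

text \<open>All flows of level m at once: the polynomial q collects the times of the m commuting
  one-parameter flows.\<close>

definition flow :: "nat \<Rightarrow> nat \<Rightarrow> complex poly \<Rightarrow> complex mat \<Rightarrow> complex mat" where
  "flow n m q B = pad_one n (exp_poly (upper_left m B) q) * B * pad_one n (exp_poly (upper_left m B) (- q))"

lemma flow_closed [simp]:
  assumes "B \<in> carrier_mat n n" "m \<le> n"
  shows "flow n m q B \<in> carrier_mat n n"
  unfolding flow_def using assms by (intro mult_carrier_mat[of _ n n]) auto

lemma exp_poly_conj:
  assumes "A \<in> carrier_mat m m"
  shows "exp_poly A q * A * exp_poly A (- q) = A"
proof -
  have x: "poly_mat A [:0, 1:] = A" using assms unfolding poly_mat_linear[OF assms] by auto
  have "exp_poly A q * A = A * exp_poly A q" using exp_poly_commute[OF assms, of "[:0,1:]" q] by (simp add: x)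
  then show ?thesis using assms exp_poly_minus(1)[OF assms, of q]
    by (simp add: assoc_mult_mat[of _ m m _ m _ m])
qed

text \<open>exp(q(B_m)) commutes with B_m. Hence the generator of a flow is constant along that
  flow, from which \<open>flow_add\<close> follows.\<close>

lemma upper_left_flow:
  assumes B: "B \<in> carrier_mat n n" and "m \<le> n" "k \<le> m"
  shows "upper_left k (flow n m q B) = upper_left k B"
proof -
  have "upper_left m (flow n m q B) = upper_left m B"
    unfolding flow_def
    by (subst upper_left_conj_pad_one[of _ m]) (use assms in \<open>auto simp: pad_one_self[of _ m] exp_poly_conj[of _ m]\<close>)
  with \<open>k \<le> m\<close> show ?thesis by (metis upper_left_upper_left)
qed

lemma pad_one_exp_inverse:
  assumes "A \<in> carrier_mat m m" "m \<le> n"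
  shows "pad_one n (exp_poly A q) * pad_one n (exp_poly A (- q)) = 1\<^sub>m n"
    "pad_one n (exp_poly A (- q)) * pad_one n (exp_poly A q) = 1\<^sub>m n"
  using assms by (simp_all add: pad_one_mult[of _ m] exp_poly_minus[of _ m] pad_one_one)

lemma flow_add:
  assumes B: "B \<in> carrier_mat n n" and m: "m \<le> n"
  shows "flow n m p (flow n m q B) = flow n m (p + q) B"
proof -
  let ?A = "upper_left m B"
  let ?G = "\<lambda>p. pad_one n (exp_poly ?A p)"
  have G: "?G p \<in> carrier_mat n n" for p using m by simp
  have GG: "?G p * ?G q = ?G (p + q)" for p q using m by (simp add: pad_one_mult[of _ m] exp_poly_add[of _ m])
  have "flow n m p (flow n m q B) = ?G p * (?G q * B * ?G (- q)) * ?G (- p)"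
    unfolding flow_def[of n m p] upper_left_flow[OF B m order_refl] by (simp add: flow_def)
  also have "\<dots> = (?G p * ?G q) * B * (?G (- q) * ?G (- p))"
    using G B by (simp add: assoc_mult_mat[of _ n n _ n _ n] mult_carrier_mat[of _ n n _ n])
  finally show ?thesis unfolding GG flow_def by (simp add: add.commute)
qed

lemma flow_0: "B \<in> carrier_mat n n \<Longrightarrow> m \<le> n \<Longrightarrow> flow n m 0 B = B"
  by (simp add: flow_def exp_poly_0[of _ m] pad_one_one)

text \<open>The flow of level k leaves B_m alone. The flow of level m conjugates B_k by g, hence
  also its exponential, and the extra factors g cancel.\<close>

lemma flow_commute:
  assumes B: "B \<in> carrier_mat n n" and mk: "m \<le> k" "k \<le> n"
  shows "flow n m p (flow n k q B) = flow n k q (flow n m p B)"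
proof -
  have mn: "m \<le> n" using mk by simp
  let ?A = "upper_left m B"
  let ?C = "upper_left k B"
  define G G' where "G = pad_one n (exp_poly ?A p)" and "G' = pad_one n (exp_poly ?A (- p))"
  define H where "H q = pad_one n (exp_poly ?C q)" for q
  have c: "G \<in> carrier_mat n n" "G' \<in> carrier_mat n n" "H q \<in> carrier_mat n n" for q
    using mk mn by (simp_all add: G_def G'_def H_def)
  have GG: "G * G' = 1\<^sub>m n" "G' * G = 1\<^sub>m n"
    using pad_one_exp_inverse[of ?A m n p] mn by (simp_all add: G_def G'_def)
  define g g' where "g = pad_one k (exp_poly ?A p)" and "g' = pad_one k (exp_poly ?A (- p))"
  have gc: "g \<in> carrier_mat k k" "g' \<in> carrier_mat k k" using mk by (simp_all add: g_def g'_def)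
  have gg: "g * g' = 1\<^sub>m k" "g' * g = 1\<^sub>m k"
    using pad_one_exp_inverse[of ?A m k p] mk by (simp_all add: g_def g'_def)
  define C' where "C' = g * ?C * g'"
  have C': "C' \<in> carrier_mat k k" using gc by (simp add: C'_def mult_carrier_mat[of _ k k _ k])
  have UL: "upper_left k (flow n m p B) = C'"
    unfolding flow_def C'_def g_def g'_def using mk B by (intro upper_left_conj_pad_one[of _ m]) auto
  have e: "exp_poly C' q = g * exp_poly ?C q * g'" for q
  proof -
    have "g * ?C = C' * g"
      using gc gg by (simp add: C'_def assoc_mult_mat[of _ k k _ k _ k] mult_carrier_mat[of _ k k _ k] right_mult_one_mat[of _ k])
    then have "g * exp_poly ?C q = exp_poly C' q * g"
      using exp_poly_intertwine[of ?C k C' k g q] C' gc by simp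
    then have "g * exp_poly ?C q * g' = exp_poly C' q * (g * g')"
      using gc C' by (simp add: assoc_mult_mat[of _ k k _ k _ k])
    then show ?thesis using gg C' by (simp add: right_mult_one_mat[of _ k])
  qed
  have padG: "pad_one n g = G" "pad_one n g' = G'"
    using mk by (simp_all add: g_def g'_def G_def G'_def pad_one_pad_one[of _ m])
  have He: "pad_one n (exp_poly C' q) = G * H q * G'" for q
    unfolding e padG[symmetric] H_def using gc mk by (simp add: pad_one_mult[of _ k] mult_carrier_mat[of _ k k _ k])
  have "flow n k q (flow n m p B) = G * H q * G' * (G * B * G') * (G * H (- q) * G')"
    unfolding flow_def[of n k q] UL He by (simp add: flow_def G_def G'_def)
  also have "\<dots> = G * H q * (G' * G) * B * (G' * G) * H (- q) * G'"
    using c B by (simp add: assoc_mult_mat[of _ n n _ n _ n] mult_carrier_mat[of _ n n _ n])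
  also have "\<dots> = G * (H q * B * H (- q)) * G'"
    unfolding GG using c B by (simp add: assoc_mult_mat[of _ n n _ n _ n] mult_carrier_mat[of _ n n _ n] right_mult_one_mat[of _ n])
  also have "\<dots> = flow n m p (flow n k q B)"
    unfolding flow_def[of n m p] upper_left_flow[OF B mk(2,1)] by (simp add: flow_def G_def G'_def H_def)
  finally show ?thesis ..
qed

lemma mat_inverse_eqI:
  fixes g :: "complex mat"
  assumes "g \<in> carrier_mat n n" "h \<in> carrier_mat n n" "g * h = 1\<^sub>m n" "h * g = 1\<^sub>m n"
  shows "mat_inverse g = Some h"
proof (cases "mat_inverse g")
  case None
  then have "g \<notin> Units (ring_mat TYPE(complex) n ())" by (rule mat_inverse(1)[OF assms(1)])
  moreover have "g \<in> Units (ring_mat TYPE(complex) n ())"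
    using assms by (auto simp: Units_def ring_mat_def)
  ultimately show ?thesis by blast
next
  case (Some k)
  then have k: "k * g = 1\<^sub>m n" "k \<in> carrier_mat n n" using mat_inverse(2)[OF assms(1)] by blast+
  have "k = k * (g * h)" using assms k by (simp add: right_mult_one_mat[of _ n])
  also have "\<dots> = k * g * h" by (rule assoc_mult_mat[symmetric, of _ n n _ n _ n]) (use assms k in auto)
  also have "\<dots> = h" using assms k by (simp add: left_mult_one_mat[of _ n])
  finally show ?thesis using Some by simp
qed

text \<open>Extension by zeros is applied to the power A^(i-1), so i = 1 gives the m x m identity
  extended by zeros, which is the constant polynomial at level m.\<close>

lemma gz_flow_eq_flow:
  assumes B: "B \<in> carrier_mat n n" and m: "m \<le> n"
  shows "gz_flow n m i z B = flow n m (monom z (i - 1)) B"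
proof -
  let ?A = "upper_left m B"
  let ?q = "monom z (i - 1)"
  have A: "?A \<in> carrier_mat m m" by simp
  have p: "?A ^\<^sub>m (i - 1) \<in> carrier_mat m m" by simp
  have "z \<cdot>\<^sub>m extend_by_zeros n (?A ^\<^sub>m (i - 1)) = extend_by_zeros n (poly_mat ?A ?q)"
    unfolding poly_mat_monom[OF A] using p m
    by (intro eq_matI) (auto simp: extend_by_zeros_def Let_def carrier_matD[OF p] simp del: pow_mat_dim pow_mat_dim_square)
  then have e: "mat_exp (z \<cdot>\<^sub>m extend_by_zeros n (?A ^\<^sub>m (i - 1))) = pad_one n (exp_poly ?A ?q)"
    using mat_exp_extend_by_zeros[OF poly_mat_closed[OF A] m] by (simp add: exp_poly_def)
  have "mat_inverse (pad_one n (exp_poly ?A ?q)) = Some (pad_one n (exp_poly ?A (- ?q)))"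
    using m pad_one_exp_inverse[OF A m] by (intro mat_inverse_eqI[of _ n]) auto
  then show ?thesis by (simp add: gz_flow_def Ad_def e flow_def)
qed

section \<open>The action of the whole group, organised by levels\<close>

definition act :: "nat \<Rightarrow> (nat \<Rightarrow> complex poly) \<Rightarrow> nat \<Rightarrow> complex mat \<Rightarrow> complex mat" where
  "act n Q k B = foldr (\<lambda>m. flow n m (Q m)) [1..<k] B"

lemma foldr_flow_closed:
  "B \<in> carrier_mat n n \<Longrightarrow> \<forall>m\<in>set ms. m \<le> n \<Longrightarrow> foldr (\<lambda>m. flow n m (Q m)) ms B \<in> carrier_mat n n"
  by (induction ms) auto

lemma act_closed [simp]: "B \<in> carrier_mat n n \<Longrightarrow> k \<le> n \<Longrightarrow> act n Q k B \<in> carrier_mat n n"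
  unfolding act_def by (rule foldr_flow_closed) auto

lemma act_1 [simp]: "act n Q 1 B = B" "act n Q (Suc 0) B = B" "act n Q 0 B = B"
  by (simp_all add: act_def)

text \<open>The fold applies the highest level first; commutation moves it to the outside, which
  permits induction from small blocks to large ones.\<close>

lemma act_Suc:
  assumes B: "B \<in> carrier_mat n n" and k: "1 \<le> k" "k \<le> n"
  shows "act n Q (Suc k) B = flow n k (Q k) (act n Q k B)"
proof -
  have "foldr (\<lambda>m. flow n m (Q m)) ms (flow n k (Q k) B) = flow n k (Q k) (foldr (\<lambda>m. flow n m (Q m)) ms B)"
    if "\<forall>m\<in>set ms. m \<le> k" for ms
    using that
  proof (induction ms)
    case (Cons a ms)
    then have "foldr (\<lambda>m. flow n m (Q m)) ms B \<in> carrier_mat n n" using k by (intro foldr_flow_closed[OF B]) auto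
    from flow_commute[OF this, of a k] Cons k show ?case by simp
  qed simp
  then show ?thesis using k by (simp add: act_def)
qed

text \<open>Encodes the m coordinates of level m as a polynomial of degree below m; the coordinate
  (m, i) is the coefficient of x^(i-1).\<close>

definition row_poly :: "(nat \<times> nat \<Rightarrow> complex) \<Rightarrow> nat \<Rightarrow> complex poly" where
  "row_poly z m = (\<Sum>i\<leftarrow>[1..<Suc m]. monom (z (m, i)) (i - 1))"

lemma gz_action_eq_act:
  assumes B: "B \<in> carrier_mat n n"
  shows "gz_action n z B = act n (row_poly z) n B"
proof -
  let ?f = "\<lambda>(m, i). gz_flow n m i (z (m, i))"
  have inner: "foldr ?f (map (Pair m) is) C = flow n m (\<Sum>i\<leftarrow>is. monom (z (m, i)) (i - 1)) C"
    if "C \<in> carrier_mat n n" "m \<le> n" for C m "is"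
    by (induction "is") (use that in \<open>auto simp: flow_0 gz_flow_eq_flow flow_add\<close>)
  have "foldr ?f (concat (map (\<lambda>m. map (Pair m) [1..<Suc m]) ms)) B = foldr (\<lambda>m. flow n m (row_poly z m)) ms B"
    if "\<forall>m\<in>set ms. m \<le> n" for ms
    using that
  proof (induction ms)
    case (Cons a ms)
    then have "foldr (\<lambda>m. flow n m (row_poly z m)) ms B \<in> carrier_mat n n" by (intro foldr_flow_closed[OF B]) auto
    from inner[OF this, of a] Cons show ?case by (simp add: row_poly_def)
  qed simp
  from this[of "[1..<n]"] show ?thesis using B by (simp add: gz_action_def act_def)
qed

lemma coeff_row_poly: "coeff (row_poly z m) j = (if j < m then z (m, Suc j) else 0)"
proof -
  have "row_poly z m = (\<Sum>i\<in>{1..<Suc m}. monom (z (m, i)) (i - 1))"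
    unfolding row_poly_def interv_sum_list_conv_sum_set_nat by (simp only: set_upt)
  also have "\<dots> = (\<Sum>i<m. monom (z (m, Suc i)) i)"
    by (rule sum.reindex_bij_witness[of _ Suc "\<lambda>i. i - 1"]) auto
  finally show ?thesis by (simp add: coeff_sum)
qed

lemma degree_row_poly: "0 < m \<Longrightarrow> degree (row_poly z m) < m"
  by (intro degree_lessI) (auto simp: coeff_row_poly)

lemma row_poly_exists:
  assumes "\<And>m. 1 \<le> m \<Longrightarrow> m < n \<Longrightarrow> degree (Q m) < m"
  shows "\<exists>z\<in>carrier (gz_group n). \<forall>m\<in>{1..<n}. row_poly z m = Q m"
proof
  define z where "z = (\<lambda>(m, i). if (m, i) \<in> gz_indices n then coeff (Q m) (i - 1) else 0)"
  show "z \<in> carrier (gz_group n)" by (auto simp: gz_group_def z_def)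
  show "\<forall>m\<in>{1..<n}. row_poly z m = Q m"
  proof
    fix m assume m: "m \<in> {1..<n}"
    show "row_poly z m = Q m"
    proof (rule poly_eqI)
      fix j
      show "coeff (row_poly z m) j = coeff (Q m) j"
        using m assms[of m] by (auto simp: coeff_row_poly z_def gz_indices_def coeff_eq_0)
    qed
  qed
qed

lemma act_cong:
  assumes "\<And>m. 1 \<le> m \<Longrightarrow> m < k \<Longrightarrow> Q m = Q' m"
  shows "act n Q k B = act n Q' k B"
  unfolding act_def by (rule foldr_cong) (use assms in auto)

section \<open>Invariance and transitivity\<close>

lemma mat_cancel_left:
  fixes X Y M :: "complex mat"
  assumes "X \<in> carrier_mat k k" "Y \<in> carrier_mat k k" "Y * X = 1\<^sub>m k" "M \<in> carrier_mat k j"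
  shows "X * M = 0\<^sub>m k j \<longleftrightarrow> M = 0\<^sub>m k j"
proof
  assume 0: "X * M = 0\<^sub>m k j"
  have "M = Y * X * M" using assms by simp
  also have "\<dots> = Y * (X * M)" by (rule assoc_mult_mat[of _ k k _ k _ j]) (use assms in auto)
  finally show "M = 0\<^sub>m k j" using assms 0 by (simp add: right_mult_zero_mat[of _ k k])
qed (use assms in \<open>simp add: right_mult_zero_mat[of _ k k]\<close>)

lemma mat_cancel_right:
  fixes X Y M :: "complex mat"
  assumes "X \<in> carrier_mat k k" "Y \<in> carrier_mat k k" "Y * X = 1\<^sub>m k" "M \<in> carrier_mat j k"
  shows "M * Y = 0\<^sub>m j k \<longleftrightarrow> M = 0\<^sub>m j k"
proof
  assume 0: "M * Y = 0\<^sub>m j k"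
  have "M = M * (Y * X)" using assms by simp
  also have "\<dots> = M * Y * X" by (rule assoc_mult_mat[symmetric, of _ j k _ k _ k]) (use assms in auto)
  finally show "M = 0\<^sub>m j k" using assms 0 by (simp add: left_mult_zero_mat[of _ k k])
qed (use assms in \<open>simp add: left_mult_zero_mat[of _ k k]\<close>)

section \<open>Invariance of strong regularity and excitation under conjugation\<close>

context
  fixes k :: nat and A b c X Y :: "complex mat"
  assumes A: "A \<in> carrier_mat k k" and b: "b \<in> carrier_mat k 1" and c: "c \<in> carrier_mat 1 k"
    and X: "X \<in> carrier_mat k k" and Y: "Y \<in> carrier_mat k k" and XY: "X * Y = 1\<^sub>m k" "Y * X = 1\<^sub>m k"
begin

lemma conj_closed: "X * A * Y \<in> carrier_mat k k"
  using A X Y by (intro mult_carrier_mat[of _ k k]) auto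

lemma poly_mat_conj: "poly_mat (X * A * Y) p = X * poly_mat A p * Y"
proof -
  have "X * A = X * A * Y * X"
    using A X Y XY by (simp add: assoc_mult_mat[of _ k k _ k _ k] mult_carrier_mat[of _ k k _ k] right_mult_one_mat[of _ k])
  then have "X * poly_mat A p = poly_mat (X * A * Y) p * X"
    using poly_mat_intertwine[OF A conj_closed X] by simp
  then have "X * poly_mat A p * Y = poly_mat (X * A * Y) p * (X * Y)"
    using X Y conj_closed by (simp add: assoc_mult_mat[of _ k k _ k _ k])
  then show ?thesis using XY conj_closed by (simp add: right_mult_one_mat[of _ k])
qed

lemma char_poly_conj: "char_poly (X * A * Y) = char_poly A"
proof (rule char_poly_similar)
  have "similar_mat_wit (X * A * Y) A X Y"
    using A X Y XY conj_closed by (simp add: similar_mat_wit_def Let_def carrier_matD[OF X])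
  then show "similar_mat (X * A * Y) A" unfolding similar_mat_def by blast
qed

lemma conj_vec_eq_0_iff: "poly_mat (X * A * Y) p * (X * b) = 0\<^sub>m k 1 \<longleftrightarrow> poly_mat A p * b = 0\<^sub>m k 1"
proof -
  have "poly_mat (X * A * Y) p * (X * b) = X * (poly_mat A p * ((Y * X) * b))"
    unfolding poly_mat_conj using A b X Y
    by (simp add: assoc_mult_mat[of _ k k _ k _ k] assoc_mult_mat[of _ k k _ k _ 1] mult_carrier_mat[of _ k k _ k] mult_carrier_mat[of _ k k _ 1])
  then show ?thesis using mat_cancel_left[OF X Y XY(2), of "poly_mat A p * b" 1] A b XY by (simp add: mult_carrier_mat[of _ k k _ 1])
qed

lemma conj_covec_eq_0_iff: "c * Y * poly_mat (X * A * Y) p = 0\<^sub>m 1 k \<longleftrightarrow> c * poly_mat A p = 0\<^sub>m 1 k"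
proof -
  have "c * Y * poly_mat (X * A * Y) p = (c * (Y * X)) * poly_mat A p * Y"
    unfolding poly_mat_conj using A c X Y
    by (simp add: assoc_mult_mat[of _ k k _ k _ k] assoc_mult_mat[of _ 1 k _ k _ k] mult_carrier_mat[of _ k k _ k] mult_carrier_mat[of _ 1 k _ k])
  then show ?thesis using mat_cancel_right[OF X Y XY(2), of "c * poly_mat A p" 1] A c XY
    by (simp add: mult_carrier_mat[of _ 1 k _ k] right_mult_one_mat[of _ 1])
qed

lemma sreg_at_conj: "sreg_at (X * A * Y) (X * b) (c * Y) \<longleftrightarrow> sreg_at A b c"
  using conj_vec_eq_0_iff conj_covec_eq_0_iff carrier_matD[OF A] carrier_matD[OF X] by (simp add: sreg_at_def)

lemma excites_conj: "excites (X * A * Y) (X * b) w \<longleftrightarrow> excites A b w"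
  using conj_vec_eq_0_iff carrier_matD[OF A] carrier_matD[OF X] by (simp add: excites_def char_poly_conj)

end

abbreviation sreg_level :: "complex mat \<Rightarrow> nat \<Rightarrow> bool" where
  "sreg_level B k \<equiv> sreg_at (upper_left k B) (border_col k B) (border_row k B)"

abbreviation excites_level :: "complex mat \<Rightarrow> nat \<Rightarrow> complex \<Rightarrow> bool" where
  "excites_level B k w \<equiv> excites (upper_left k B) (border_col k B) w"

definition sreg :: "nat \<Rightarrow> complex mat \<Rightarrow> bool" where
  "sreg n B \<longleftrightarrow> (\<forall>k. 1 \<le> k \<longrightarrow> k < n \<longrightarrow> sreg_level B k)"

definition same_levels :: "nat \<Rightarrow> complex mat \<Rightarrow> complex mat \<Rightarrow> bool" where
  "same_levels n B B' \<longleftrightarrow> (\<forall>k\<le>n. char_poly (upper_left k B') = char_poly (upper_left k B))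
     \<and> (\<forall>k<n. sreg_level B' k = sreg_level B k \<and> (\<forall>w. excites_level B' k w = excites_level B k w))"

lemma border_cong:
  assumes "upper_left (Suc k) B = upper_left (Suc k) B'"
  shows "upper_left k B = upper_left k B'" "border_col k B = border_col k B'" "border_row k B = border_row k B'"
    "B $$ (k, k) = B' $$ (k, k)"
proof -
  have ix: "B $$ (i, j) = B' $$ (i, j)" if "i < Suc k" "j < Suc k" for i j
    using arg_cong[OF assms, of "\<lambda>M. M $$ (i, j)"] that by (simp add: upper_left_def)
  show "upper_left k B = upper_left k B'" "border_col k B = border_col k B'" "border_row k B = border_row k B'"
    "B $$ (k, k) = B' $$ (k, k)"
    by (auto simp: upper_left_def border_col_def border_row_def ix intro!: eq_matI)
qed

text \<open>Levels below m lie inside the fixed block B_m. At a level k \<ge> m the triple (B_k, b,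
  c) becomes (X B_k Y, X b, c Y) with Y inverse to X.\<close>

lemma same_levels_flow:
  assumes B: "B \<in> carrier_mat n n" and m: "m \<le> n"
  shows "same_levels n B (flow n m q B)"
proof -
  let ?E = "exp_poly (upper_left m B) q" and ?E' = "exp_poly (upper_left m B) (- q)"
  have E: "?E \<in> carrier_mat m m" "?E' \<in> carrier_mat m m" by simp_all
  have P: "pad_one k ?E \<in> carrier_mat k k" "pad_one k ?E' \<in> carrier_mat k k"
    "pad_one k ?E * pad_one k ?E' = 1\<^sub>m k" "pad_one k ?E' * pad_one k ?E = 1\<^sub>m k" if "m \<le> k" for k
    using that pad_one_exp_inverse[of "upper_left m B" m k q] by simp_all
  have "char_poly (upper_left k (flow n m q B)) = char_poly (upper_left k B)" if "k \<le> n" for k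
  proof (cases "k \<le> m")
    case True
    then show ?thesis using upper_left_flow[OF B m] by simp
  next
    case False
    then show ?thesis using that unfolding flow_def
      by (subst upper_left_conj_pad_one[OF E _ _ B]) (auto simp: char_poly_conj[OF upper_left_closed border_closed P])
  qed
  moreover have "sreg_level (flow n m q B) k = sreg_level B k \<and>
     (\<forall>w. excites_level (flow n m q B) k w = excites_level B k w)" if "k < n" for k
  proof (cases "k < m")
    case True
    then have "upper_left (Suc k) (flow n m q B) = upper_left (Suc k) B" using upper_left_flow[OF B m] by simp
    from border_cong[OF this] show ?thesis by simp
  next
    case False
    then have mk: "m \<le> k" by simp
    show ?thesis
      unfolding flow_def upper_left_conj_pad_one[OF E mk less_imp_le[OF that] B] border_conj_pad_one[OF E mk that B]
      using sreg_at_conj[OF upper_left_closed border_closed P[OF mk]] excites_conj[OF upper_left_closed border_closed P[OF mk]]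
      by blast
  qed
  ultimately show ?thesis by (simp add: same_levels_def)
qed

lemma same_levels_trans: "same_levels n B C \<Longrightarrow> same_levels n C D \<Longrightarrow> same_levels n B D"
  by (auto simp: same_levels_def)

lemma same_levels_act:
  assumes B: "B \<in> carrier_mat n n" and "k \<le> n"
  shows "same_levels n B (act n Q k B)"
  using \<open>k \<le> n\<close>
proof (induction k)
  case 0
  then show ?case by (simp add: same_levels_def)
next
  case (Suc k)
  show ?case
  proof (cases "k = 0")
    case True
    then show ?thesis by (simp add: same_levels_def)
  next
    case False
    then show ?thesis using Suc B same_levels_trans[OF Suc.IH same_levels_flow[of "act n Q k B" n k "Q k"]]
      by (simp add: act_Suc)
  qed
qed

lemma upper_left_act:
  assumes B: "B \<in> carrier_mat n n" and "j \<le> k" "k \<le> k'" "k' \<le> n"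
  shows "upper_left j (act n Q k' B) = upper_left j (act n Q k B)"
  using \<open>k \<le> k'\<close> \<open>k' \<le> n\<close>
proof (induction k' rule: dec_induct)
  case (step i)
  show ?case
  proof (cases "i = 0")
    case False
    then show ?thesis using step B assms(2) by (simp add: act_Suc upper_left_flow)
  qed (use step in simp)
qed simp

lemma nonderogatory_1:
  assumes "A \<in> carrier_mat 1 1"
  shows "nonderogatory A"
  unfolding nonderogatory_def
proof (intro allI impI)
  fix p assume p: "degree p < dim_row A" "poly_mat A p = 0\<^sub>m (dim_row A) (dim_row A)"
  then obtain a where "p = [:a:]" using assms by (metis carrier_matD(1) degree_eq_zeroE less_one)
  moreover from this have "(a \<cdot>\<^sub>m 1\<^sub>m 1) $$ (0, 0) = (0\<^sub>m 1 1 :: complex mat) $$ (0, 0)"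
    using p(2) assms by (simp add: poly_mat_const)
  ultimately show "p = 0" by simp
qed

text \<open>Regularity at level k - 1 makes B_k nonderogatory, so B_n is covered although no
  condition is imposed at level n.\<close>

lemma nonderogatory_upper_left:
  assumes "sreg n B" "1 \<le> k" "k \<le> n"
  shows "nonderogatory (upper_left k B)"
  using assms(2,3)
proof (induction k rule: dec_induct)
  case base
  show ?case by (rule nonderogatory_1) simp
next
  case (step k)
  then show ?case unfolding upper_left_Suc
    using assms(1) by (intro nonderogatory_bordered[of _ k]) (auto simp: sreg_def)
qed

text \<open>At a root w of \<open>cp\<close> the next characteristic polynomial equals
  -\<beta>(w)\<gamma>(w). Only common roots leave a choice.\<close>

lemma excites_if_not_root:
  assumes A: "A \<in> carrier_mat m m" and nd: "nonderogatory A" and "m > 0"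
    and b: "b \<in> carrier_mat m 1" and c: "c \<in> carrier_mat 1 m"
    and w: "poly (char_poly A) w = 0" "poly (char_poly (bordered A b c d)) w \<noteq> 0"
  shows "excites A b w"
proof -
  obtain v l where "cyclic_pair A m v l" using cyclic_pair_exists[OF A nd \<open>m > 0\<close>] .
  then interpret cyclic_pair A m v l .
  obtain \<beta> \<gamma> where coords: "b = poly_mat A \<beta> * v" "c = l * poly_mat A \<gamma>"
    using vector_poly_exists[OF b] covector_poly_exists[OF c] by blast
  have "poly ((\<beta> * \<gamma>) mod cp) w \<noteq> 0" using w by (simp add: coords char_poly_bordered)
  moreover have "poly (\<beta> * \<gamma>) w = poly ((\<beta> * \<gamma>) mod cp) w"
    using w(1) by (metis add.left_neutral mult_zero_right poly_add poly_mult mult_div_mod_eq mult_zero_left)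
  ultimately have "poly \<beta> w \<noteq> 0" by auto
  then show ?thesis unfolding coords excites_iff[OF w(1)] .
qed

text \<open>Logarithms may be reduced to degree below m, the range that the group provides at level
  m.\<close>

lemma exp_poly_mod:
  assumes A: "A \<in> carrier_mat m m"
  shows "exp_poly A (q mod char_poly A) = exp_poly A q"
proof -
  have "q = q div char_poly A * char_poly A + q mod char_poly A" by simp
  then have "poly_mat A q = poly_mat A (q div char_poly A) * poly_mat A (char_poly A) + poly_mat A (q mod char_poly A)"
    by (metis poly_mat_add[OF A] poly_mat_mult[OF A])
  then show ?thesis using A
    by (simp add: exp_poly_def cayley_hamilton right_mult_zero_mat[of _ m m] left_add_zero_mat[of _ m m])
qed

text \<open>Blocks are matched in order of size. The flow of level k fixes B_k and moves only the
  border of B_(k+1) within that block, so each step keeps what the previous ones achieved.\<close>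

lemma act_transitive:
  assumes B: "B \<in> carrier_mat n n" and B': "B' \<in> carrier_mat n n"
    and sreg: "sreg n B" "sreg n B'"
    and char: "\<And>k. 1 \<le> k \<Longrightarrow> k \<le> n \<Longrightarrow> char_poly (upper_left k B) = char_poly (upper_left k B')"
    and ex: "\<And>k w. 1 \<le> k \<Longrightarrow> k < n \<Longrightarrow> poly (char_poly (upper_left k B)) w = 0 \<Longrightarrow>
        poly (char_poly (upper_left (Suc k) B)) w = 0 \<Longrightarrow> excites_level B k w = excites_level B' k w"
    and n: "1 \<le> n"
  shows "\<exists>Q. (\<forall>m. 1 \<le> m \<longrightarrow> m < n \<longrightarrow> degree (Q m) < m) \<and> act n Q n B = B'"
proof -
  have "\<exists>Q. (\<forall>m. 1 \<le> m \<longrightarrow> m < k \<longrightarrow> degree (Q m) < m) \<and> upper_left k (act n Q k B) = upper_left k B'"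
    if "1 \<le> k" "k \<le> n" for k
    using that
  proof (induction k rule: dec_induct)
    case base
    have lin: "char_poly M = [:- M $$ (0, 0), 1:]" if "M \<in> carrier_mat 1 1" for M :: "complex mat"
      using that unfolding char_poly_def by (subst det_single) (auto simp: char_poly_matrix_def)
    have "upper_left 1 B $$ (0, 0) = upper_left 1 B' $$ (0, 0)"
      using char[OF order_refl n] by (simp add: lin)
    then have "upper_left 1 B = upper_left 1 B'" by (intro eq_matI) (auto simp: upper_left_def One_nat_def)
    then show ?case by (intro exI[of _ "\<lambda>_. 0"]) simp
  next
    case (step k)
    then have kn: "1 \<le> k" "k < n" "k \<le> n" by auto
    from step obtain Q where Q: "\<And>m. 1 \<le> m \<Longrightarrow> m < k \<Longrightarrow> degree (Q m) < m"
      "upper_left k (act n Q k B) = upper_left k B'" by auto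
    define C where "C = act n Q k B"
    have C: "C \<in> carrier_mat n n" using B kn by (simp add: C_def)
    \<comment> \<open>Invariance hands the hypotheses on \<open>B\<close> over to the partially
      moved \<open>C\<close>.\<close>
    have lev: "same_levels n B C" unfolding C_def by (rule same_levels_act[OF B kn(3)])
    let ?A = "upper_left k B'"
    have AC: "upper_left k C = ?A" using Q(2) by (simp add: C_def)
    have nd: "nonderogatory ?A" by (rule nonderogatory_upper_left[OF sreg(2) kn(1,3)])
    have char': "char_poly (upper_left (Suc k) C) = char_poly (upper_left (Suc k) B')"
      using lev kn char[of "Suc k"] by (auto simp: same_levels_def)
    have sr: "sreg_at ?A (border_col k C) (border_row k C)" "sreg_at ?A (border_col k B') (border_row k B')"
      using sreg kn lev AC by (auto simp: sreg_def same_levels_def)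
    have "excites ?A (border_col k C) w = excites ?A (border_col k B') w" if w: "poly (char_poly ?A) w = 0" for w
    \<comment> \<open>The hypothesis \<open>ex\<close> speaks of common roots only; at the other
      roots both matrices excite automatically.\<close>
    proof (cases "poly (char_poly (upper_left (Suc k) B')) w = 0")
      case True
      then have "excites_level B k w = excites_level B' k w"
        using kn w char[of k] char[of "Suc k"] by (intro ex) auto
      then show ?thesis using lev AC kn by (auto simp: same_levels_def)
    next
      case False
      have k0: "k > 0" using kn by simp
      have "poly (char_poly (bordered ?A (border_col k B') (border_row k B') (B' $$ (k, k)))) w \<noteq> 0"
        using False unfolding upper_left_Suc .
      moreover have "poly (char_poly (bordered ?A (border_col k C) (border_row k C) (C $$ (k, k)))) w \<noteq> 0"
        using False unfolding char'[symmetric] unfolding upper_left_Suc AC .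
      ultimately show ?thesis
        using excites_if_not_root[OF upper_left_closed nd k0 border_closed w] by blast
    qed
    with border_transitive[OF upper_left_closed nd _ border_closed(1) border_closed(1) border_closed(2) border_closed(2) sr, of "C $$ (k, k)" "B' $$ (k, k)"]
    obtain q where d: "C $$ (k, k) = B' $$ (k, k)" and q: "exp_poly ?A q * border_col k C = border_col k B'"
      "border_row k C = border_row k B' * exp_poly ?A q"
      using char' kn unfolding upper_left_Suc AC by auto
    define q' where "q' = q mod char_poly ?A"
    have q': "degree q' < k" "exp_poly ?A q' = exp_poly ?A q"
      using degree_mod_less[of "char_poly ?A" q] char_poly_facts[OF upper_left_closed[of k B']] kn
      by (auto simp: q'_def exp_poly_mod[of _ k])
    define Q' where "Q' = Q(k := q')"
    have act: "act n Q' (Suc k) B = flow n k q' C"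
      using act_cong[of k Q' Q n B] kn B by (simp add: act_Suc Q'_def C_def)
    have E: "exp_poly ?A q' \<in> carrier_mat k k" "exp_poly ?A (- q') \<in> carrier_mat k k" by simp_all
    note bc = border_conj_pad_one[OF E order_refl kn(2) C, unfolded pad_one_self[OF E(1)] pad_one_self[OF E(2)]]
    have "border_row k C * exp_poly ?A (- q') = border_row k B' * (exp_poly ?A q' * exp_poly ?A (- q'))"
      unfolding q'(2)[symmetric] q(2) by (rule assoc_mult_mat[of _ 1 k _ k _ k]) auto
    also have "\<dots> = border_row k B'" by (simp add: exp_poly_minus(1)[of _ k] right_mult_one_mat[of _ 1])
    finally have UL: "upper_left (Suc k) (flow n k q' C) = upper_left (Suc k) B'"
      unfolding upper_left_Suc upper_left_flow[OF C kn(3) order_refl] AC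
      unfolding flow_def AC bc by (simp add: q'(2) q(1) d)
    have "\<forall>m. 1 \<le> m \<longrightarrow> m < Suc k \<longrightarrow> degree (Q' m) < m"
      using Q(1) q'(1) by (auto simp: Q'_def less_Suc_eq)
    then show ?case by (intro exI[of _ Q'] conjI) (simp_all only: act UL)
  qed
  from this[OF n order_refl] obtain Q where "\<forall>m. 1 \<le> m \<longrightarrow> m < n \<longrightarrow> degree (Q m) < m"
    "upper_left n (act n Q n B) = upper_left n B'" by blast
  then show ?thesis using B B' by (auto simp: upper_left_self)
qed

section \<open>Construction of matrices with prescribed level data\<close>

lemma upper_left_bordered:
  assumes "B \<in> carrier_mat k k" "j \<le> k"
  shows "upper_left j (bordered B b c d) = upper_left j B"
  by (rule eq_matI) (use assms in \<open>auto simp: upper_left_def bordered_def\<close>)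

lemma border_bordered:
  assumes B: "B \<in> carrier_mat k k" and b: "b \<in> carrier_mat k 1" and c: "c \<in> carrier_mat 1 k"
  shows "border_col k (bordered B b c d) = b" "border_row k (bordered B b c d) = c"
  using assms by (auto simp: border_col_def border_row_def bordered_def One_nat_def intro!: eq_matI)

lemma matrix_exists:
  fixes P :: "nat \<Rightarrow> complex poly"
  assumes P: "\<And>k. 1 \<le> k \<Longrightarrow> degree (P k) = k \<and> lead_coeff (P k) = 1"
    and "1 \<le> n"
  shows "\<exists>B. B \<in> carrier_mat n n \<and> (\<forall>k. 1 \<le> k \<longrightarrow> k \<le> n \<longrightarrow> char_poly (upper_left k B) = P k) \<and> sreg n B
    \<and> (\<forall>k w. 1 \<le> k \<longrightarrow> k < n \<longrightarrow> poly (P k) w = 0 \<longrightarrow> poly (P (Suc k)) w = 0 \<longrightarrow> (excites_level B k w \<longleftrightarrow> (k, w) \<in> S))"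
  using \<open>1 \<le> n\<close>
proof (induction n rule: dec_induct)
  case base
  define B where "B = mat 1 1 (\<lambda>_. - coeff (P 1) 0)"
  have B: "B \<in> carrier_mat 1 1" by (simp add: B_def)
  have "char_poly B = [:coeff (P 1) 0, 1:]"
    using B unfolding char_poly_def by (subst det_single) (auto simp: char_poly_matrix_def B_def)
  also have "\<dots> = P 1"
    using P[of 1] by (intro poly_eqI) (auto simp: coeff_pCons coeff_eq_0 One_nat_def split: nat.splits)
  finally show ?case using B upper_left_self[OF B] by (intro exI[of _ B]) (auto simp: sreg_def dest: le_antisym)
next
  case (step n)
  then obtain B where B: "B \<in> carrier_mat n n" and char: "\<And>k. 1 \<le> k \<Longrightarrow> k \<le> n \<Longrightarrow> char_poly (upper_left k B) = P k"
    and sreg: "sreg n B" and ex: "\<And>k w. 1 \<le> k \<Longrightarrow> k < n \<Longrightarrow> poly (P k) w = 0 \<Longrightarrow> poly (P (Suc k)) w = 0 \<Longrightarrow> (excites_level B k w \<longleftrightarrow> (k, w) \<in> S)"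
    by blast
  have charB: "char_poly B = P n" using char[of n] step upper_left_self[OF B] by simp
  have nd: "nonderogatory B" using nonderogatory_upper_left[OF sreg step(1) order_refl] upper_left_self[OF B] by simp
  \<comment> \<open>\<open>border_exists\<close> accepts only common roots, so S is cut down to
    those of level n.\<close>
  have "\<exists>b c d. b \<in> carrier_mat n 1 \<and> c \<in> carrier_mat 1 n \<and> char_poly (bordered B b c d) = P (Suc n) \<and> sreg_at B b c
    \<and> (\<forall>w. poly (char_poly B) w = 0 \<longrightarrow> poly (P (Suc n)) w = 0 \<longrightarrow>
         (excites B b w \<longleftrightarrow> w \<in> {w. (n, w) \<in> S \<and> poly (P n) w = 0 \<and> poly (P (Suc n)) w = 0}))"
    by (rule border_exists[OF B nd]) (use step P[of "Suc n"] charB in auto)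
  then obtain b c d where bcd: "b \<in> carrier_mat n 1" "c \<in> carrier_mat 1 n"
    "char_poly (bordered B b c d) = P (Suc n)" "sreg_at B b c"
    "\<And>w. poly (P n) w = 0 \<Longrightarrow> poly (P (Suc n)) w = 0 \<Longrightarrow> (excites B b w \<longleftrightarrow> (n, w) \<in> S)"
    unfolding charB by blast
  define C where "C = bordered B b c d"
  have C: "C \<in> carrier_mat (Suc n) (Suc n)" using bordered_closed[OF B] by (simp only: C_def Suc_eq_plus1)
  have UL: "upper_left k C = upper_left k B" if "k \<le> n" for k
    unfolding C_def by (rule upper_left_bordered[OF B that])
  have bc: "border_col k C = border_col k B" "border_row k C = border_row k B" if "k < n" for k
    using border_cong[OF UL[of "Suc k"]] that by auto
  have top: "upper_left n C = B" "border_col n C = b" "border_row n C = c"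
    using UL[of n] upper_left_self[OF B] border_bordered[OF B bcd(1,2)] by (auto simp: C_def)
  show ?case
  proof (rule exI[of _ C], intro conjI allI impI)
    fix k assume "1 \<le> k" "k \<le> Suc n"
    then show "char_poly (upper_left k C) = P k"
      using char UL upper_left_self[OF C] bcd(3) by (cases "k = Suc n") (auto simp: C_def)
  next
    show "sreg (Suc n) C" unfolding sreg_def
    proof (intro allI impI)
      fix k assume "1 \<le> k" "k < Suc n"
      then show "sreg_level C k" using sreg bcd(4) top UL bc by (cases "k = n") (auto simp: sreg_def)
    qed
  next
    fix k w assume "1 \<le> k" "k < Suc n" "poly (P k) w = 0" "poly (P (Suc k)) w = 0"
    then show "excites_level C k w \<longleftrightarrow> (k, w) \<in> S"
      using ex bcd(5) top UL bc by (cases "k = n") auto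
  qed (rule C)
qed

section \<open>Stabilisers\<close>

lemma upper_left_dim [simp]:
  "dim_row (upper_left m B) = m" "dim_col (upper_left m B) = m"
  "dim_row (poly_mat (upper_left m B) p) = m" "dim_col (poly_mat (upper_left m B) p) = m"
  using carrier_matD[OF upper_left_closed] poly_mat_dim[OF upper_left_closed] by auto

lemma mat_exp_zero: "mat_exp (0\<^sub>m m m) = 1\<^sub>m m"
  using exp_poly_0[of "0\<^sub>m m m" m] by (simp add: exp_poly_def poly_mat_0)

text \<open>p(A) b = 0 says that b intertwines the 1 x 1 zero matrix with p(A), and the exponential
  of zero is 1.\<close>

lemma exp_poly_fixes:
  assumes A: "A \<in> carrier_mat m m" and b: "b \<in> carrier_mat m 1" and c: "c \<in> carrier_mat 1 m"
  shows "poly_mat A p * b = 0\<^sub>m m 1 \<Longrightarrow> exp_poly A p * b = b"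
    and "c * poly_mat A p = 0\<^sub>m 1 m \<Longrightarrow> c * exp_poly A p = c"
proof -
  have Z: "0\<^sub>m 1 1 \<in> carrier_mat 1 (1 :: nat)" by simp
  show "exp_poly A p * b = b" if "poly_mat A p * b = 0\<^sub>m m 1"
    using mat_exp_intertwine[OF Z poly_mat_closed[OF A] b, of p] that b
    by (simp add: right_mult_zero_mat[of _ m 1] mat_exp_zero exp_poly_def right_mult_one_mat[OF b])
  show "c * exp_poly A p = c" if "c * poly_mat A p = 0\<^sub>m 1 m"
    using mat_exp_intertwine[OF poly_mat_closed[OF A] Z c, of p] that c
    by (simp add: left_mult_zero_mat[of _ 1] mat_exp_zero exp_poly_def left_mult_one_mat[OF c])
qed

lemma flow_trivial:
  assumes B: "B \<in> carrier_mat n n" and m: "m \<le> n" and e: "exp_poly (upper_left m B) q = 1\<^sub>m m"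
  shows "flow n m q B = B"
proof -
  have "exp_poly (upper_left m B) (- q) = 1\<^sub>m m"
    using exp_poly_minus(1)[OF upper_left_closed[of m B], of q] by (simp add: e left_mult_one_mat[of _ m])
  then show ?thesis using B m by (simp add: flow_def e pad_one_one)
qed

text \<open>Upward induction isolates the levels: lower ones act trivially and higher ones fix
  B_(k+1), so the flow of level k alone fixes B_(k+1). Its exponential E then fixes b and c, and E -
  1 is a polynomial in B_k that strong regularity forces to vanish.\<close>

lemma stabilizer_exp_trivial:
  assumes B: "B \<in> carrier_mat n n" and sreg: "sreg n B" and fix_B: "act n Q n B = B"
    and k: "1 \<le> k" "k < n"
  shows "exp_poly (upper_left k B) (Q k) = 1\<^sub>m k"
proof -
  have "act n Q k B = B \<and> (\<forall>j. 1 \<le> j \<longrightarrow> j < k \<longrightarrow> exp_poly (upper_left j B) (Q j) = 1\<^sub>m j)" if "1 \<le> k" "k \<le> n" for k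
    using that
  proof (induction k rule: dec_induct)
    case (step k)
    then have kn: "1 \<le> k" "k < n" "k \<le> n" by auto
    from step have IH: "act n Q k B = B" "\<And>j. 1 \<le> j \<Longrightarrow> j < k \<Longrightarrow> exp_poly (upper_left j B) (Q j) = 1\<^sub>m j" by auto
    let ?A = "upper_left k B"
    have act: "act n Q (Suc k) B = flow n k (Q k) B" using act_Suc[OF B kn(1,3)] IH(1) by simp
    have "upper_left (Suc k) (flow n k (Q k) B) = upper_left (Suc k) (act n Q n B)"
      using upper_left_act[OF B order_refl, of "Suc k" n Q] kn unfolding act by simp
    then have UL: "upper_left (Suc k) (flow n k (Q k) B) = upper_left (Suc k) B" unfolding fix_B .
    have E: "exp_poly ?A (Q k) \<in> carrier_mat k k" "exp_poly ?A (- Q k) \<in> carrier_mat k k" by simp_all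
    note bc = border_conj_pad_one[OF E order_refl kn(2) B, unfolded pad_one_self[OF E(1)] pad_one_self[OF E(2)], folded flow_def]
    have fix_col: "exp_poly ?A (Q k) * border_col k B = border_col k B"
      using border_cong(2)[OF UL] bc(1) by simp
    have "border_row k B * exp_poly ?A (- Q k) = border_row k B"
      using border_cong(3)[OF UL] bc(2) by simp
    then have "border_row k B * exp_poly ?A (- Q k) * exp_poly ?A (Q k) = border_row k B * exp_poly ?A (Q k)" by simp
    then have fix_row: "border_row k B * exp_poly ?A (Q k) = border_row k B"
      using exp_poly_minus(2)[OF upper_left_closed, of k B "Q k"]
      by (simp add: assoc_mult_mat[of _ 1 k _ k _ k] right_mult_one_mat[of _ 1])
    obtain v where "cyclic_vector ?A k v"
      using cyclic_vector_exists[OF upper_left_closed nonderogatory_upper_left[OF sreg kn(1,3)]] by blast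
    then interpret cyclic_vector ?A k v .
    obtain r where r: "exp_poly ?A (Q k) = poly_mat ?A r" using exp_poly_is_poly by blast
    define p where "p = (r - 1) mod cp"
    have "degree p < k" using degree_mod_char_poly kn by (simp add: p_def)
    moreover have p: "poly_mat ?A p = exp_poly ?A (Q k) - 1\<^sub>m k"
      by (simp add: p_def poly_mat_mod poly_mat_diff[OF A] r poly_mat_1[OF A])
    have "poly_mat ?A p * border_col k B = 0\<^sub>m k 1"
      unfolding p minus_mult_distrib_mat[OF E(1) one_carrier_mat border_closed(1)] fix_col
      by (simp add: left_mult_one_mat[OF border_closed(1)])
    moreover have "border_row k B * poly_mat ?A p = 0\<^sub>m 1 k"
      unfolding p mult_minus_distrib_mat[OF border_closed(2) E(1) one_carrier_mat] fix_row
      by (simp add: right_mult_one_mat[OF border_closed(2)])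
    moreover have "sreg_level B k" using sreg kn(1,2) unfolding sreg_def by blast
    ultimately have "p = 0" by (simp add: sreg_at_def)
    then have "poly_mat ?A (r - 1) = 0\<^sub>m k k" by (metis p_def poly_mat_mod poly_mat_0 dims(1))
    then have "poly_mat ?A r = poly_mat ?A 1"
      using poly_mat_add[OF A, of "r - 1" 1] by (simp add: left_add_zero_mat[of _ k k])
    then have e: "exp_poly ?A (Q k) = 1\<^sub>m k" by (simp add: r poly_mat_1[OF A])
    then show ?case using flow_trivial[OF B kn(3) e] act IH(2) by (auto simp: less_Suc_eq)
  qed auto
  from this[of n] k show ?thesis by auto
qed

text \<open>For two elements of the stabiliser the difference p of their level-m polynomials
  satisfies exp(p(B_m)) = 1. If they are close, p(B_m) = 0, and p = 0 because B_m is
  nonderogatory.\<close>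

lemma discrete_stabilizer_if_sreg:
  assumes B: "B \<in> carrier_mat n n" and sreg: "sreg n B"
  shows "discrete (Group_Action.stabilizer (gz_group n) (gz_action n) B)"
proof (rule discreteI)
  fix z assume z: "z \<in> Group_Action.stabilizer (gz_group n) (gz_action n) B"
  define S where "S = Group_Action.stabilizer (gz_group n) (gz_action n) B"
  \<comment> \<open>Entry (i, j) of p(B_m), written out as a linear form in the coordinates, which
    shows its continuity in the product topology.\<close>
  define ent where "ent z' = (\<lambda>(m, i, j). \<Sum>k<m. (z' (m, Suc k) - z (m, Suc k)) * (upper_left m B ^\<^sub>m k) $$ (i, j))" for z' :: "nat \<times> nat \<Rightarrow> complex"
  define J where "J = (SIGMA m:{1..<n}. {..<m} \<times> {..<m})"
  \<comment> \<open>Finitely many conditions, each matching the smallness hypothesis of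
    \<open>exp_eq_1_imp_0\<close>.\<close>
  define T where "T = (\<Inter>x\<in>J. {z'. real (fst x) * norm (ent z' x) < 1})"
  have "open {z'. real (fst x) * norm (ent z' x) < 1}" for x
  proof -
    obtain m i j where x: "x = (m, i, j)" by (cases x) auto
    have "continuous_on UNIV (\<lambda>z'. ent z' x)" unfolding x ent_def
      by (auto intro!: continuous_intros continuous_on_product_coordinates)
    then show ?thesis by (intro open_Collect_less continuous_intros)
  qed
  then have "open T" unfolding T_def J_def by (intro open_INT) auto
  moreover have "T \<inter> S = {z}"
  proof (intro equalityI subsetI)
    fix z' assume "z' \<in> T \<inter> S"
    then have T: "z' \<in> T" and z': "z' \<in> carrier (gz_group n)" "act n (row_poly z') n B = B"
      using B by (auto simp: S_def Group_Action.stabilizer_def gz_action_eq_act)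
    have z0: "z \<in> carrier (gz_group n)" "act n (row_poly z) n B = B"
      using z B by (auto simp: Group_Action.stabilizer_def gz_action_eq_act)
    have "row_poly z' m = row_poly z m" if m: "1 \<le> m" "m < n" for m
    proof -
      let ?A = "upper_left m B"
      define p where "p = row_poly z' m - row_poly z m"
      have A: "?A \<in> carrier_mat m m" by simp
      have deg: "degree p < m" unfolding p_def using m by (intro degree_diff_less degree_row_poly) auto
      have "exp_poly ?A p = exp_poly ?A (row_poly z' m) * exp_poly ?A (- row_poly z m)"
        using exp_poly_add[OF A, of "row_poly z' m" "- row_poly z m"] by (simp add: p_def)
      moreover have "exp_poly ?A (- row_poly z m) = 1\<^sub>m m"
        using exp_poly_minus(1)[OF A, of "row_poly z m"] stabilizer_exp_trivial[OF B sreg z0(2) m]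
        by (simp add: left_mult_one_mat[of _ m])
      ultimately have e: "mat_exp (poly_mat ?A p) = 1\<^sub>m m"
        using stabilizer_exp_trivial[OF B sreg z'(2) m] by (simp add: exp_poly_def)
      have "real m * norm (poly_mat ?A p $$ (i, j)) < 1" if ij: "i < m" "j < m" for i j
      proof -
        have "(m, i, j) \<in> J" using ij m by (simp add: J_def)
        with T have "real m * norm (ent z' (m, i, j)) < 1" by (force simp: T_def)
        then show ?thesis
          using poly_mat_index[OF A ij deg] by (simp add: ent_def p_def coeff_row_poly)
      qed
      from exp_eq_1_imp_0[OF poly_mat_closed[OF A] e this] have "poly_mat ?A p = 0\<^sub>m m m" by simp
      then have "p = 0" using nonderogatory_upper_left[OF sreg, of m] m deg carrier_matD[OF A]
        by (simp add: nonderogatory_def)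
      then show ?thesis by (simp add: p_def)
    qed
    then have coords: "z' (m, Suc k) = z (m, Suc k)" if "1 \<le> m" "m < n" "k < m" for m k
      using that by (metis coeff_row_poly)
    have "z' x = z x" for x
    proof (cases "x \<in> gz_indices n")
      case True
      then obtain m i where "x = (m, i)" "1 \<le> i" "i \<le> m" "m \<le> n - 1" by (auto simp: gz_indices_def)
      then show ?thesis using coords[of m "i - 1"] by auto
    next
      case False
      then show ?thesis using z'(1) z0(1) by (cases x) (simp add: gz_group_def)
    qed
    then show "z' \<in> {z}" by auto
  next
    fix z' assume "z' \<in> {z}"
    then show "z' \<in> T \<inter> S" using z by (auto simp: T_def S_def ent_def)
  qed
  ultimately show "z isolated_in Group_Action.stabilizer (gz_group n) (gz_action n) B"
    using z by (auto intro!: isolated_inI[of z _ T] simp: S_def)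
qed

lemma act_skip:
  assumes B: "B \<in> carrier_mat n n" and "1 \<le> a" "a \<le> b" "b \<le> n"
    and 0: "\<And>k. a \<le> k \<Longrightarrow> k < b \<Longrightarrow> Q k = 0"
  shows "act n Q b B = act n Q a B"
  using \<open>a \<le> b\<close> \<open>b \<le> n\<close> 0
proof (induction b rule: dec_induct)
  case (step b)
  then show ?case using B \<open>1 \<le> a\<close> by (simp add: act_Suc flow_0)
qed simp

lemma upper_left_Suc_flow_fixed:
  assumes B: "B \<in> carrier_mat n n" and m: "m < n"
    and p: "poly_mat (upper_left m B) p * border_col m B = 0\<^sub>m m 1" "border_row m B * poly_mat (upper_left m B) p = 0\<^sub>m 1 m"
  shows "upper_left (Suc m) (flow n m p B) = upper_left (Suc m) B"
proof -
  let ?A = "upper_left m B"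
  have A: "?A \<in> carrier_mat m m" by simp
  have E: "exp_poly ?A p \<in> carrier_mat m m" "exp_poly ?A (- p) \<in> carrier_mat m m" by simp_all
  note bc = border_conj_pad_one[OF E order_refl m B, unfolded pad_one_self[OF E(1)] pad_one_self[OF E(2)], folded flow_def]
  have "border_row m B * poly_mat ?A (- p) = - (border_row m B * poly_mat ?A p)"
    unfolding poly_mat_uminus[OF A] by (rule uminus_mult_right_mat) (use carrier_matD[OF poly_mat_closed[OF A, of p]] in simp)
  then have "border_row m B * poly_mat ?A (- p) = 0\<^sub>m 1 m" using p(2) by auto
  then have "border_row m B * exp_poly ?A (- p) = border_row m B" "exp_poly ?A p * border_col m B = border_col m B"
    using exp_poly_fixes[OF A border_closed] p(1) by blast+
  then show ?thesis
    unfolding upper_left_Suc using upper_left_flow[OF B less_imp_le[OF m] order_refl] bc by simp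
qed

text \<open>If \<open>p\<close> violates strong regularity at level \<open>m\<close>, the conjugation by \<open>exp (p(B\<^sub>m))\<close> fixes
  \<open>B\<^sub>m\<^sub>+\<^sub>1\<close>. On the whole of \<open>B\<close> it is undone at level \<open>m + 1\<close>: its generator commutes with
  \<open>B\<^sub>m\<^sub>+\<^sub>1\<close>, so it is a polynomial in \<open>B\<^sub>m\<^sub>+\<^sub>1\<close> unless \<open>B\<^sub>m\<^sub>+\<^sub>1\<close> is derogatory, and in that case a
  nonzero polynomial of low degree kills \<open>B\<^sub>m\<^sub>+\<^sub>1\<close>.\<close>
lemma stabilizer_line_if_not_sreg:
  assumes B: "B \<in> carrier_mat n n" and "\<not> sreg n B"
  shows "\<exists>q. (\<forall>m. 1 \<le> m \<longrightarrow> m < n \<longrightarrow> degree (q m) < m) \<and> (\<exists>m. 1 \<le> m \<and> m < n \<and> q m \<noteq> 0)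
    \<and> (\<forall>t. act n (\<lambda>m. Polynomial.smult t (q m)) n B = B)"
proof -
  from assms(2) obtain m where m: "1 \<le> m" "m < n" "\<not> sreg_level B m" by (auto simp: sreg_def)
  let ?A = "upper_left m B"
  have A: "?A \<in> carrier_mat m m" by simp
  obtain p where p: "degree p < m" "p \<noteq> 0" "poly_mat ?A p * border_col m B = 0\<^sub>m m 1"
    "border_row m B * poly_mat ?A p = 0\<^sub>m 1 m"
    using m(3) carrier_matD[OF A] by (auto simp: sreg_at_def)
  have tp: "poly_mat ?A (Polynomial.smult t p) * border_col m B = 0\<^sub>m m 1"
    "border_row m B * poly_mat ?A (Polynomial.smult t p) = 0\<^sub>m 1 m" for t
    unfolding poly_mat_smult[OF A] mult_smult_assoc_mat[OF poly_mat_closed[OF A] border_closed(1)]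
      mult_smult_distrib[OF border_closed(2) poly_mat_closed[OF A]] p by auto
  have fix_up: "upper_left (Suc m) (flow n m (Polynomial.smult t p) B) = upper_left (Suc m) B" for t
    by (rule upper_left_Suc_flow_fixed[OF B m(2) tp])
  have one_level: "act n (\<lambda>k. Polynomial.smult t (if k = j then q else 0)) n B = flow n j (Polynomial.smult t q) B"
    if "1 \<le> j" "j < n" for j q t
  proof -
    let ?Q = "\<lambda>k. Polynomial.smult t (if k = j then q else 0)"
    have "act n ?Q n B = act n ?Q (Suc j) B" using that by (intro act_skip[OF B]) auto
    also have "\<dots> = flow n j (Polynomial.smult t q) (act n ?Q j B)" using act_Suc[OF B, of j ?Q] that by simp
    also have "act n ?Q j B = act n ?Q 1 B" using that by (intro act_skip[OF B]) auto
    finally show ?thesis by simp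
  qed
  show ?thesis
  proof (cases "Suc m = n")
    \<comment> \<open>At the top level B_(m+1) is B itself, and nothing has to be undone.\<close>
    case True
    have "flow n m (Polynomial.smult t p) B = B" for t
      using fix_up[of t] upper_left_self[OF B] upper_left_self[OF flow_closed[OF B], of m] m True by simp
    then show ?thesis using one_level[OF m(1,2)] p(1,2) m
      by (intro exI[of _ "\<lambda>k. if k = m then p else 0"]) auto
  next
    case False
    then have Sm: "1 \<le> Suc m" "Suc m < n" using m by auto
    let ?C = "upper_left (Suc m) B"
    have C: "?C \<in> carrier_mat (Suc m) (Suc m)" by simp
    show ?thesis
    proof (cases "nonderogatory ?C")
      case False
      then obtain q where q: "degree q < Suc m" "q \<noteq> 0" "poly_mat ?C q = 0\<^sub>m (Suc m) (Suc m)"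
        using carrier_matD[OF C] by (auto simp: nonderogatory_def)
      have "flow n (Suc m) (Polynomial.smult t q) B = B" for t
      proof (rule flow_trivial[OF B])
        have "poly_mat ?C (Polynomial.smult t q) = 0\<^sub>m (Suc m) (Suc m)"
          unfolding poly_mat_smult[OF C] q by auto
        then show "exp_poly ?C (Polynomial.smult t q) = 1\<^sub>m (Suc m)" by (simp add: exp_poly_def mat_exp_zero)
      qed (use Sm in simp)
      then show ?thesis using one_level[OF Sm] q(1,2) Sm
        by (intro exI[of _ "\<lambda>k. if k = Suc m then q else 0"]) auto
    next
      case True
      \<comment> \<open>The generator diag(p(A), 0) of the level-m flow; the two annihilation
        conditions on p are what makes it commute with B_(m+1).\<close>
      define X where "X = extend_by_zeros (Suc m) (poly_mat ?A p)"
      have pA: "poly_mat ?A p \<in> carrier_mat m m" by simp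
      have X: "X = four_block_mat (poly_mat ?A p) (0\<^sub>m m 1) (0\<^sub>m 1 m) (0\<^sub>m 1 1)"
        unfolding X_def extend_by_zeros_def by (simp add: Let_def One_nat_def)
      have Xc: "X \<in> carrier_mat (Suc m) (Suc m)"
        unfolding X Suc_eq_plus1 by (rule four_block_carrier_mat) auto
      have comm: "poly_mat ?A p * ?A = ?A * poly_mat ?A p"
        using poly_mat_intertwine[OF A A A refl, of p] by simp
      have d: "mat 1 1 (\<lambda>_. B $$ (m, m)) \<in> carrier_mat 1 1" by simp
      have pAA: "poly_mat ?A p * ?A \<in> carrier_mat m m" "?A * poly_mat ?A p \<in> carrier_mat m m"
        by (simp_all add: mult_carrier_mat[of _ m m])
      have z: "four_block_mat (poly_mat ?A p * ?A + 0\<^sub>m m 1 * border_row m B) (poly_mat ?A p * border_col m B + 0\<^sub>m m 1 * mat 1 1 (\<lambda>_. B $$ (m, m)))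
           (0\<^sub>m 1 m * ?A + 0\<^sub>m 1 1 * border_row m B) (0\<^sub>m 1 m * border_col m B + 0\<^sub>m 1 1 * mat 1 1 (\<lambda>_. B $$ (m, m)))
         = four_block_mat (poly_mat ?A p * ?A) (0\<^sub>m m 1) (0\<^sub>m 1 m) (0\<^sub>m 1 1)"
        unfolding p(3) left_mult_zero_mat[OF border_closed(2)] left_mult_zero_mat[OF border_closed(1)] left_mult_zero_mat[OF A] left_mult_zero_mat[OF d]
        using pAA by (simp add: right_add_zero_mat[of _ m m])
      have z': "four_block_mat (?A * poly_mat ?A p + border_col m B * 0\<^sub>m 1 m) (?A * 0\<^sub>m m 1 + border_col m B * 0\<^sub>m 1 1)
           (border_row m B * poly_mat ?A p + mat 1 1 (\<lambda>_. B $$ (m, m)) * 0\<^sub>m 1 m) (border_row m B * 0\<^sub>m m 1 + mat 1 1 (\<lambda>_. B $$ (m, m)) * 0\<^sub>m 1 1)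
         = four_block_mat (?A * poly_mat ?A p) (0\<^sub>m m 1) (0\<^sub>m 1 m) (0\<^sub>m 1 1)"
        unfolding p(4) right_mult_zero_mat[OF border_closed(2)] right_mult_zero_mat[OF border_closed(1)] right_mult_zero_mat[OF A] right_mult_zero_mat[OF d]
        using pAA by (simp add: right_add_zero_mat[of _ m m])
      have XC: "X * ?C = ?C * X"
        unfolding X upper_left_Suc bordered_def
          mult_four_block_mat[OF pA zero_carrier_mat zero_carrier_mat zero_carrier_mat A border_closed d]
          mult_four_block_mat[OF A border_closed d pA zero_carrier_mat zero_carrier_mat zero_carrier_mat]
          z z' unfolding comm ..
      obtain v where "cyclic_vector ?C (Suc m) v" using cyclic_vector_exists[OF C True] by blast
      then interpret cv: cyclic_vector ?C "Suc m" v .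
      obtain r where r: "X = poly_mat ?C r" using cv.commuting_mat_poly_exists[OF Xc XC] by blast
      define q where "q = r mod char_poly ?C"
      have q: "degree q < Suc m" "poly_mat ?C q = X"
        using cv.degree_mod_char_poly by (simp_all add: q_def cv.poly_mat_mod r)
      have exp_q: "exp_poly ?C (Polynomial.smult t q) = pad_one (Suc m) (exp_poly ?A (Polynomial.smult t p))" for t
      proof -
        have "poly_mat ?C (Polynomial.smult t q) = extend_by_zeros (Suc m) (poly_mat ?A (Polynomial.smult t p))"
          unfolding poly_mat_smult[OF C] q poly_mat_smult[OF A] X_def using carrier_matD[OF pA]
          by (intro eq_matI) (auto simp: extend_by_zeros_def Let_def)
        then show ?thesis unfolding exp_poly_def by (simp add: mat_exp_extend_by_zeros[of _ m])
      qed
      \<comment> \<open>Level m + 1 runs the same one-parameter group with the opposite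
        sign.\<close>
      define Q where "Q k = (if k = m then p else if k = Suc m then - q else 0)" for k
      have "act n (\<lambda>k. Polynomial.smult t (Q k)) n B = B" for t
      proof -
        let ?Q = "\<lambda>k. Polynomial.smult t (Q k)"
        define G where "G t = pad_one n (exp_poly ?A (Polynomial.smult t p))" for t
        have G: "G t \<in> carrier_mat n n" for t using m by (simp add: G_def)
        have GG: "G (- t) * G t = 1\<^sub>m n"
          using pad_one_exp_inverse(2)[OF A, of n "Polynomial.smult t p"] m by (simp add: G_def)
        have "act n ?Q n B = act n ?Q (Suc (Suc m)) B" using Sm by (intro act_skip[OF B]) (auto simp: Q_def)
        also have "\<dots> = flow n (Suc m) (Polynomial.smult (- t) q) (act n ?Q (Suc m) B)"
          using act_Suc[OF B, of "Suc m" ?Q] Sm by (simp add: Q_def)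
        also have "act n ?Q (Suc m) B = flow n m (Polynomial.smult t p) (act n ?Q m B)"
          using act_Suc[OF B, of m ?Q] m by (simp add: Q_def)
        also have "act n ?Q m B = act n ?Q 1 B" using m by (intro act_skip[OF B]) (auto simp: Q_def)
        also have "\<dots> = B" by simp
        finally have "act n ?Q n B = flow n (Suc m) (Polynomial.smult (- t) q) (flow n m (Polynomial.smult t p) B)" .
        also have "\<dots> = G (- t) * (G t * B * G (- t)) * G t"
        proof -
          have "- Polynomial.smult (- t) q = Polynomial.smult t q" "- Polynomial.smult t p = Polynomial.smult (- t) p" by simp_all
          then show ?thesis using Sm
            unfolding flow_def[of n "Suc m"] fix_up exp_q
            by (simp add: exp_q flow_def G_def pad_one_pad_one[of _ m])
        qed
        also have "\<dots> = (G (- t) * G t) * B * (G (- t) * G t)"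
          using G B by (simp add: assoc_mult_mat[of _ n n _ n _ n] mult_carrier_mat[of _ n n _ n])
        also have "\<dots> = B" using B by (simp add: GG)
        finally show ?thesis .
      qed
      moreover have "Q m \<noteq> 0" using p(2) by (simp add: Q_def)
      moreover have "degree (Q k) < k" if "1 \<le> k" for k
        using p(1) q(1) that by (auto simp: Q_def)
      ultimately show ?thesis using m(1,2) by (intro exI[of _ Q]) blast
    qed
  qed
qed

text \<open>Without strong regularity the stabiliser contains a line t z with z nonzero, along which
  0 is not isolated.\<close>

lemma sreg_if_discrete_stabilizer:
  assumes B: "B \<in> carrier_mat n n"
    and disc: "discrete (Group_Action.stabilizer (gz_group n) (gz_action n) B)"
  shows "sreg n B"
proof (rule ccontr)
  assume "\<not> sreg n B"
  then obtain q where q: "\<And>m. 1 \<le> m \<Longrightarrow> m < n \<Longrightarrow> degree (q m) < m" "\<exists>m. 1 \<le> m \<and> m < n \<and> q m \<noteq> 0"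
    "\<And>t. act n (\<lambda>m. Polynomial.smult t (q m)) n B = B"
    using stabilizer_line_if_not_sreg[OF B] by blast
  obtain z where z: "z \<in> carrier (gz_group n)" "\<And>m. 1 \<le> m \<Longrightarrow> m < n \<Longrightarrow> row_poly z m = q m"
    using row_poly_exists[of n q] q(1) by fastforce
  define f where "f t = (\<lambda>x. t * z x)" for t
  define S where "S = Group_Action.stabilizer (gz_group n) (gz_action n) B"
  have rp: "row_poly (f t) m = Polynomial.smult t (row_poly z m)" for t m
    by (rule poly_eqI) (simp add: coeff_row_poly f_def)
  have fS: "f t \<in> S" for t
  proof -
    have "act n (row_poly (f t)) n B = act n (\<lambda>m. Polynomial.smult t (q m)) n B"
      by (rule act_cong) (simp add: rp z(2))
    then have "gz_action n (f t) B = B" using q(3) by (simp add: gz_action_eq_act[OF B])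
    moreover have "f t \<in> carrier (gz_group n)" using z(1) by (simp add: gz_group_def f_def)
    ultimately show ?thesis by (simp add: S_def Group_Action.stabilizer_def)
  qed
  have "f 0 isolated_in S" using disc fS by (auto simp: discrete_def S_def)
  then obtain T where T: "open T" "T \<inter> S = {f 0}" by (auto simp: isolated_in_def)
  have "continuous_on UNIV f"
    unfolding f_def by (intro continuous_on_coordinatewise_then_product continuous_intros)
  then have "open (f -` T)" using T(1) by (simp add: open_vimage)
  moreover have "0 \<in> f -` T" using T(2) by auto
  ultimately obtain e where e: "e > 0" "ball 0 e \<subseteq> f -` T" using open_contains_ball by blast
  define t where "t = complex_of_real (e / 2)"
  have "t \<in> ball 0 e" using e(1) by (simp add: t_def)
  then have "f t = f 0" using e(2) T(2) fS by blast
  then have "t * z x = 0 * z x" for x unfolding f_def by (rule fun_cong)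
  then have "z x = 0" for x using e(1) by (simp add: t_def)
  then have "row_poly z m = 0" for m by (intro poly_eqI) (simp add: coeff_row_poly)
  with q(2) z(2) show False by force
qed

section \<open>Counting the orbits\<close>

lemma chi_monic: "degree (chi c m) = m" "lead_coeff (chi c m) = 1"
proof -
  have co: "coeff (chi c m) j = (if j = m then 1 else 0)" if "j \<ge> m" for j
  proof -
    have "(\<Sum>i = 1..m. coeff (monom (c m i) (i - 1)) j) = 0" using that by (intro sum.neutral) auto
    then show ?thesis by (simp add: chi_def coeff_sum)
  qed
  show "degree (chi c m) = m"
    by (intro antisym degree_le le_degree) (auto simp: co)
  then show "lead_coeff (chi c m) = 1" by (simp add: co)
qed

text \<open>One element per binary choice: a level together with a root shared with the next level.
  Its cardinality is the exponent in the count.\<close>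

definition common_roots :: "(nat \<Rightarrow> nat \<Rightarrow> complex) \<Rightarrow> nat \<Rightarrow> (nat \<times> complex) set" where
  "common_roots c n = {(j, w). 1 \<le> j \<and> j < n \<and> poly (chi c j) w = 0 \<and> poly (chi c (Suc j)) w = 0}"

definition excited_class :: "(nat \<Rightarrow> nat \<Rightarrow> complex) \<Rightarrow> nat \<Rightarrow> (nat \<times> complex) set \<Rightarrow> complex mat set" where
  "excited_class c n S = {B \<in> M_set c n. sreg n B \<and> {(j, w) \<in> common_roots c n. excites_level B j w} = S}"

lemma same_levels_excited_class:
  assumes B: "B \<in> M_set c n" "sreg n B" and B': "B' \<in> carrier_mat n n" "same_levels n B B'"
  shows "B' \<in> M_set c n" "sreg n B'"
    "{(j, w) \<in> common_roots c n. excites_level B' j w} = {(j, w) \<in> common_roots c n. excites_level B j w}"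
  using assms by (auto simp: M_set_def same_levels_def sreg_def common_roots_def)

text \<open>Invariance of the level data gives one inclusion and \<open>act_transitive\<close> the
  other; \<open>row_poly_exists\<close> turns the polynomials found there into a group
  element.\<close>

lemma orbit_eq_excited_class:
  assumes n: "1 \<le> n" and B: "B \<in> M_set c n" and sreg: "sreg n B"
  shows "Group_Action.orbit (gz_group n) (gz_action n) B
    = excited_class c n {(j, w) \<in> common_roots c n. excites_level B j w}"
proof (intro equalityI subsetI)
  have Bc: "B \<in> carrier_mat n n" using B by (simp add: M_set_def)
  fix B' assume "B' \<in> Group_Action.orbit (gz_group n) (gz_action n) B"
  then obtain z where "B' = act n (row_poly z) n B"
    by (auto simp: Group_Action.orbit_def gz_action_eq_act[OF Bc])
  then have "B' \<in> carrier_mat n n" "same_levels n B B'"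
    using Bc same_levels_act[OF Bc] by auto
  from same_levels_excited_class[OF B sreg this]
  show "B' \<in> excited_class c n {(j, w) \<in> common_roots c n. excites_level B j w}"
    by (simp add: excited_class_def)
next
  have Bc: "B \<in> carrier_mat n n" using B by (simp add: M_set_def)
  fix B' assume "B' \<in> excited_class c n {(j, w) \<in> common_roots c n. excites_level B j w}"
  then have B': "B' \<in> M_set c n" "sreg n B'"
    and eq: "{(j, w) \<in> common_roots c n. excites_level B' j w} = {(j, w) \<in> common_roots c n. excites_level B j w}"
    by (auto simp: excited_class_def)
  have char: "char_poly (upper_left k B) = chi c k" "char_poly (upper_left k B') = chi c k" if "1 \<le> k" "k \<le> n" for k
    using B B' that by (auto simp: M_set_def)
  have "\<exists>Q. (\<forall>m. 1 \<le> m \<longrightarrow> m < n \<longrightarrow> degree (Q m) < m) \<and> act n Q n B = B'"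
  proof (rule act_transitive[OF Bc _ sreg B'(2)])
    show "B' \<in> carrier_mat n n" using B' by (simp add: M_set_def)
    fix k w assume k: "1 \<le> k" "k < n" "poly (char_poly (upper_left k B)) w = 0"
      "poly (char_poly (upper_left (Suc k) B)) w = 0"
    then have "(k, w) \<in> common_roots c n" using char[of k] char[of "Suc k"] by (simp add: common_roots_def)
    then show "excites_level B k w = excites_level B' k w" using eq by blast
  qed (use char n in auto)
  then obtain Q where Q: "\<And>m. 1 \<le> m \<Longrightarrow> m < n \<Longrightarrow> degree (Q m) < m" "act n Q n B = B'" by blast
  obtain z where z: "z \<in> carrier (gz_group n)" "\<forall>m\<in>{1..<n}. row_poly z m = Q m"
    using row_poly_exists[of n Q] Q(1) by blast
  have "act n (row_poly z) n B = act n Q n B" by (rule act_cong) (use z(2) in auto)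
  then have "gz_action n z B = B'" using Q(2) gz_action_eq_act[OF Bc] by simp
  then show "B' \<in> Group_Action.orbit (gz_group n) (gz_action n) B"
    using z(1) by (auto simp: Group_Action.orbit_def)
qed

text \<open>Checked directly from the zero tuple: orbits and stabilisers are used through their
  definitions only.\<close>

lemma mem_orbit_self:
  assumes B: "B \<in> carrier_mat n n"
  shows "B \<in> Group_Action.orbit (gz_group n) (gz_action n) B"
proof -
  have "row_poly (\<lambda>_. 0) m = 0" for m by (rule poly_eqI) (simp add: coeff_row_poly)
  then have "act n (row_poly (\<lambda>_. 0)) n B = B"
    using act_skip[OF B, of 1 n "row_poly (\<lambda>_. 0)"] B by (cases "n = 0") auto
  then have "gz_action n (\<lambda>_. 0) B = B" by (simp add: gz_action_eq_act[OF B])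
  moreover have "(\<lambda>_. 0) \<in> carrier (gz_group n)" by (simp add: gz_group_def)
  ultimately show ?thesis unfolding Group_Action.orbit_def by force
qed

lemma excited_class_nonempty:
  assumes "1 \<le> n" and S: "S \<subseteq> common_roots c n"
  shows "excited_class c n S \<noteq> {}"
proof -
  obtain B where B: "B \<in> carrier_mat n n" "\<And>k. 1 \<le> k \<Longrightarrow> k \<le> n \<Longrightarrow> char_poly (upper_left k B) = chi c k" "sreg n B"
    "\<And>k w. 1 \<le> k \<Longrightarrow> k < n \<Longrightarrow> poly (chi c k) w = 0 \<Longrightarrow> poly (chi c (Suc k)) w = 0 \<Longrightarrow> (excites_level B k w \<longleftrightarrow> (k, w) \<in> S)"
    using matrix_exists[of "chi c" n S] assms(1) chi_monic by blast
  have "{(j, w) \<in> common_roots c n. excites_level B j w} = S"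
    using S B(4) by (auto simp: common_roots_def)
  then have "B \<in> excited_class c n S" using B(1-3) by (simp add: excited_class_def M_set_def)
  then show ?thesis by blast
qed

lemma maximal_orbits_eq:
  assumes n: "1 \<le> n"
  shows "{Q \<in> gz_orbits n. Q \<subseteq> M_set c n \<and> gz_maximal_dimension n Q} = excited_class c n ` Pow (common_roots c n)"
proof (intro equalityI subsetI)
  fix Q assume "Q \<in> {Q \<in> gz_orbits n. Q \<subseteq> M_set c n \<and> gz_maximal_dimension n Q}"
  then obtain B where B: "B \<in> carrier_mat n n" "Q = Group_Action.orbit (gz_group n) (gz_action n) B"
    and Q: "Q \<subseteq> M_set c n" "gz_maximal_dimension n Q"
    by (auto simp: gz_orbits_def Group_Action.orbits_def)
  have BQ: "B \<in> Q" unfolding B(2) by (rule mem_orbit_self[OF B(1)])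
  then have "sreg n B" using Q(2) sreg_if_discrete_stabilizer[OF B(1)] by (simp add: gz_maximal_dimension_def)
  with orbit_eq_excited_class[OF n, of B c] BQ Q(1) B(2)
  show "Q \<in> excited_class c n ` Pow (common_roots c n)" by blast
next
  fix Q assume "Q \<in> excited_class c n ` Pow (common_roots c n)"
  then obtain S where S: "S \<subseteq> common_roots c n" "Q = excited_class c n S" by blast
  obtain B where B: "B \<in> excited_class c n S" using excited_class_nonempty[OF n S(1)] by blast
  then have "B \<in> carrier_mat n n" "Q = Group_Action.orbit (gz_group n) (gz_action n) B"
    using orbit_eq_excited_class[OF n, of B c] S(2) by (auto simp: excited_class_def M_set_def)
  then have "Q \<in> gz_orbits n" by (auto simp: gz_orbits_def Group_Action.orbits_def)
  moreover have "Q \<subseteq> M_set c n" by (auto simp: S(2) excited_class_def)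
  moreover have "gz_maximal_dimension n Q"
    unfolding gz_maximal_dimension_def S(2)
    by (auto intro!: discrete_stabilizer_if_sreg simp: excited_class_def M_set_def)
  ultimately show "Q \<in> {Q \<in> gz_orbits n. Q \<subseteq> M_set c n \<and> gz_maximal_dimension n Q}" by blast
qed

text \<open>Classes are nonempty, and any member determines the index set.\<close>

lemma inj_on_excited_class:
  assumes "1 \<le> n"
  shows "inj_on (excited_class c n) (Pow (common_roots c n))"
proof (rule inj_onI)
  fix S S' assume S: "S \<in> Pow (common_roots c n)" and eq: "excited_class c n S = excited_class c n S'"
  obtain B where B: "B \<in> excited_class c n S" using excited_class_nonempty[OF assms, of S c] S by auto
  then have "B \<in> excited_class c n S'" using eq by simp
  with B show "S = S'" unfolding excited_class_def by blast
qed

theorem corollary6p3: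
  fixes n r :: nat
    and c :: "nat \<Rightarrow> nat \<Rightarrow> complex"
    and z :: "nat \<Rightarrow> complex"
    and t :: "nat \<Rightarrow> nat"
  assumes "n \<ge> 1"
    and "bij_betw z {1..r} {w. \<exists>m \<in> {1..n}. poly (chi c m) w = 0}"
    and "\<And>i. i \<in> {1..r} \<Longrightarrow>
           t i = card {j \<in> {1..n - 1}. poly (chi c j) (z i) = 0 \<and> poly (chi c (j + 1)) (z i) = 0}"
  shows "card {Q \<in> gz_orbits n. Q \<subseteq> M_set c n \<and> gz_maximal_dimension n Q} = 2 ^ (\<Sum>i = 1..r. t i)"
proof -
  define J where "J i = {j \<in> {1..n - 1}. poly (chi c j) (z i) = 0 \<and> poly (chi c (j + 1)) (z i) = 0}" for i
  have "inj_on z {1..r}" using assms(2) by (simp add: bij_betw_def)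
  \<comment> \<open>Distinct i have distinct roots z i, so the sum of the t i counts pairs (level,
    root) without repetition.\<close>
  then have inj: "inj_on (\<lambda>(i, j). (j, z i)) (Sigma {1..r} J)"
    unfolding inj_on_def[of "\<lambda>(i, j). (j, z i)"] by (auto dest: inj_onD)
  have "(\<lambda>(i, j). (j, z i)) ` Sigma {1..r} J = common_roots c n"
  proof (intro equalityI subsetI)
    fix x assume "x \<in> (\<lambda>(i, j). (j, z i)) ` Sigma {1..r} J"
    then show "x \<in> common_roots c n" using assms(1) by (auto simp: J_def common_roots_def simp flip: Suc_eq_plus1)
  next
    fix x assume "x \<in> common_roots c n"
    then obtain j w where x: "x = (j, w)" and j: "1 \<le> j" "j < n" "poly (chi c j) w = 0" "poly (chi c (Suc j)) w = 0"
      by (auto simp: common_roots_def)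
    then have "w \<in> {w. \<exists>m \<in> {1..n}. poly (chi c m) w = 0}" by auto
    then have "w \<in> z ` {1..r}" using bij_betw_imp_surj_on[OF assms(2)] by blast
    then obtain i where i: "i \<in> {1..r}" "w = z i" by blast
    have "(i, j) \<in> Sigma {1..r} J" using i j by (auto simp: J_def simp flip: Suc_eq_plus1)
    then show "x \<in> (\<lambda>(i, j). (j, z i)) ` Sigma {1..r} J" unfolding x i by (rule rev_image_eqI) simp
  qed
  then have common: "common_roots c n = (\<lambda>(i, j). (j, z i)) ` Sigma {1..r} J" ..
  have finJ: "finite (J i)" for i by (simp add: J_def)
  have "card (common_roots c n) = (\<Sum>i = 1..r. card (J i))"
    unfolding common card_image[OF inj] by (rule card_SigmaI) (auto simp: finJ)
  also have "\<dots> = (\<Sum>i = 1..r. t i)" using assms(3) by (simp add: J_def)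
  finally have card: "card (common_roots c n) = (\<Sum>i = 1..r. t i)" .
  have "finite (common_roots c n)" unfolding common using finJ by blast
  then show ?thesis
    unfolding maximal_orbits_eq[OF assms(1)] card_image[OF inj_on_excited_class[OF assms(1)]]
    by (simp add: card_Pow card)
qed

end
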